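(* Let $R$ be a commutative ring. The category $\mathbf{Mod}$ is enriched in $\mathbf{Comod}$, with hom-objects $\mathbf{Mod}(M,N)=Q(M,N)$: there is a $\mathbf{Comod}$-enriched category with the same objects as $\mathbf{Mod}$, with hom-object from $M$ to $N$ the universal measuring comodule $Q(M,N)$, and with underlying ordinary category $\mathbf{Mod}$.
   Context: $\mathbf{Alg}_R$ and $\mathbf{Coalg}_R$ are the categories of $R$-algebras and $R$-coalgebras (monoids and comonoids in the symmetric monoidal closed category of $R$-modules). For an algebra $A$, modules are left $A$-modules $\mu:A\otimes M\to M$; for a coalgebra $C$, comodules are right $C$-comodules $\delta:X\to X\otimes C$, written $\delta(x)=\sum x_{(0)}\otimes x_{(1)}$. Global category of comodules $\mathbf{Comod}$: objects are all comodules $X$ over all $R$-coalgebras $C$, written $X_C$; a morphism $X_C\to Y_D$ is a pair $(k,g)$ with $g:C\to D$ a coalgebra map and $k:g_*X\to Y$ a $D$-comodule map, where $g_*X$ is $X$ with coaction $X\xrightarrow{\delta}X\otimes C\xrightarrow{1\otimes g}X\otimes D$. It is symmetric monoidal: $X_C\otimes Y_D$ is $X\otimes_R Y$ with the $C\otimes D$-coaction $X\otimes Y\xrightarrow{\delta_X\otimes\delta_Y}X\otimes C\otimes Y\otimes D\cong X\otimes Y\otimes C\otimes D$; the unit is $R$ as a comodule over the coalgebra $R$. Global category of modules $\mathbf{Mod}$: objects are all modules $M$ over all $R$-algebras $A$, written $M_A$; a morphism $M_A\to N_B$ is a pair $(m,f)$ with $f:A\to B$ an algebra map and $m:M\to f^\sharp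 N$ an $A$-module map, where $f^\sharp N$ is $N$ with action $A\otimes N\xrightarrow{f\otimes1}B\otimes N\xrightarrow{\mu}N$. For a coalgebra $C$ and an algebra $B$, $\mathrm{Hom}_R(C,B)$ is an algebra under convolution $(f*g)(c)=\sum f(c_1)g(c_2)$, with unit $\eta\circ\epsilon$. For a $C$-comodule $X$ and a $B$-module $N$, $\mathrm{Hom}(X,N)$ denotes the $R$-module $\mathrm{Hom}_R(X,N)$ with the $\mathrm{Hom}_R(C,B)$-action whose transpose is the composite $\mathrm{Hom}_R(C,B)\otimes\mathrm{Hom}_R(X,N)\otimes X\xrightarrow{1\otimes1\otimes\delta}\mathrm{Hom}_R(C,B)\otimes\mathrm{Hom}_R(X,N)\otimes X\otimes C\cong\mathrm{Hom}_R(C,B)\otimes C\otimes\mathrm{Hom}_R(X,N)\otimes X\xrightarrow{e\otimes e}B\otimes N\xrightarrow{\mu}N$, where the isomorphism is the symmetry and $e$ is evaluation; on elements, $(f\cdot\varphi)(x)=\sum f(x_{(1)})\,\varphi(x_{(0)})$. This gives a functor $\mathrm{Hom}:\mathbf{Comod}^{\mathrm{op}}\times\mathbf{Mod}\to\mathbf{Mod}$, $(X_C,N_B)\mapsto\mathrm{Hom}(X,N)_{\mathrm{Hom}_R(C,B)}$. The universal measuring comodule $Q(M,N)$ of $M,N\in\mathbf{Mod}$ is the object of $\mathbf{Comod}$ determined by the natural isomorphism $$\mathbf{Comod}(X,Q(M,N))\cong\mathbf{Mod}(M,\mathrm{Hom}(X,N)),$$ i.e. $Q(-,N)$ is right adjoint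 to $\mathrm{Hom}(-,N)^{\mathrm{op}}:\mathbf{Comod}\to\mathbf{Mod}^{\mathrm{op}}$ (it exists for all $M,N$). The underlying ordinary category of a category $\mathcal{K}$ enriched in a monoidal category $\mathcal{W}$ with unit $I$ has the same objects as $\mathcal{K}$ and as morphisms $M\to N$ the arrows $I\to\mathcal{K}(M,N)$ in $\mathcal{W}$. *)

theory Defs
  imports "HOL-Algebra.Module"
begin

section \<open>Categories, monoidal categories, enriched categories\<close>

text \<open>Hom-sets are indexed by source and target and are not required to be disjoint; hence
  composition takes the three objects as arguments: \<open>Cmp C X Y Z g f\<close> is \<open>g \<circ> f\<close> for
  \<open>f : X \<rightarrow> Y\<close> and \<open>g : Y \<rightarrow> Z\<close>.\<close>

record ('o, 'h) cat =
  Obj :: "'o set"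
  Arr :: "'o \<Rightarrow> 'o \<Rightarrow> 'h set"
  Idn :: "'o \<Rightarrow> 'h"
  Cmp :: "'o \<Rightarrow> 'o \<Rightarrow> 'o \<Rightarrow> 'h \<Rightarrow> 'h \<Rightarrow> 'h"

locale category =
  fixes C :: "('o, 'h, 'z) cat_scheme"
  assumes id_arr: "X \<in> Obj C \<Longrightarrow> Idn C X \<in> Arr C X X"
    and cmp_arr: "\<lbrakk>X \<in> Obj C; Y \<in> Obj C; Z \<in> Obj C; f \<in> Arr C X Y; g \<in> Arr C Y Z\<rbrakk>
      \<Longrightarrow> Cmp C X Y Z g f \<in> Arr C X Z"
    and cmp_id_right: "\<lbrakk>X \<in> Obj C; Y \<in> Obj C; f \<in> Arr C X Y\<rbrakk> \<Longrightarrow> Cmp C X X Y f (Idn C X) = f"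
    and cmp_id_left: "\<lbrakk>X \<in> Obj C; Y \<in> Obj C; f \<in> Arr C X Y\<rbrakk> \<Longrightarrow> Cmp C X Y Y (Idn C Y) f = f"
    and cmp_assoc: "\<lbrakk>X \<in> Obj C; Y \<in> Obj C; Z \<in> Obj C; W \<in> Obj C;
        f \<in> Arr C X Y; g \<in> Arr C Y Z; h \<in> Arr C Z W\<rbrakk>
      \<Longrightarrow> Cmp C X Z W h (Cmp C X Y Z g f) = Cmp C X Y W (Cmp C Y Z W h g) f"

definition inverse_arr :: "('o, 'h, 'z) cat_scheme \<Rightarrow> 'o \<Rightarrow> 'o \<Rightarrow> 'h \<Rightarrow> 'h \<Rightarrow> bool" where
  "inverse_arr C X Y f g \<longleftrightarrow> f \<in> Arr C X Y \<and> g \<in> Arr C Y X \<and>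
     Cmp C X Y X g f = Idn C X \<and> Cmp C Y X Y f g = Idn C Y"

definition iso_arr :: "('o, 'h, 'z) cat_scheme \<Rightarrow> 'o \<Rightarrow> 'o \<Rightarrow> 'h \<Rightarrow> bool" where
  "iso_arr C X Y f \<longleftrightarrow> (\<exists>g. inverse_arr C X Y f g)"

definition inv_arr :: "('o, 'h, 'z) cat_scheme \<Rightarrow> 'o \<Rightarrow> 'o \<Rightarrow> 'h \<Rightarrow> 'h" where
  "inv_arr C X Y f = (THE g. inverse_arr C X Y f g)"

text \<open>An isomorphism of categories that is the identity on objects.\<close>

definition iso_over_objects ::
  "('o, 'h, 'z) cat_scheme \<Rightarrow> ('o, 'k, 'w) cat_scheme \<Rightarrow> ('o \<Rightarrow> 'o \<Rightarrow> 'h \<Rightarrow> 'k) \<Rightarrow> bool" where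
  "iso_over_objects C D F \<longleftrightarrow> Obj C = Obj D \<and>
     (\<forall>X\<in>Obj C. \<forall>Y\<in>Obj C. bij_betw (F X Y) (Arr C X Y) (Arr D X Y)) \<and>
     (\<forall>X\<in>Obj C. F X X (Idn C X) = Idn D X) \<and>
     (\<forall>X\<in>Obj C. \<forall>Y\<in>Obj C. \<forall>Z\<in>Obj C. \<forall>f\<in>Arr C X Y. \<forall>g\<in>Arr C Y Z.
        F X Z (Cmp C X Y Z g f) = Cmp D X Y Z (F Y Z g) (F X Y f))"

text \<open>\<open>TArr W X Y X' Y' f g\<close> is \<open>f \<otimes> g\<close> for \<open>f : X \<rightarrow> X'\<close> and \<open>g : Y \<rightarrow> Y'\<close>.\<close>

record ('o, 'h) moncat = "('o, 'h) cat" +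
  Unt :: "'o"
  TObj :: "'o \<Rightarrow> 'o \<Rightarrow> 'o"
  TArr :: "'o \<Rightarrow> 'o \<Rightarrow> 'o \<Rightarrow> 'o \<Rightarrow> 'h \<Rightarrow> 'h \<Rightarrow> 'h"
  Assoc :: "'o \<Rightarrow> 'o \<Rightarrow> 'o \<Rightarrow> 'h"
  Lunit :: "'o \<Rightarrow> 'h"
  Runit :: "'o \<Rightarrow> 'h"

locale monoidal_category = category W for W :: "('o, 'h, 'z) moncat_scheme" +
  assumes unt_obj: "Unt W \<in> Obj W"
    and tobj_obj: "\<lbrakk>X \<in> Obj W; Y \<in> Obj W\<rbrakk> \<Longrightarrow> TObj W X Y \<in> Obj W"
    and tarr_arr: "\<lbrakk>X \<in> Obj W; Y \<in> Obj W; X' \<in> Obj W; Y' \<in> Obj W; f \<in> Arr W X X'; g \<in> Arr W Y Y'\<rbrakk>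
      \<Longrightarrow> TArr W X Y X' Y' f g \<in> Arr W (TObj W X Y) (TObj W X' Y')"
    and tarr_id: "\<lbrakk>X \<in> Obj W; Y \<in> Obj W\<rbrakk>
      \<Longrightarrow> TArr W X Y X Y (Idn W X) (Idn W Y) = Idn W (TObj W X Y)"
    and tarr_cmp: "\<lbrakk>X \<in> Obj W; Y \<in> Obj W; X' \<in> Obj W; Y' \<in> Obj W; X'' \<in> Obj W; Y'' \<in> Obj W;
        f \<in> Arr W X X'; f' \<in> Arr W X' X''; g \<in> Arr W Y Y'; g' \<in> Arr W Y' Y''\<rbrakk>
      \<Longrightarrow> TArr W X Y X'' Y'' (Cmp W X X' X'' f' f) (Cmp W Y Y' Y'' g' g)
        = Cmp W (TObj W X Y) (TObj W X' Y') (TObj W X'' Y'')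
            (TArr W X' Y' X'' Y'' f' g') (TArr W X Y X' Y' f g)"
    and assoc_iso: "\<lbrakk>X \<in> Obj W; Y \<in> Obj W; Z \<in> Obj W\<rbrakk>
      \<Longrightarrow> iso_arr W (TObj W (TObj W X Y) Z) (TObj W X (TObj W Y Z)) (Assoc W X Y Z)"
    and lunit_iso: "X \<in> Obj W \<Longrightarrow> iso_arr W (TObj W (Unt W) X) X (Lunit W X)"
    and runit_iso: "X \<in> Obj W \<Longrightarrow> iso_arr W (TObj W X (Unt W)) X (Runit W X)"
    and assoc_natural: "\<lbrakk>X \<in> Obj W; Y \<in> Obj W; Z \<in> Obj W; X' \<in> Obj W; Y' \<in> Obj W; Z' \<in> Obj W;
        f \<in> Arr W X X'; g \<in> Arr W Y Y'; h \<in> Arr W Z Z'\<rbrakk>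
      \<Longrightarrow> Cmp W (TObj W (TObj W X Y) Z) (TObj W (TObj W X' Y') Z') (TObj W X' (TObj W Y' Z'))
            (Assoc W X' Y' Z')
            (TArr W (TObj W X Y) Z (TObj W X' Y') Z' (TArr W X Y X' Y' f g) h)
        = Cmp W (TObj W (TObj W X Y) Z) (TObj W X (TObj W Y Z)) (TObj W X' (TObj W Y' Z'))
            (TArr W X (TObj W Y Z) X' (TObj W Y' Z') f (TArr W Y Z Y' Z' g h))
            (Assoc W X Y Z)"
    and lunit_natural: "\<lbrakk>X \<in> Obj W; Y \<in> Obj W; f \<in> Arr W X Y\<rbrakk>
      \<Longrightarrow> Cmp W (TObj W (Unt W) X) (TObj W (Unt W) Y) Y (Lunit W Y)
            (TArr W (Unt W) X (Unt W) Y (Idn W (Unt W)) f)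
        = Cmp W (TObj W (Unt W) X) X Y f (Lunit W X)"
    and runit_natural: "\<lbrakk>X \<in> Obj W; Y \<in> Obj W; f \<in> Arr W X Y\<rbrakk>
      \<Longrightarrow> Cmp W (TObj W X (Unt W)) (TObj W Y (Unt W)) Y (Runit W Y)
            (TArr W X (Unt W) Y (Unt W) f (Idn W (Unt W)))
        = Cmp W (TObj W X (Unt W)) X Y f (Runit W X)"
    and pentagon: "\<lbrakk>V \<in> Obj W; X \<in> Obj W; Y \<in> Obj W; Z \<in> Obj W\<rbrakk>
      \<Longrightarrow> Cmp W (TObj W (TObj W (TObj W V X) Y) Z) (TObj W (TObj W V (TObj W X Y)) Z)
            (TObj W V (TObj W X (TObj W Y Z)))
            (Cmp W (TObj W (TObj W V (TObj W X Y)) Z) (TObj W V (TObj W (TObj W X Y) Z))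
              (TObj W V (TObj W X (TObj W Y Z)))
              (TArr W V (TObj W (TObj W X Y) Z) V (TObj W X (TObj W Y Z))
                (Idn W V) (Assoc W X Y Z))
              (Assoc W V (TObj W X Y) Z))
            (TArr W (TObj W (TObj W V X) Y) Z (TObj W V (TObj W X Y)) Z
              (Assoc W V X Y) (Idn W Z))
        = Cmp W (TObj W (TObj W (TObj W V X) Y) Z) (TObj W (TObj W V X) (TObj W Y Z))
            (TObj W V (TObj W X (TObj W Y Z)))
            (Assoc W V X (TObj W Y Z)) (Assoc W (TObj W V X) Y Z)"
    and triangle: "\<lbrakk>X \<in> Obj W; Y \<in> Obj W\<rbrakk>
      \<Longrightarrow> Cmp W (TObj W (TObj W X (Unt W)) Y) (TObj W X (TObj W (Unt W) Y)) (TObj W X Y)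
            (TArr W X (TObj W (Unt W) Y) X Y (Idn W X) (Lunit W Y)) (Assoc W X (Unt W) Y)
        = TArr W (TObj W X (Unt W)) Y X Y (Runit W X) (Idn W Y)"

text \<open>\<open>EComp K L M N : K(M,N) \<otimes> K(L,M) \<rightarrow> K(L,N)\<close> and \<open>EId K M : I \<rightarrow> K(M,M)\<close>.\<close>

record ('e, 'o, 'h) ecat =
  EObj :: "'e set"
  EHom :: "'e \<Rightarrow> 'e \<Rightarrow> 'o"
  EComp :: "'e \<Rightarrow> 'e \<Rightarrow> 'e \<Rightarrow> 'h"
  EId :: "'e \<Rightarrow> 'h"

locale enriched_category = monoidal_category W
  for W :: "('o, 'h, 'z) moncat_scheme" and K :: "('e, 'o, 'h, 'y) ecat_scheme" +
  assumes ehom_obj: "\<lbrakk>M \<in> EObj K; N \<in> EObj K\<rbrakk> \<Longrightarrow> EHom K M N \<in> Obj W"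
    and ecomp_arr: "\<lbrakk>L \<in> EObj K; M \<in> EObj K; N \<in> EObj K\<rbrakk>
      \<Longrightarrow> EComp K L M N \<in> Arr W (TObj W (EHom K M N) (EHom K L M)) (EHom K L N)"
    and eid_arr: "M \<in> EObj K \<Longrightarrow> EId K M \<in> Arr W (Unt W) (EHom K M M)"
    and ecomp_assoc: "\<lbrakk>L \<in> EObj K; M \<in> EObj K; N \<in> EObj K; P \<in> EObj K\<rbrakk>
      \<Longrightarrow> Cmp W (TObj W (TObj W (EHom K N P) (EHom K M N)) (EHom K L M))
            (TObj W (EHom K M P) (EHom K L M)) (EHom K L P)
            (EComp K L M P)
            (TArr W (TObj W (EHom K N P) (EHom K M N)) (EHom K L M) (EHom K M P) (EHom K L M)
              (EComp K M N P) (Idn W (EHom K L M)))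
        = Cmp W (TObj W (TObj W (EHom K N P) (EHom K M N)) (EHom K L M))
            (TObj W (EHom K N P) (TObj W (EHom K M N) (EHom K L M))) (EHom K L P)
            (Cmp W (TObj W (EHom K N P) (TObj W (EHom K M N) (EHom K L M)))
              (TObj W (EHom K N P) (EHom K L N)) (EHom K L P)
              (EComp K L N P)
              (TArr W (EHom K N P) (TObj W (EHom K M N) (EHom K L M)) (EHom K N P) (EHom K L N)
                (Idn W (EHom K N P)) (EComp K L M N)))
            (Assoc W (EHom K N P) (EHom K M N) (EHom K L M))"
    and ecomp_id_left: "\<lbrakk>M \<in> EObj K; N \<in> EObj K\<rbrakk>
      \<Longrightarrow> Cmp W (TObj W (Unt W) (EHom K M N)) (TObj W (EHom K N N) (EHom K M N)) (EHom K M N)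
            (EComp K M N N)
            (TArr W (Unt W) (EHom K M N) (EHom K N N) (EHom K M N) (EId K N) (Idn W (EHom K M N)))
        = Lunit W (EHom K M N)"
    and ecomp_id_right: "\<lbrakk>M \<in> EObj K; N \<in> EObj K\<rbrakk>
      \<Longrightarrow> Cmp W (TObj W (EHom K M N) (Unt W)) (TObj W (EHom K M N) (EHom K M M)) (EHom K M N)
            (EComp K M M N)
            (TArr W (EHom K M N) (Unt W) (EHom K M N) (EHom K M M) (Idn W (EHom K M N)) (EId K M))
        = Runit W (EHom K M N)"

definition underlying_cat ::
  "('o, 'h, 'z) moncat_scheme \<Rightarrow> ('e, 'o, 'h, 'y) ecat_scheme \<Rightarrow> ('e, 'h) cat" where
  "underlying_cat W K = \<lparr>
     Obj = EObj K,
     Arr = (\<lambda>M N. Arr W (Unt W) (EHom K M N)),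
     Idn = EId K,
     Cmp = (\<lambda>L M N g f.
       Cmp W (Unt W) (TObj W (Unt W) (Unt W)) (EHom K L N)
         (Cmp W (TObj W (Unt W) (Unt W)) (TObj W (EHom K M N) (EHom K L M)) (EHom K L N)
           (EComp K L M N)
           (TArr W (Unt W) (Unt W) (EHom K M N) (EHom K L M) g f))
         (inv_arr W (TObj W (Unt W) (Unt W)) (Unt W) (Lunit W (Unt W))))\<rparr>"


section \<open>Linear maps and tensor products\<close>

text \<open>An \<open>R\<close>-module is a record satisfying the library locale \<^locale>\<open>module\<close>; its
  fields \<^const>\<open>mult\<close> and \<^const>\<open>one\<close> play no role unless it is regarded as an algebra.\<close>

definition rlinear ::
  "('r, 's) ring_scheme \<Rightarrow> ('r, 'm, 'y) module_scheme \<Rightarrow> ('r, 'n, 'z) module_scheme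
   \<Rightarrow> ('m \<Rightarrow> 'n) \<Rightarrow> bool" where
  "rlinear R M N f \<longleftrightarrow> f \<in> carrier M \<rightarrow> carrier N \<and>
     (\<forall>x\<in>carrier M. \<forall>y\<in>carrier M. f (x \<oplus>\<^bsub>M\<^esub> y) = f x \<oplus>\<^bsub>N\<^esub> f y) \<and>
     (\<forall>r\<in>carrier R. \<forall>x\<in>carrier M. f (r \<odot>\<^bsub>M\<^esub> x) = r \<odot>\<^bsub>N\<^esub> f x)"

text \<open>Linear maps as a set: extensional, so that equality of maps is equality on the carrier.\<close>

definition lin ::
  "('r, 's) ring_scheme \<Rightarrow> ('r, 'm, 'y) module_scheme \<Rightarrow> ('r, 'n, 'z) module_scheme
   \<Rightarrow> ('m \<Rightarrow> 'n) set" where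
  "lin R M N = {f. rlinear R M N f \<and> f \<in> extensional (carrier M)}"

definition bilinear ::
  "('r, 's) ring_scheme \<Rightarrow> ('r, 'l, 'x) module_scheme \<Rightarrow> ('r, 'm, 'y) module_scheme
   \<Rightarrow> ('r, 'n, 'z) module_scheme \<Rightarrow> ('l \<Rightarrow> 'm \<Rightarrow> 'n) \<Rightarrow> bool" where
  "bilinear R L M N b \<longleftrightarrow>
     (\<forall>x\<in>carrier L. rlinear R M N (b x)) \<and> (\<forall>y\<in>carrier M. rlinear R L N (\<lambda>x. b x y))"

definition ring_module :: "('r, 's) ring_scheme \<Rightarrow> ('r, 'r) module" where
  "ring_module R = \<lparr>carrier = carrier R, mult = mult R, one = one R,
     zero = zero R, add = add R, smult = mult R\<rparr>"

text \<open>The universe of elements of coalgebras and comodules. It contains an arbitrary type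
  \<open>'x\<close> and the scalars, and is closed under formal finite sums \<open>x\<^sub>1 \<otimes> y\<^sub>1 + \<dots> + x\<^sub>n \<otimes> y\<^sub>n\<close>
  (written as lists of pairs), so that the tensor product of two modules with elements in the
  universe, and the unit module, again have elements in the universe. Since \<open>'x\<close> is arbitrary,
  the universe can be as large as desired.\<close>

datatype ('r, 'x) univ =
    Atom 'x
  | Scalar (scalar: 'r)
  | Formal (formal: "(('r, 'x) univ \<times> ('r, 'x) univ) list")

type_synonym ('r, 'x) umod = "('r, ('r, 'x) univ) module"

text \<open>The congruence on formal sums whose quotient is \<open>M \<otimes>\<^sub>R N\<close>: the additive monoid of formal
  sums modulo biadditivity and \<open>rx \<otimes> y = x \<otimes> ry\<close> (additive inverses are then given by
  \<open>(-x) \<otimes> y\<close>).\<close>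

inductive tcong ::
  "('r, 's) ring_scheme \<Rightarrow> ('r, 'm, 'y) module_scheme \<Rightarrow> ('r, 'n, 'z) module_scheme
   \<Rightarrow> ('m \<times> 'n) list \<Rightarrow> ('m \<times> 'n) list \<Rightarrow> bool"
  for R :: "('r, 's) ring_scheme" and M :: "('r, 'm, 'y) module_scheme"
    and N :: "('r, 'n, 'z) module_scheme" where
  refl: "set k \<subseteq> carrier M \<times> carrier N \<Longrightarrow> tcong R M N k k"
| sym: "tcong R M N k l \<Longrightarrow> tcong R M N l k"
| trans: "tcong R M N j k \<Longrightarrow> tcong R M N k l \<Longrightarrow> tcong R M N j l"
| append: "tcong R M N k k' \<Longrightarrow> tcong R M N l l' \<Longrightarrow> tcong R M N (k @ l) (k' @ l')"
| comm: "set k \<subseteq> carrier M \<times> carrier N \<Longrightarrow> set l \<subseteq> carrier M \<times> carrier N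
    \<Longrightarrow> tcong R M N (k @ l) (l @ k)"
| add_left: "x \<in> carrier M \<Longrightarrow> x' \<in> carrier M \<Longrightarrow> y \<in> carrier N
    \<Longrightarrow> tcong R M N [(x \<oplus>\<^bsub>M\<^esub> x', y)] [(x, y), (x', y)]"
| add_right: "x \<in> carrier M \<Longrightarrow> y \<in> carrier N \<Longrightarrow> y' \<in> carrier N
    \<Longrightarrow> tcong R M N [(x, y \<oplus>\<^bsub>N\<^esub> y')] [(x, y), (x, y')]"
| balanced: "r \<in> carrier R \<Longrightarrow> x \<in> carrier M \<Longrightarrow> y \<in> carrier N
    \<Longrightarrow> tcong R M N [(r \<odot>\<^bsub>M\<^esub> x, y)] [(x, r \<odot>\<^bsub>N\<^esub> y)]"
| zero_left: "y \<in> carrier N \<Longrightarrow> tcong R M N [(\<zero>\<^bsub>M\<^esub>, y)] []"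

text \<open>A congruence class is represented by a chosen member, which keeps it in the universe.\<close>

definition tclass ::
  "('r, 's) ring_scheme \<Rightarrow> ('r, ('r, 'x) univ, 'y) module_scheme
   \<Rightarrow> ('r, ('r, 'x) univ, 'z) module_scheme
   \<Rightarrow> (('r, 'x) univ \<times> ('r, 'x) univ) list \<Rightarrow> ('r, 'x) univ" where
  "tclass R M N l = Formal (SOME k. tcong R M N l k)"

definition tensor ::
  "('r, 's) ring_scheme \<Rightarrow> ('r, ('r, 'x) univ, 'y) module_scheme
   \<Rightarrow> ('r, ('r, 'x) univ, 'z) module_scheme \<Rightarrow> ('r, 'x) umod" where
  "tensor R M N = \<lparr>
     carrier = tclass R M N ` {l. set l \<subseteq> carrier M \<times> carrier N},
     mult = undefined, one = undefined,
     zero = tclass R M N [],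
     add = (\<lambda>s t. tclass R M N (formal s @ formal t)),
     smult = (\<lambda>r t. tclass R M N (map (\<lambda>(x, y). (r \<odot>\<^bsub>M\<^esub> x, y)) (formal t)))\<rparr>"

definition pure ::
  "('r, 's) ring_scheme \<Rightarrow> ('r, ('r, 'x) univ, 'y) module_scheme
   \<Rightarrow> ('r, ('r, 'x) univ, 'z) module_scheme
   \<Rightarrow> ('r, 'x) univ \<Rightarrow> ('r, 'x) univ \<Rightarrow> ('r, 'x) univ" where
  "pure R M N x y = tclass R M N [(x, y)]"

text \<open>The linear map out of a tensor product induced by a bilinear map \<open>b\<close> into \<open>N\<close>, i.e.
  \<open>\<Sum> x\<^sub>i \<otimes> y\<^sub>i \<mapsto> \<Sum> b x\<^sub>i y\<^sub>i\<close>. With \<open>t\<close> a value of a comultiplication or coaction this is the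
  Sweedler notation \<open>\<Sum> b t\<^sub>(\<^sub>0\<^sub>) t\<^sub>(\<^sub>1\<^sub>)\<close>.\<close>

definition tlift ::
  "('r, 'n, 'z) module_scheme \<Rightarrow> (('r, 'x) univ \<Rightarrow> ('r, 'x) univ \<Rightarrow> 'n) \<Rightarrow> ('r, 'x) univ \<Rightarrow> 'n" where
  "tlift N b t = foldr (\<lambda>(x, y) s. b x y \<oplus>\<^bsub>N\<^esub> s) (formal t) \<zero>\<^bsub>N\<^esub>"

text \<open>\<open>f \<otimes> g : M \<otimes> N \<rightarrow> M' \<otimes> N'\<close>\<close>

definition tmap where
  "tmap R M N M' N' f g =
     (\<lambda>t\<in>carrier (tensor R M N). tlift (tensor R M' N') (\<lambda>x y. pure R M' N' (f x) (g y)) t)"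

text \<open>\<open>(M \<otimes> N) \<otimes> P \<rightarrow> M \<otimes> (N \<otimes> P)\<close>\<close>

definition tassoc where
  "tassoc R M N P =
     (\<lambda>t\<in>carrier (tensor R (tensor R M N) P).
        tlift (tensor R M (tensor R N P))
          (\<lambda>s z. tlift (tensor R M (tensor R N P))
             (\<lambda>x y. pure R M (tensor R N P) x (pure R N P y z)) s) t)"

text \<open>\<open>(X \<otimes> C) \<otimes> (Y \<otimes> D) \<rightarrow> (X \<otimes> Y) \<otimes> (C \<otimes> D)\<close>\<close>

definition tswap where
  "tswap R X C Y D =
     (\<lambda>t\<in>carrier (tensor R (tensor R X C) (tensor R Y D)).
        tlift (tensor R (tensor R X Y) (tensor R C D))
          (\<lambda>s s'. tlift (tensor R (tensor R X Y) (tensor R C D))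
             (\<lambda>x c. tlift (tensor R (tensor R X Y) (tensor R C D))
                (\<lambda>y d. pure R (tensor R X Y) (tensor R C D) (pure R X Y x y) (pure R C D c d)) s') s) t)"


section \<open>Coalgebras and the global category of comodules\<close>

record ('r, 'u) coalgebra = "('r, 'u) module" +
  comult :: "'u \<Rightarrow> 'u"
  counit :: "'u \<Rightarrow> 'r"

type_synonym ('r, 'x) ucoalg = "('r, ('r, 'x) univ) coalgebra"

definition is_coalgebra :: "'r ring \<Rightarrow> ('r, 'x) ucoalg \<Rightarrow> bool" where
  "is_coalgebra R C \<longleftrightarrow> module R C \<and>
     rlinear R C (tensor R C C) (comult C) \<and>
     rlinear R C (ring_module R) (counit C) \<and>
     (\<forall>c\<in>carrier C.
        tassoc R C C C (tmap R C C (tensor R C C) C (comult C) (\<lambda>d. d) (comult C c))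
          = tmap R C C C (tensor R C C) (\<lambda>d. d) (comult C) (comult C c) \<and>
        tlift C (\<lambda>c1 c2. counit C c1 \<odot>\<^bsub>C\<^esub> c2) (comult C c) = c \<and>
        tlift C (\<lambda>c1 c2. counit C c2 \<odot>\<^bsub>C\<^esub> c1) (comult C c) = c)"

definition coalgebra_maps :: "'r ring \<Rightarrow> ('r, 'x) ucoalg \<Rightarrow> ('r, 'x) ucoalg
    \<Rightarrow> (('r, 'x) univ \<Rightarrow> ('r, 'x) univ) set" where
  "coalgebra_maps R C D = {g \<in> lin R C D. \<forall>c\<in>carrier C.
     comult D (g c) = tmap R C C D D g g (comult C c) \<and> counit D (g c) = counit C c}"

text \<open>An object \<open>X\<^sub>C\<close>: a coalgebra \<open>C\<close>, an \<open>R\<close>-module \<open>X\<close> and a coaction \<open>X \<rightarrow> X \<otimes> C\<close>.\<close>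

record ('r, 'x) comod =
  coalg :: "('r, 'x) ucoalg"
  cospace :: "('r, 'x) umod"
  coact :: "('r, 'x) univ \<Rightarrow> ('r, 'x) univ"

definition is_comod :: "'r ring \<Rightarrow> ('r, 'x) comod \<Rightarrow> bool" where
  "is_comod R X \<longleftrightarrow> is_coalgebra R (coalg X) \<and> module R (cospace X) \<and>
     rlinear R (cospace X) (tensor R (cospace X) (coalg X)) (coact X) \<and>
     (\<forall>x\<in>carrier (cospace X).
        tassoc R (cospace X) (coalg X) (coalg X)
            (tmap R (cospace X) (coalg X) (tensor R (cospace X) (coalg X)) (coalg X)
               (coact X) (\<lambda>c. c) (coact X x))
          = tmap R (cospace X) (coalg X) (cospace X) (tensor R (coalg X) (coalg X))
               (\<lambda>y. y) (comult (coalg X)) (coact X x) \<and>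
        tlift (cospace X) (\<lambda>y c. counit (coalg X) c \<odot>\<^bsub>cospace X\<^esub> y) (coact X x) = x)"

text \<open>\<open>g\<^sub>*X\<close> for \<open>g : C \<rightarrow> D\<close>\<close>

definition pushforward :: "'r ring \<Rightarrow> (('r, 'x) univ \<Rightarrow> ('r, 'x) univ) \<Rightarrow> ('r, 'x) ucoalg
    \<Rightarrow> ('r, 'x) comod \<Rightarrow> ('r, 'x) comod" where
  "pushforward R g D X = \<lparr>coalg = D, cospace = cospace X,
     coact = (\<lambda>x. tmap R (cospace X) (coalg X) (cospace X) D (\<lambda>y. y) g (coact X x))\<rparr>"

text \<open>Comodule maps between comodules over the same coalgebra \<open>D\<close>.\<close>

definition comodule_maps :: "'r ring \<Rightarrow> ('r, 'x) ucoalg \<Rightarrow> ('r, 'x) comod \<Rightarrow> ('r, 'x) comod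
    \<Rightarrow> (('r, 'x) univ \<Rightarrow> ('r, 'x) univ) set" where
  "comodule_maps R D X Y = {k \<in> lin R (cospace X) (cospace Y). \<forall>x\<in>carrier (cospace X).
     coact Y (k x) = tmap R (cospace X) D (cospace Y) D k (\<lambda>d. d) (coact X x)}"

type_synonym ('r, 'x) comod_arr =
  "(('r, 'x) univ \<Rightarrow> ('r, 'x) univ) \<times> (('r, 'x) univ \<Rightarrow> ('r, 'x) univ)"

definition comod_arrs :: "'r ring \<Rightarrow> ('r, 'x) comod \<Rightarrow> ('r, 'x) comod \<Rightarrow> ('r, 'x) comod_arr set" where
  "comod_arrs R X Y = {(k, g). g \<in> coalgebra_maps R (coalg X) (coalg Y) \<and>
     k \<in> comodule_maps R (coalg Y) (pushforward R g (coalg Y) X) Y}"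

definition comod_id :: "('r, 'x) comod \<Rightarrow> ('r, 'x) comod_arr" where
  "comod_id X = ((\<lambda>x\<in>carrier (cospace X). x), (\<lambda>c\<in>carrier (coalg X). c))"

definition comod_cmp :: "('r, 'x) comod \<Rightarrow> ('r, 'x) comod_arr \<Rightarrow> ('r, 'x) comod_arr
    \<Rightarrow> ('r, 'x) comod_arr" where
  "comod_cmp X v u = (compose (carrier (cospace X)) (fst v) (fst u),
     compose (carrier (coalg X)) (snd v) (snd u))"

definition coalgebra_tensor :: "'r ring \<Rightarrow> ('r, 'x) ucoalg \<Rightarrow> ('r, 'x) ucoalg \<Rightarrow> ('r, 'x) ucoalg" where
  "coalgebra_tensor R C D = module.extend (tensor R C D) (coalgebra.fields
     (\<lambda>t. tswap R C C D D
        (tmap R C D (tensor R C C) (tensor R D D) (comult C) (comult D) t))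
     (tlift (ring_module R) (\<lambda>c d. counit C c \<otimes>\<^bsub>R\<^esub> counit D d)))"

definition comod_tensor :: "'r ring \<Rightarrow> ('r, 'x) comod \<Rightarrow> ('r, 'x) comod \<Rightarrow> ('r, 'x) comod" where
  "comod_tensor R X Y = \<lparr>
     coalg = coalgebra_tensor R (coalg X) (coalg Y),
     cospace = tensor R (cospace X) (cospace Y),
     coact = (\<lambda>t. tswap R (cospace X) (coalg X) (cospace Y) (coalg Y)
       (tmap R (cospace X) (cospace Y)
          (tensor R (cospace X) (coalg X)) (tensor R (cospace Y) (coalg Y))
          (coact X) (coact Y) t))\<rparr>"

text \<open>\<open>R\<close> itself, as a module, coalgebra and comodule with elements in the universe.\<close>

definition unit_module :: "'r ring \<Rightarrow> ('r, 'x) umod" where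
  "unit_module R = \<lparr>carrier = Scalar ` carrier R,
     mult = undefined, one = undefined,
     zero = Scalar \<zero>\<^bsub>R\<^esub>,
     add = (\<lambda>a b. Scalar (scalar a \<oplus>\<^bsub>R\<^esub> scalar b)),
     smult = (\<lambda>r a. Scalar (r \<otimes>\<^bsub>R\<^esub> scalar a))\<rparr>"

definition unit_coalgebra :: "'r ring \<Rightarrow> ('r, 'x) ucoalg" where
  "unit_coalgebra R = module.extend (unit_module R) (coalgebra.fields
     (\<lambda>a. pure R (unit_module R) (unit_module R) a (Scalar \<one>\<^bsub>R\<^esub>)) scalar)"

definition unit_comod :: "'r ring \<Rightarrow> ('r, 'x) comod" where
  "unit_comod R = \<lparr>coalg = unit_coalgebra R, cospace = unit_module R,
     coact = (\<lambda>a. pure R (unit_module R) (unit_coalgebra R) a (Scalar \<one>\<^bsub>R\<^esub>))\<rparr>"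

definition lin_lunit where
  "lin_lunit R M = (\<lambda>t\<in>carrier (tensor R (unit_module R) M). tlift M (\<lambda>a x. scalar a \<odot>\<^bsub>M\<^esub> x) t)"

definition lin_runit where
  "lin_runit R M = (\<lambda>t\<in>carrier (tensor R M (unit_module R)). tlift M (\<lambda>x a. scalar a \<odot>\<^bsub>M\<^esub> x) t)"

definition Comod :: "'r ring \<Rightarrow> (('r, 'x) comod, ('r, 'x) comod_arr) moncat" where
  "Comod R = \<lparr>
     Obj = {X. is_comod R X},
     Arr = comod_arrs R,
     Idn = comod_id,
     Cmp = (\<lambda>X Y Z. comod_cmp X),
     Unt = unit_comod R,
     TObj = comod_tensor R,
     TArr = (\<lambda>X Y X' Y' u v.
       (tmap R (cospace X) (cospace Y) (cospace X') (cospace Y') (fst u) (fst v),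
        tmap R (coalg X) (coalg Y) (coalg X') (coalg Y') (snd u) (snd v))),
     Assoc = (\<lambda>X Y Z. (tassoc R (cospace X) (cospace Y) (cospace Z),
       tassoc R (coalg X) (coalg Y) (coalg Z))),
     Lunit = (\<lambda>X. (lin_lunit R (cospace X), lin_lunit R (coalg X))),
     Runit = (\<lambda>X. (lin_runit R (cospace X), lin_runit R (coalg X)))\<rparr>"


section \<open>Algebras and the global category of modules\<close>

text \<open>Associative unital, not necessarily commutative, \<open>R\<close>-algebras (unlike the library locale
  \<^locale>\<open>algebra\<close>, which is about commutative ones).\<close>

definition is_algebra :: "'r ring \<Rightarrow> ('r, 'a) module \<Rightarrow> bool" where
  "is_algebra R A \<longleftrightarrow> ring A \<and> module R A \<and> bilinear R A A A (mult A)"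

definition algebra_maps :: "'r ring \<Rightarrow> ('r, 'a) module \<Rightarrow> ('r, 'b) module \<Rightarrow> ('a \<Rightarrow> 'b) set" where
  "algebra_maps R A B = {f \<in> lin R A B. f \<one>\<^bsub>A\<^esub> = \<one>\<^bsub>B\<^esub> \<and>
     (\<forall>a\<in>carrier A. \<forall>b\<in>carrier A. f (a \<otimes>\<^bsub>A\<^esub> b) = f a \<otimes>\<^bsub>B\<^esub> f b)}"

text \<open>An object \<open>M\<^sub>A\<close>: an algebra \<open>A\<close>, an \<open>R\<close>-module \<open>M\<close> and an action \<open>A \<otimes> M \<rightarrow> M\<close>, given as a
  bilinear map. The types of elements of \<open>A\<close> and of \<open>M\<close> are arbitrary.\<close>

record ('r, 'a, 'm) amod =
  alg :: "('r, 'a) module"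
  space :: "('r, 'm) module"
  act :: "'a \<Rightarrow> 'm \<Rightarrow> 'm"

definition is_amod :: "'r ring \<Rightarrow> ('r, 'a, 'm) amod \<Rightarrow> bool" where
  "is_amod R M \<longleftrightarrow> is_algebra R (alg M) \<and> module R (space M) \<and>
     bilinear R (alg M) (space M) (space M) (act M) \<and>
     (\<forall>x\<in>carrier (space M). act M \<one>\<^bsub>alg M\<^esub> x = x) \<and>
     (\<forall>a\<in>carrier (alg M). \<forall>b\<in>carrier (alg M). \<forall>x\<in>carrier (space M).
        act M (a \<otimes>\<^bsub>alg M\<^esub> b) x = act M a (act M b x))"

text \<open>\<open>f\<^sup>\<sharp>N\<close> for \<open>f : A \<rightarrow> B\<close>\<close>

definition pullback :: "('a \<Rightarrow> 'b) \<Rightarrow> ('r, 'a) module \<Rightarrow> ('r, 'b, 'n) amod \<Rightarrow> ('r, 'a, 'n) amod" where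
  "pullback f A N = \<lparr>alg = A, space = space N, act = (\<lambda>a. act N (f a))\<rparr>"

text \<open>Module maps between modules over the same algebra \<open>A\<close>.\<close>

definition module_maps :: "'r ring \<Rightarrow> ('r, 'a) module \<Rightarrow> ('r, 'a, 'm) amod \<Rightarrow> ('r, 'a, 'n) amod
    \<Rightarrow> ('m \<Rightarrow> 'n) set" where
  "module_maps R A M N = {h \<in> lin R (space M) (space N).
     \<forall>a\<in>carrier A. \<forall>x\<in>carrier (space M). h (act M a x) = act N a (h x)}"

text \<open>Arrows of \<open>Mod\<close>; source and target may have elements of different types.\<close>

definition mod_arrs :: "'r ring \<Rightarrow> ('r, 'a, 'm) amod \<Rightarrow> ('r, 'b, 'n) amod
    \<Rightarrow> (('m \<Rightarrow> 'n) \<times> ('a \<Rightarrow> 'b)) set" where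
  "mod_arrs R M N = {(h, f). f \<in> algebra_maps R (alg M) (alg N) \<and>
     h \<in> module_maps R (alg M) M (pullback f (alg M) N)}"

definition mod_id :: "('r, 'a, 'm) amod \<Rightarrow> ('m \<Rightarrow> 'm) \<times> ('a \<Rightarrow> 'a)" where
  "mod_id M = ((\<lambda>x\<in>carrier (space M). x), (\<lambda>a\<in>carrier (alg M). a))"

definition mod_cmp :: "('r, 'a, 'm) amod \<Rightarrow> ('n \<Rightarrow> 'p) \<times> ('b \<Rightarrow> 'c) \<Rightarrow> ('m \<Rightarrow> 'n) \<times> ('a \<Rightarrow> 'b)
    \<Rightarrow> ('m \<Rightarrow> 'p) \<times> ('a \<Rightarrow> 'c)" where
  "mod_cmp M v u = (compose (carrier (space M)) (fst v) (fst u),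
     compose (carrier (alg M)) (snd v) (snd u))"

definition Mod :: "'r ring \<Rightarrow> (('r, 'a, 'm) amod, ('m \<Rightarrow> 'm) \<times> ('a \<Rightarrow> 'a)) cat" where
  "Mod R = \<lparr>
     Obj = {M. is_amod R M},
     Arr = mod_arrs R,
     Idn = mod_id,
     Cmp = (\<lambda>L M N. mod_cmp L)\<rparr>"


section \<open>The functor Hom and universal measuring comodules\<close>

definition conv_algebra :: "'r ring \<Rightarrow> ('r, 'x) ucoalg \<Rightarrow> ('r, 'b) module
    \<Rightarrow> ('r, ('r, 'x) univ \<Rightarrow> 'b) module" where
  "conv_algebra R C B = \<lparr>
     carrier = lin R C B,
     mult = (\<lambda>f g. \<lambda>c\<in>carrier C. tlift B (\<lambda>c1 c2. f c1 \<otimes>\<^bsub>B\<^esub> g c2) (comult C c)),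
     one = (\<lambda>c\<in>carrier C. counit C c \<odot>\<^bsub>B\<^esub> \<one>\<^bsub>B\<^esub>),
     zero = (\<lambda>c\<in>carrier C. \<zero>\<^bsub>B\<^esub>),
     add = (\<lambda>f g. \<lambda>c\<in>carrier C. f c \<oplus>\<^bsub>B\<^esub> g c),
     smult = (\<lambda>r f. \<lambda>c\<in>carrier C. r \<odot>\<^bsub>B\<^esub> f c)\<rparr>"

definition hom_module :: "'r ring \<Rightarrow> ('r, 'u) module \<Rightarrow> ('r, 'n) module \<Rightarrow> ('r, 'u \<Rightarrow> 'n) module" where
  "hom_module R X N = \<lparr>
     carrier = lin R X N,
     mult = undefined, one = undefined,
     zero = (\<lambda>x\<in>carrier X. \<zero>\<^bsub>N\<^esub>),
     add = (\<lambda>p q. \<lambda>x\<in>carrier X. p x \<oplus>\<^bsub>N\<^esub> q x),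
     smult = (\<lambda>r p. \<lambda>x\<in>carrier X. r \<odot>\<^bsub>N\<^esub> p x)\<rparr>"

definition Hom_amod :: "'r ring \<Rightarrow> ('r, 'x) comod \<Rightarrow> ('r, 'b, 'n) amod
    \<Rightarrow> ('r, ('r, 'x) univ \<Rightarrow> 'b, ('r, 'x) univ \<Rightarrow> 'n) amod" where
  "Hom_amod R X N = \<lparr>
     alg = conv_algebra R (coalg X) (alg N),
     space = hom_module R (cospace X) (space N),
     act = (\<lambda>f p. \<lambda>x\<in>carrier (cospace X).
       tlift (space N) (\<lambda>x0 x1. act N (f x1) (p x0)) (coact X x))\<rparr>"

text \<open>\<open>Hom(u,N) : Hom(X,N) \<rightarrow> Hom(X',N)\<close> for \<open>u : X' \<rightarrow> X\<close>\<close>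

definition Hom_precomp :: "'r ring \<Rightarrow> ('r, 'x) comod \<Rightarrow> ('r, 'x) comod \<Rightarrow> ('r, 'b, 'n) amod
    \<Rightarrow> ('r, 'x) comod_arr
    \<Rightarrow> ((('r, 'x) univ \<Rightarrow> 'n) \<Rightarrow> (('r, 'x) univ \<Rightarrow> 'n)) \<times> ((('r, 'x) univ \<Rightarrow> 'b) \<Rightarrow> (('r, 'x) univ \<Rightarrow> 'b))" where
  "Hom_precomp R X' X N u =
     ((\<lambda>p\<in>lin R (cospace X) (space N). compose (carrier (cospace X')) p (fst u)),
      (\<lambda>f\<in>lin R (coalg X) (alg N). compose (carrier (coalg X')) f (snd u)))"

text \<open>\<open>Q\<close> is a universal measuring comodule of \<open>M\<close> and \<open>N\<close>, with \<open>X\<close> ranging over all comodules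
  with elements in the universe: there is an isomorphism
  \<open>Comod(X, Q) \<cong> Mod(M, Hom(X, N))\<close>, natural in \<open>X\<close>. For a family \<open>Q(M,N)\<close> of such objects, the
  functoriality of \<open>Q\<close> and the naturality in \<open>M\<close> and \<open>N\<close> are consequences.\<close>

definition universal_measuring_comodule ::
  "'r ring \<Rightarrow> ('r, 'a, 'm) amod \<Rightarrow> ('r, 'b, 'n) amod \<Rightarrow> ('r, 'x) comod \<Rightarrow> bool" where
  "universal_measuring_comodule R M N Q \<longleftrightarrow> Q \<in> Obj (Comod R) \<and>
     (\<exists>\<Phi>. (\<forall>X\<in>Obj (Comod R).
             bij_betw (\<Phi> X) (Arr (Comod R) X Q) (mod_arrs R M (Hom_amod R X N))) \<and>
          (\<forall>X\<in>Obj (Comod R). \<forall>X'\<in>Obj (Comod R). \<forall>u\<in>Arr (Comod R) X' X. \<forall>v\<in>Arr (Comod R) X Q.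
             \<Phi> X' (Cmp (Comod R) X' X Q v u) = mod_cmp M (Hom_precomp R X' X N u) (\<Phi> X v)))"

end

theory Submission
  imports Defs
begin

text \<open>By the Yoneda lemma \<open>Q(M,N)\<close> carries a universal pairing \<open>ev : M \<rightarrow> Hom(Q(M,N),N)\<close>, and
  a map into \<open>Q(L,N)\<close> is determined by its composite with \<open>ev\<close>. Two pairings \<open>p : M \<rightarrow> Hom(X,N)\<close> and
  \<open>q : L \<rightarrow> Hom(Y,M)\<close> compose to \<open>L \<rightarrow> Hom(X \<otimes> Y,N)\<close>, \<open>l \<mapsto> (x \<otimes> y \<mapsto> p (q l y) x)\<close>; composing the
  universal ones gives \<open>Q(M,N) \<otimes> Q(L,M) \<rightarrow> Q(L,N)\<close>, and \<open>m \<mapsto> (r \<mapsto> r m)\<close> gives \<open>R \<rightarrow> Q(M,M)\<close>. The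
  axioms hold because evaluation turns them into the associativity and unitality of substitution.
  Evaluation at \<open>1 \<in> R\<close> identifies \<open>Hom(R,N)\<close> with \<open>N\<close>, hence \<open>Comod(R,Q(M,N))\<close> with \<open>Mod(M,N)\<close>.
  All structure maps of \<open>Comod\<close> are composites of linear maps, so identities between them are
  checked on pure tensors.\<close>

section \<open>Linear and bilinear maps\<close>

text \<open>Only the universal property of \<open>Q(M,N)\<close> enters, never a construction of it.
  It is tested on \<open>Q(M,N)\<close> itself, on the unit, and on tensor products of these with at
  most three factors; the universe of elements is closed under tensor products and contains the
  unit, which is why a universal property quantified over that universe suffices. An arrow of
  \<open>Comod\<close> has a comodule component and a coalgebra component, so every identity is
  needed twice. The duplication is absorbed by lemmas about plain modules and linear maps in which a
  comultiplication is a coaction of a coalgebra on itself and a multiplication is an action of an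
  algebra on itself; such lemmas are then instantiated once per component. The point that needs an
  argument is that a composite of pairings respects the actions: the coaction of
  \<open>X \<otimes> Y\<close> must deliver comodule parts of x and y on one side and coalgebra
  parts on the other, which is the work of the interchange \<open>tswap\<close>.\<close>

lemma rlinearI:
  assumes "\<And>x. x \<in> carrier M \<Longrightarrow> f x \<in> carrier N"
    and "\<And>x y. x \<in> carrier M \<Longrightarrow> y \<in> carrier M \<Longrightarrow> f (x \<oplus>\<^bsub>M\<^esub> y) = f x \<oplus>\<^bsub>N\<^esub> f y"
    and "\<And>r x. r \<in> carrier R \<Longrightarrow> x \<in> carrier M \<Longrightarrow> f (r \<odot>\<^bsub>M\<^esub> x) = r \<odot>\<^bsub>N\<^esub> f x"
  shows "rlinear R M N f"
  using assms by (auto simp: rlinear_def)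

lemma rlinear_closed: "rlinear R M N f \<Longrightarrow> x \<in> carrier M \<Longrightarrow> f x \<in> carrier N"
  by (auto simp: rlinear_def)

lemma rlinear_add:
  "rlinear R M N f \<Longrightarrow> x \<in> carrier M \<Longrightarrow> y \<in> carrier M \<Longrightarrow> f (x \<oplus>\<^bsub>M\<^esub> y) = f x \<oplus>\<^bsub>N\<^esub> f y"
  by (auto simp: rlinear_def)

lemma rlinear_smult:
  "rlinear R M N f \<Longrightarrow> r \<in> carrier R \<Longrightarrow> x \<in> carrier M \<Longrightarrow> f (r \<odot>\<^bsub>M\<^esub> x) = r \<odot>\<^bsub>N\<^esub> f x"
  by (auto simp: rlinear_def)

lemma module_closed:
  assumes "module R M"
  shows "\<zero>\<^bsub>M\<^esub> \<in> carrier M"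
    and "x \<in> carrier M \<Longrightarrow> y \<in> carrier M \<Longrightarrow> x \<oplus>\<^bsub>M\<^esub> y \<in> carrier M"
    and "r \<in> carrier R \<Longrightarrow> x \<in> carrier M \<Longrightarrow> r \<odot>\<^bsub>M\<^esub> x \<in> carrier M"
proof -
  interpret module R M by fact
  show "\<zero>\<^bsub>M\<^esub> \<in> carrier M" by simp
  show "x \<in> carrier M \<Longrightarrow> y \<in> carrier M \<Longrightarrow> x \<oplus>\<^bsub>M\<^esub> y \<in> carrier M" by simp
  show "r \<in> carrier R \<Longrightarrow> x \<in> carrier M \<Longrightarrow> r \<odot>\<^bsub>M\<^esub> x \<in> carrier M" by simp
qed

lemma rlinear_zero:
  assumes "module R M" "module R N" "rlinear R M N f"
  shows "f \<zero>\<^bsub>M\<^esub> = \<zero>\<^bsub>N\<^esub>"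
proof -
  interpret M: module R M by fact
  interpret N: module R N by fact
  have "f \<zero>\<^bsub>M\<^esub> = f (\<zero>\<^bsub>R\<^esub> \<odot>\<^bsub>M\<^esub> \<zero>\<^bsub>M\<^esub>)" by simp
  also have "\<dots> = \<zero>\<^bsub>R\<^esub> \<odot>\<^bsub>N\<^esub> f \<zero>\<^bsub>M\<^esub>" by (rule rlinear_smult[OF assms(3)]) auto
  also have "\<dots> = \<zero>\<^bsub>N\<^esub>" using rlinear_closed[OF assms(3)] by simp
  finally show ?thesis .
qed

lemma rlinear_id: "rlinear R M M (\<lambda>x. x)"
  by (simp add: rlinear_def)

lemma rlinear_comp:
  "rlinear R N P g \<Longrightarrow> rlinear R M N f \<Longrightarrow> rlinear R M P (\<lambda>x. g (f x))"
  by (simp add: rlinear_def Pi_iff)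

text \<open>Linearity tests values on the carrier only, and \<open>module R M\<close> makes the
  carrier closed under the operations. The equation serves as a congruence rule: the simplifier may
  rewrite the body of an abstraction knowing that its argument lies in
  \<open>carrier M\<close>.\<close>

lemma rlinear_cong:
  assumes "module R M" "\<And>x. x \<in> carrier M \<Longrightarrow> f x = g x"
  shows "rlinear R M N f = rlinear R M N g"
  using assms(2) module_closed[OF assms(1)] by (auto simp: rlinear_def Pi_iff)

lemma rlinear_restrict: "module R M \<Longrightarrow> rlinear R M N (restrict f (carrier M)) = rlinear R M N f"
  by (rule rlinear_cong) auto

lemma bilinearI:
  assumes "\<And>x. x \<in> carrier L \<Longrightarrow> rlinear R M N (b x)"
    and "\<And>y. y \<in> carrier M \<Longrightarrow> rlinear R L N (\<lambda>x. b x y)"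
  shows "bilinear R L M N b"
  using assms by (simp add: bilinear_def)

lemma bilinear_left: "bilinear R L M N b \<Longrightarrow> y \<in> carrier M \<Longrightarrow> rlinear R L N (\<lambda>x. b x y)"
  by (simp add: bilinear_def)

lemma bilinear_right: "bilinear R L M N b \<Longrightarrow> x \<in> carrier L \<Longrightarrow> rlinear R M N (b x)"
  by (simp add: bilinear_def)

lemma bilinear_closed:
  "bilinear R L M N b \<Longrightarrow> x \<in> carrier L \<Longrightarrow> y \<in> carrier M \<Longrightarrow> b x y \<in> carrier N"
  by (metis bilinear_right rlinear_closed)

lemma bilinear_closed_ball:
  "bilinear R L M N b \<Longrightarrow> \<forall>x\<in>carrier L. \<forall>y\<in>carrier M. b x y \<in> carrier N"
  by (simp add: bilinear_closed)

lemma bilinear_comp: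
  assumes "bilinear R L M N b" "rlinear R L' L f" "rlinear R M' M g"
  shows "bilinear R L' M' N (\<lambda>x y. b (f x) (g y))"
  using assms by (auto simp: bilinear_def rlinear_def Pi_iff)

lemma bilinear_compose_rlinear:
  "rlinear R N P h \<Longrightarrow> bilinear R L M N b \<Longrightarrow> bilinear R L M P (\<lambda>x y. h (b x y))"
  by (auto simp: bilinear_def intro: rlinear_comp)

section \<open>Tensor products\<close>

lemma tcong_wf:
  assumes "module R M" "module R N" "tcong R M N k l"
  shows "set k \<subseteq> carrier M \<times> carrier N \<and> set l \<subseteq> carrier M \<times> carrier N"
  using assms(3)
  by induction (auto simp: module_closed[OF assms(1)] module_closed[OF assms(2)])

text \<open>Congruent sums are congruent to exactly the same sums, so both representatives are
  chosen from one and the same predicate.\<close>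

lemma tclass_eqI: "tcong R M N k l \<Longrightarrow> tclass R M N k = tclass R M N l"
proof -
  assume a: "tcong R M N k l"
  have "tcong R M N k = tcong R M N l"
    by (rule ext) (meson a tcong.sym tcong.trans)
  then show ?thesis by (simp add: tclass_def)
qed

text \<open>Reflexivity makes the class of a well-formed sum inhabited, hence the chosen
  representative really belongs to it.\<close>

lemma tcong_formal:
  "set l \<subseteq> carrier M \<times> carrier N \<Longrightarrow> tcong R M N l (formal (tclass R M N l))"
  unfolding tclass_def univ.sel by (rule someI, rule tcong.refl)

lemma tclass_in_tensor:
  "set l \<subseteq> carrier M \<times> carrier N \<Longrightarrow> tclass R M N l \<in> carrier (tensor R M N)"
  by (auto simp: tensor_def)

lemma formal_wf:
  assumes "module R M" "module R N" "t \<in> carrier (tensor R M N)"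
  shows "set (formal t) \<subseteq> carrier M \<times> carrier N"
proof -
  obtain l where l: "set l \<subseteq> carrier M \<times> carrier N" "t = tclass R M N l"
    using assms(3) by (auto simp: tensor_def)
  show ?thesis unfolding l(2) using tcong_wf[OF assms(1,2) tcong_formal[OF l(1)]] by simp
qed

text \<open>The operations of \<open>tensor\<close> act on chosen representatives. As these are
  congruent to the given sums and appending respects congruence, addition may be computed on any
  representatives; \<open>tensor_smult_tclass\<close> is the analogue for scalars.\<close>

lemma tensor_add_tclass:
  assumes "set k \<subseteq> carrier M \<times> carrier N" "set l \<subseteq> carrier M \<times> carrier N"
  shows "tclass R M N k \<oplus>\<^bsub>tensor R M N\<^esub> tclass R M N l = tclass R M N (k @ l)"
  by (simp add: tensor_def)
    (metis assms tcong.append tcong.sym tclass_eqI tcong_formal)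

text \<open>The \<open>balanced\<close> case is where commutativity of \<open>R\<close> enters: the
  scalar \<open>r\<close> applied from outside and the scalar \<open>s\<close> of the clause have to
  be exchanged.\<close>

lemma tcong_smult:
  assumes M: "module R M" and N: "module R N" and r: "r \<in> carrier R" and k: "tcong R M N k l"
  shows "tcong R M N (map (\<lambda>(x, y). (r \<odot>\<^bsub>M\<^esub> x, y)) k) (map (\<lambda>(x, y). (r \<odot>\<^bsub>M\<^esub> x, y)) l)"
proof -
  interpret M: module R M by fact
  interpret N: module R N by fact
  show ?thesis
    using k
  proof induction
    case (refl k)
    then show ?case using r by (intro tcong.refl) auto
  next
    case (comm k l)
    show ?case unfolding map_append by (rule tcong.comm) (use comm r in auto)
  next
    case (add_left x x' y)
    then show ?case using r tcong.add_left[of "r \<odot>\<^bsub>M\<^esub> x" M "r \<odot>\<^bsub>M\<^esub> x'" y N R]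
      by (simp add: M.smult_r_distr)
  next
    case (balanced s x y)
    then have "tcong R M N [(s \<odot>\<^bsub>M\<^esub> (r \<odot>\<^bsub>M\<^esub> x), y)] [(r \<odot>\<^bsub>M\<^esub> x, s \<odot>\<^bsub>N\<^esub> y)]"
      using r by (intro tcong.balanced) auto
    moreover have "s \<odot>\<^bsub>M\<^esub> (r \<odot>\<^bsub>M\<^esub> x) = r \<odot>\<^bsub>M\<^esub> (s \<odot>\<^bsub>M\<^esub> x)"
      using balanced r by (simp flip: M.smult_assoc1 add: M.R.m_comm)
    ultimately show ?case by simp
  qed (use r in \<open>auto intro: tcong.intros\<close>)
qed

lemma tensor_smult_tclass:
  assumes "module R M" "module R N" "r \<in> carrier R" "set l \<subseteq> carrier M \<times> carrier N"
  shows "r \<odot>\<^bsub>tensor R M N\<^esub> tclass R M N l = tclass R M N (map (\<lambda>(x, y). (r \<odot>\<^bsub>M\<^esub> x, y)) l)"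
  unfolding tensor_def
  using tclass_eqI[OF tcong_smult[OF assms(1-3) tcong.sym[OF tcong_formal[OF assms(4)]]]] by simp

lemma tensor_zero: "\<zero>\<^bsub>tensor R M N\<^esub> = tclass R M N []"
  by (simp add: tensor_def)

lemma tcong_pointwise:
  assumes "\<And>x y. (x, y) \<in> set l \<Longrightarrow> tcong R M N (f (x, y)) (g (x, y))"
  shows "tcong R M N (concat (map f l)) (concat (map g l))"
  using assms by (induction l) (auto intro: tcong.intros)

text \<open>Commutativity sorts an interleaved sum into two blocks. With singleton lists for
  \<open>f\<close> and \<open>g\<close> this yields additive inverses and the law
  \<open>(a + b) t = a t + b t\<close> in \<open>tensor_module\<close>.\<close>

lemma tcong_concat_distrib:
  assumes "\<And>x y. (x, y) \<in> set l
      \<Longrightarrow> set (f (x, y)) \<subseteq> carrier M \<times> carrier N \<and> set (g (x, y)) \<subseteq> carrier M \<times> carrier N"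
  shows "tcong R M N (concat (map (\<lambda>p. f p @ g p) l)) (concat (map f l) @ concat (map g l))"
  using assms
proof (induction l)
  case Nil
  then show ?case by (auto intro: tcong.intros)
next
  case (Cons p l)
  let ?F = "concat (map f l)" and ?G = "concat (map g l)"
  have wf: "set (f p) \<subseteq> carrier M \<times> carrier N" "set (g p) \<subseteq> carrier M \<times> carrier N"
    "set ?F \<subseteq> carrier M \<times> carrier N" "set ?G \<subseteq> carrier M \<times> carrier N"
    using Cons.prems by (cases p; fastforce)+
  have IH: "tcong R M N (concat (map (\<lambda>p. f p @ g p) l)) (?F @ ?G)"
    using Cons by auto
  have "tcong R M N (f p @ (g p @ concat (map (\<lambda>p. f p @ g p) l))) (f p @ (g p @ (?F @ ?G)))"
    by (intro tcong.append tcong.refl wf IH)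
  moreover have "tcong R M N (f p @ ((g p @ ?F) @ ?G)) (f p @ ((?F @ g p) @ ?G))"
    by (intro tcong.append tcong.refl tcong.comm wf)
  ultimately show ?case by (auto intro: tcong.trans)
qed

lemma concat_map_Nil: "concat (map (\<lambda>p. []) l) = []"
  by (induction l) auto

lemma tensor_module:
  assumes M: "module R M" and N: "module R N"
  shows "module R (tensor R M N)"
proof -
  interpret M: module R M by fact
  interpret N: module R N by fact
  let ?T = "tensor R M N" and ?c = "tclass R M N" and ?s = "\<lambda>r. map (\<lambda>(x, y). (r \<odot>\<^bsub>M\<^esub> x, y))"
  let ?W = "{l. set l \<subseteq> carrier M \<times> carrier N}"
  have car: "\<exists>l \<in> ?W. t = ?c l" if "t \<in> carrier ?T" for t
    using that by (auto simp: tensor_def)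
  have cl: "?c l \<in> carrier ?T" if "l \<in> ?W" for l using that by (simp add: tclass_in_tensor)
  have add: "?c k \<oplus>\<^bsub>?T\<^esub> ?c l = ?c (k @ l)" if "k \<in> ?W" "l \<in> ?W" for k l
    using that by (simp add: tensor_add_tclass)
  have sm: "r \<odot>\<^bsub>?T\<^esub> ?c l = ?c (?s r l)" if "r \<in> carrier R" "l \<in> ?W" for r l
    using that by (simp add: tensor_smult_tclass[OF M N])
  have W: "k @ l \<in> ?W" if "k \<in> ?W" "l \<in> ?W" for k l using that by auto
  have sW: "?s r l \<in> ?W" if "r \<in> carrier R" "l \<in> ?W" for r l using that by auto
  \<comment> \<open>The additive inverse is multiplication of the first factors by -1. Placing each
    term next to its negative, every pair \<open>(-x, y), (x, y)\<close> contracts to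
    \<open>(0, y)\<close> and then to the empty sum.\<close>
  have neg: "tcong R M N (?s (\<ominus>\<^bsub>R\<^esub> \<one>\<^bsub>R\<^esub>) l @ l) []" if "l \<in> ?W" for l
  proof -
    have "tcong R M N (concat (map (\<lambda>p. [(\<ominus>\<^bsub>R\<^esub> \<one>\<^bsub>R\<^esub> \<odot>\<^bsub>M\<^esub> fst p, snd p)] @ [p]) l))
       (concat (map (\<lambda>p. [(\<ominus>\<^bsub>R\<^esub> \<one>\<^bsub>R\<^esub> \<odot>\<^bsub>M\<^esub> fst p, snd p)]) l) @ concat (map (\<lambda>p. [p]) l))"
      by (rule tcong_concat_distrib) (use that in auto)
    moreover have "concat (map (\<lambda>p. [p]) l) = l" by (induction l) auto
    moreover have "concat (map (\<lambda>p. [(\<ominus>\<^bsub>R\<^esub> \<one>\<^bsub>R\<^esub> \<odot>\<^bsub>M\<^esub> fst p, snd p)]) l) = ?s (\<ominus>\<^bsub>R\<^esub> \<one>\<^bsub>R\<^esub>) l"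
      by (induction l) auto
    moreover have "tcong R M N (concat (map (\<lambda>p. [(\<ominus>\<^bsub>R\<^esub> \<one>\<^bsub>R\<^esub> \<odot>\<^bsub>M\<^esub> fst p, snd p)] @ [p]) l))
        (concat (map (\<lambda>p. []) l))"
    proof (rule tcong_pointwise)
      fix x y assume "(x, y) \<in> set l"
      then have xy: "x \<in> carrier M" "y \<in> carrier N" using that by auto
      have "tcong R M N [(\<ominus>\<^bsub>R\<^esub> \<one>\<^bsub>R\<^esub> \<odot>\<^bsub>M\<^esub> x \<oplus>\<^bsub>M\<^esub> x, y)] [(\<ominus>\<^bsub>R\<^esub> \<one>\<^bsub>R\<^esub> \<odot>\<^bsub>M\<^esub> x, y), (x, y)]"
        using xy by (intro tcong.add_left) auto
      moreover have "\<ominus>\<^bsub>R\<^esub> \<one>\<^bsub>R\<^esub> \<odot>\<^bsub>M\<^esub> x \<oplus>\<^bsub>M\<^esub> x = \<zero>\<^bsub>M\<^esub>"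
        using xy by (simp add: M.smult_l_minus M.l_neg)
      ultimately show "tcong R M N ([(\<ominus>\<^bsub>R\<^esub> \<one>\<^bsub>R\<^esub> \<odot>\<^bsub>M\<^esub> fst (x, y), snd (x, y))] @ [(x, y)]) []"
        using tcong.zero_left[OF xy(2), where M=M and R=R]
        by simp (rule tcong.trans[OF tcong.sym])
    qed
    ultimately show ?thesis by (simp only: concat_map_Nil) (rule tcong.trans[OF tcong.sym])
  qed
  have "abelian_group ?T"
  proof (rule abelian_groupI)
    show "\<zero>\<^bsub>?T\<^esub> \<in> carrier ?T" by (simp add: tensor_zero tclass_in_tensor)
  next
    fix x y assume "x \<in> carrier ?T" "y \<in> carrier ?T"
    then obtain k l where "k \<in> ?W" "x = ?c k" "l \<in> ?W" "y = ?c l" using car by metis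
    then show "x \<oplus>\<^bsub>?T\<^esub> y \<in> carrier ?T" "x \<oplus>\<^bsub>?T\<^esub> y = y \<oplus>\<^bsub>?T\<^esub> x"
      using tcong.comm[of k M N l R]
          by (auto simp add: tensor_add_tclass tclass_in_tensor intro: tclass_eqI)
  next
    fix x y z assume "x \<in> carrier ?T" "y \<in> carrier ?T" "z \<in> carrier ?T"
    then obtain k l m where "k \<in> ?W" "x = ?c k" "l \<in> ?W" "y = ?c l" "m \<in> ?W" "z = ?c m" using car
        by metis
    then show "x \<oplus>\<^bsub>?T\<^esub> y \<oplus>\<^bsub>?T\<^esub> z = x \<oplus>\<^bsub>?T\<^esub> (y \<oplus>\<^bsub>?T\<^esub> z)"
      using W by (simp add: add)
  next
    fix x assume "x \<in> carrier ?T"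
    then obtain k where k: "k \<in> ?W" "x = ?c k" using car by metis
    then show "\<zero>\<^bsub>?T\<^esub> \<oplus>\<^bsub>?T\<^esub> x = x" by (simp add: tensor_zero tensor_add_tclass)
    show "\<exists>y\<in>carrier ?T. y \<oplus>\<^bsub>?T\<^esub> x = \<zero>\<^bsub>?T\<^esub>"
    proof (rule bexI[where x="?c (?s (\<ominus>\<^bsub>R\<^esub> \<one>\<^bsub>R\<^esub>) k)"])
      have "?s (\<ominus>\<^bsub>R\<^esub> \<one>\<^bsub>R\<^esub>) k \<in> ?W" using k by (intro sW) auto
      then show "?c (?s (\<ominus>\<^bsub>R\<^esub> \<one>\<^bsub>R\<^esub>) k) \<oplus>\<^bsub>?T\<^esub> x = \<zero>\<^bsub>?T\<^esub>" "?c (?s (\<ominus>\<^bsub>R\<^esub> \<one>\<^bsub>R\<^esub>) k) \<in> carrier ?T"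
        using k tclass_eqI[OF neg[OF k(1)]] by (simp_all add: add tensor_zero cl)
    qed
  qed
  then show ?thesis
  proof (rule moduleI[OF M.is_cring])
    fix a x assume a: "a \<in> carrier R" "x \<in> carrier ?T"
    then obtain k where k: "k \<in> ?W" "x = ?c k" using car by metis
    then show "a \<odot>\<^bsub>?T\<^esub> x \<in> carrier ?T" using a cl[OF sW] by (simp add: sm)
    fix b assume b: "b \<in> carrier R"
    show "(a \<otimes>\<^bsub>R\<^esub> b) \<odot>\<^bsub>?T\<^esub> x = a \<odot>\<^bsub>?T\<^esub> (b \<odot>\<^bsub>?T\<^esub> x)"
    proof -
      have "?s (a \<otimes>\<^bsub>R\<^esub> b) k = ?s a (?s b k)"
        using a b k by (auto simp: M.smult_assoc1)
      then show ?thesis using a b k sW by (simp only: sm M.R.m_closed)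
    qed
    show "(a \<oplus>\<^bsub>R\<^esub> b) \<odot>\<^bsub>?T\<^esub> x = a \<odot>\<^bsub>?T\<^esub> x \<oplus>\<^bsub>?T\<^esub> b \<odot>\<^bsub>?T\<^esub> x"
    proof -
      \<comment> \<open>Each term splits in two by \<open>add_left\<close>, and sorting separates
        the two multiples. Unlike associativity of scalars, which holds for the lists themselves,
        this is true only up to congruence.\<close>
      let ?f = "\<lambda>p. [(a \<odot>\<^bsub>M\<^esub> fst p, snd p)]" and ?g = "\<lambda>p. [(b \<odot>\<^bsub>M\<^esub> fst p, snd p)]"
      have 1: "tcong R M N (concat (map (\<lambda>p. ?f p @ ?g p) k))
          (concat (map ?f k) @ concat (map ?g k))"
        by (rule tcong_concat_distrib) (use a b k in auto)
      have 2: "tcong R M N (concat (map (\<lambda>p. [((a \<oplus>\<^bsub>R\<^esub> b) \<odot>\<^bsub>M\<^esub> fst p, snd p)]) k))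
          (concat (map (\<lambda>p. ?f p @ ?g p) k))"
      proof (rule tcong_pointwise)
        fix x y assume "(x, y) \<in> set k"
        then have "x \<in> carrier M" "y \<in> carrier N" using k by auto
        then show "tcong R M N [((a \<oplus>\<^bsub>R\<^esub> b) \<odot>\<^bsub>M\<^esub> fst (x, y), snd (x, y))] (?f (x, y) @ ?g (x, y))"
          using a b by (simp add: M.smult_l_distr tcong.add_left)
      qed
      have c: "concat (map (\<lambda>p. [(r \<odot>\<^bsub>M\<^esub> fst p, snd p)]) k) = ?s r k" for r
        by (induction k) auto
      show ?thesis
        using a b k sW tclass_eqI[OF tcong.trans[OF 2 1], unfolded c] by (simp add: sm add)
    qed
  next
    fix a x y assume a: "a \<in> carrier R" "x \<in> carrier ?T" "y \<in> carrier ?T"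
    obtain k l where k: "k \<in> ?W" "x = ?c k" "l \<in> ?W" "y = ?c l"
      using car[OF a(2)] car[OF a(3)] by blast
    then show "a \<odot>\<^bsub>?T\<^esub> (x \<oplus>\<^bsub>?T\<^esub> y) = a \<odot>\<^bsub>?T\<^esub> x \<oplus>\<^bsub>?T\<^esub> a \<odot>\<^bsub>?T\<^esub> y"
      using a W[OF k(1,3)] sW[OF a(1) k(1)] sW[OF a(1) k(3)] by (simp add: add sm)
  next
    fix x assume a: "x \<in> carrier ?T"
    then obtain k where k: "k \<in> ?W" "x = ?c k" using car by metis
    moreover have "?s \<one>\<^bsub>R\<^esub> k = k" using k by (auto intro!: map_idI)
    ultimately show "\<one>\<^bsub>R\<^esub> \<odot>\<^bsub>?T\<^esub> x = x" by (simp add: sm)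
  qed
qed

section \<open>Pure tensors and the universal property\<close>

lemma pure_closed:
  "x \<in> carrier M \<Longrightarrow> y \<in> carrier N \<Longrightarrow> pure R M N x y \<in> carrier (tensor R M N)"
  by (simp add: pure_def tclass_in_tensor)

lemma bilinear_pure:
  assumes "module R M" "module R N"
  shows "bilinear R M N (tensor R M N) (pure R M N)"
proof -
  interpret M: module R M by fact
  interpret N: module R N by fact
  show ?thesis
  proof (intro bilinearI rlinearI)
    fix x x' y assume "x \<in> carrier M" "x' \<in> carrier M" "y \<in> carrier N"
    then show "pure R M N (x \<oplus>\<^bsub>M\<^esub> x') y = pure R M N x y \<oplus>\<^bsub>tensor R M N\<^esub> pure R M N x' y"
      by (simp add: pure_def tensor_add_tclass tclass_eqI tcong.add_left)
  next
    fix y y' x assume "x \<in> carrier M" "y' \<in> carrier N" "y \<in> carrier N"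
    then show "pure R M N x (y \<oplus>\<^bsub>N\<^esub> y') = pure R M N x y \<oplus>\<^bsub>tensor R M N\<^esub> pure R M N x y'"
      by (simp add: pure_def tensor_add_tclass tclass_eqI tcong.add_right)
  next
    fix r x y assume a: "r \<in> carrier R" "x \<in> carrier M" "y \<in> carrier N"
    show "pure R M N (r \<odot>\<^bsub>M\<^esub> x) y = r \<odot>\<^bsub>tensor R M N\<^esub> pure R M N x y"
      using a by (simp add: pure_def tensor_smult_tclass[OF assms])
    then show "pure R M N x (r \<odot>\<^bsub>N\<^esub> y) = r \<odot>\<^bsub>tensor R M N\<^esub> pure R M N x y"
      using a by (simp add: pure_def) (metis tcong.balanced tclass_eqI)
  qed (auto intro: pure_closed)
qed

text \<open>Prepending an entry to a formal sum adds one pure tensor to its class, so induction on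
  lists becomes induction on tensors.\<close>

lemma tensor_induct [consumes 3, case_names zero pure add]:
  assumes "module R M" "module R N" "t \<in> carrier (tensor R M N)"
    and "P \<zero>\<^bsub>tensor R M N\<^esub>"
    and "\<And>x y. x \<in> carrier M \<Longrightarrow> y \<in> carrier N \<Longrightarrow> P (pure R M N x y)"
    and "\<And>s t. s \<in> carrier (tensor R M N) \<Longrightarrow> t \<in> carrier (tensor R M N) \<Longrightarrow> P s \<Longrightarrow> P t
      \<Longrightarrow> P (s \<oplus>\<^bsub>tensor R M N\<^esub> t)"
  shows "P t"
proof -
  have "P (tclass R M N l)" if "set l \<subseteq> carrier M \<times> carrier N" for l
    using that
  proof (induction l)
    case Nil
    then show ?case using assms(4) by (simp add: tensor_zero)
  next
    case (Cons p l)
    then have "P (pure R M N (fst p) (snd p) \<oplus>\<^bsub>tensor R M N\<^esub> tclass R M N l)"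
      by (intro assms(5,6)) (auto intro: tclass_in_tensor pure_closed)
    also have "pure R M N (fst p) (snd p) \<oplus>\<^bsub>tensor R M N\<^esub> tclass R M N l = tclass R M N (p # l)"
      using Cons.prems by (simp add: pure_def tensor_add_tclass)
    finally show ?case .
  qed
  then show ?thesis using assms(3) by (auto simp: tensor_def)
qed

text \<open>The uniqueness half of the universal property; the existence half is
  \<open>rlinear_tlift\<close> together with \<open>tlift_pure\<close>.\<close>

lemma tensor_ext:
  assumes M: "module R M" and N: "module R N" and P: "module R P"
    and F: "rlinear R (tensor R M N) P F" and G: "rlinear R (tensor R M N) P G"
    and eq: "\<And>x y. x \<in> carrier M \<Longrightarrow> y \<in> carrier N \<Longrightarrow> F (pure R M N x y) = G (pure R M N x y)"
    and t: "t \<in> carrier (tensor R M N)"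
  shows "F t = G t"
  using M N t
proof (induction t rule: tensor_induct)
  case zero
  show ?case using rlinear_zero[OF tensor_module[OF M N] P] F G by metis
next
  case (add s t)
  then show ?case using rlinear_add[OF F] rlinear_add[OF G] by simp
qed (rule eq)

lemma foldr_add_closed:
  assumes "abelian_monoid P" "\<forall>x\<in>carrier M. \<forall>y\<in>carrier N. b x y \<in> carrier P"
    and "set l \<subseteq> carrier M \<times> carrier N"
  shows "foldr (\<lambda>(x, y) s. b x y \<oplus>\<^bsub>P\<^esub> s) l \<zero>\<^bsub>P\<^esub> \<in> carrier P"
proof -
  interpret abelian_monoid P by fact
  show ?thesis
    using assms(3) by (induction l) (auto simp: assms(2))
qed

lemma foldr_add_append:
  assumes "abelian_monoid P" "\<forall>x\<in>carrier M. \<forall>y\<in>carrier N. b x y \<in> carrier P"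
    and "set k \<subseteq> carrier M \<times> carrier N" "set l \<subseteq> carrier M \<times> carrier N"
  shows "foldr (\<lambda>(x, y) s. b x y \<oplus>\<^bsub>P\<^esub> s) (k @ l) \<zero>\<^bsub>P\<^esub>
    = foldr (\<lambda>(x, y) s. b x y \<oplus>\<^bsub>P\<^esub> s) k \<zero>\<^bsub>P\<^esub> \<oplus>\<^bsub>P\<^esub> foldr (\<lambda>(x, y) s. b x y \<oplus>\<^bsub>P\<^esub> s) l \<zero>\<^bsub>P\<^esub>"
proof -
  interpret abelian_monoid P by fact
  note closed = foldr_add_closed[OF assms(1,2)]
  show ?thesis
    using assms(3)
  proof (induction k)
    case Nil
    then show ?case using closed[OF assms(4)] by simp
  next
    case (Cons p k)
    then show ?case
      using closed[OF _] closed[OF assms(4)] by (cases p) (simp add: a_assoc assms(2))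
  qed
qed

text \<open>Each clause generating the congruence corresponds to an identity satisfied in
  \<open>P\<close> by sums of values of a bilinear map. The sum therefore depends on the class
  alone, and \<open>tlift\<close> may be evaluated on any representative.\<close>

lemma foldr_tcong:
  assumes M: "module R M" and N: "module R N" and P: "module R P" and b: "bilinear R M N P b"
    and "tcong R M N k l"
  shows "foldr (\<lambda>(x, y) s. b x y \<oplus>\<^bsub>P\<^esub> s) k \<zero>\<^bsub>P\<^esub> = foldr (\<lambda>(x, y) s. b x y \<oplus>\<^bsub>P\<^esub> s) l \<zero>\<^bsub>P\<^esub>"
  using assms(5)
proof induction
  interpret M: module R M by fact
  interpret N: module R N by fact
  interpret P: module R P by fact
  note app = foldr_add_append[OF P.abelian_monoid_axioms bilinear_closed_ball[OF b]]
  case (append k k' l l')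
  then show ?case
    using app[of k l] app[of k' l'] append.hyps[THEN tcong_wf[OF M N]] by simp
next
  interpret P: module R P by fact
  case (comm k l)
  note app = foldr_add_append[OF P.abelian_monoid_axioms bilinear_closed_ball[OF b]]
    and closed = foldr_add_closed[OF P.abelian_monoid_axioms bilinear_closed_ball[OF b]]
  show ?case
    using app[OF comm] app[OF comm(2,1)] closed[OF comm(1)] closed[OF comm(2)] P.M.a_comm by simp
next
  interpret P: module R P by fact
  case (add_left x x' y)
  then show ?case
    using rlinear_add[OF bilinear_left[OF b]] bilinear_closed[OF b] by (simp add: P.a_assoc)
next
  interpret P: module R P by fact
  case (add_right x y y')
  then show ?case
    using rlinear_add[OF bilinear_right[OF b]] bilinear_closed[OF b] by (simp add: P.a_assoc)
next
  interpret M: module R M by fact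
  interpret N: module R N by fact
  interpret P: module R P by fact
  case (balanced r x y)
  then show ?case
    using rlinear_smult[OF bilinear_right[OF b]] rlinear_smult[OF bilinear_left[OF b]] by simp
next
  interpret M: module R M by fact
  interpret N: module R N by fact
  interpret P: module R P by fact
  case (zero_left y)
  then show ?case using rlinear_zero[OF M P bilinear_left[OF b]] by simp
qed auto

lemma tlift_tclass:
  assumes "module R M" "module R N" "module R P" "bilinear R M N P b"
    and "set l \<subseteq> carrier M \<times> carrier N"
  shows "tlift P b (tclass R M N l) = foldr (\<lambda>(x, y) s. b x y \<oplus>\<^bsub>P\<^esub> s) l \<zero>\<^bsub>P\<^esub>"
  unfolding tlift_def
  by (rule foldr_tcong[OF assms(1-4), symmetric]) (rule tcong_formal[OF assms(5)])

lemma tlift_pure: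
  assumes "module R M" "module R N" "module R P" "bilinear R M N P b" "x \<in> carrier M"
      "y \<in> carrier N"
  shows "tlift P b (pure R M N x y) = b x y"
proof -
  interpret P: module R P by fact
  show ?thesis
    unfolding pure_def using assms(5,6) bilinear_closed[OF assms(4-6)]
    by (subst tlift_tclass[OF assms(1-4)]) auto
qed

lemma rlinear_tlift:
  assumes M: "module R M" and N: "module R N" and P: "module R P" and b: "bilinear R M N P b"
  shows "rlinear R (tensor R M N) P (tlift P b)"
proof -
  interpret M: module R M by fact
  interpret N: module R N by fact
  interpret P: module R P by fact
  let ?f = "\<lambda>l. foldr (\<lambda>(x, y) s. b x y \<oplus>\<^bsub>P\<^esub> s) l \<zero>\<^bsub>P\<^esub>"
  have bc: "b (fst p) (snd p) \<in> carrier P" if "p \<in> carrier M \<times> carrier N" for p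
    using that bilinear_closed[OF b] by auto
  have car: "\<exists>l. set l \<subseteq> carrier M \<times> carrier N \<and> t = tclass R M N l" if "t \<in> carrier (tensor R M N)"
      for t
    using that by (auto simp: tensor_def)
  have fc: "?f l \<in> carrier P" if "set l \<subseteq> carrier M \<times> carrier N" for l
    by (rule foldr_add_closed[OF P.abelian_monoid_axioms bilinear_closed_ball[OF b] that])
  show ?thesis
  proof (rule rlinearI)
    fix t assume "t \<in> carrier (tensor R M N)"
    then obtain l where l: "set l \<subseteq> carrier M \<times> carrier N" "t = tclass R M N l" using car by blast
    then show "tlift P b t \<in> carrier P" by (simp add: tlift_tclass[OF assms] fc)
    fix r assume r: "r \<in> carrier R"
    have s: "set (map (\<lambda>(x, y). (r \<odot>\<^bsub>M\<^esub> x, y)) l) \<subseteq> carrier M \<times> carrier N" using l r by auto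
    have "?f (map (\<lambda>(x, y). (r \<odot>\<^bsub>M\<^esub> x, y)) l) = r \<odot>\<^bsub>P\<^esub> ?f l"
      using l(1)
    proof (induction l)
      case (Cons p l)
      then have "?f l \<in> carrier P" by (intro fc) auto
      with Cons show ?case
        using r bc[of p] rlinear_smult[OF bilinear_left[OF b], of "snd p" r "fst p"]
        by (cases p) (simp add: P.smult_r_distr)
    qed (use r in simp)
    then show "tlift P b (r \<odot>\<^bsub>tensor R M N\<^esub> t) = r \<odot>\<^bsub>P\<^esub> tlift P b t"
      using l r s by (simp add: tensor_smult_tclass[OF M N] tlift_tclass[OF assms])
  next
    fix t s assume "t \<in> carrier (tensor R M N)" "s \<in> carrier (tensor R M N)"
    then obtain l k where l: "set l \<subseteq> carrier M \<times> carrier N" "t = tclass R M N l"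
      and k: "set k \<subseteq> carrier M \<times> carrier N" "s = tclass R M N k" using car by blast
    have "?f (l @ k) = ?f l \<oplus>\<^bsub>P\<^esub> ?f k"
      by (rule foldr_add_append[OF P.abelian_monoid_axioms bilinear_closed_ball[OF b] l(1) k(1)])
    then show "tlift P b (t \<oplus>\<^bsub>tensor R M N\<^esub> s) = tlift P b t \<oplus>\<^bsub>P\<^esub> tlift P b s"
      using l k by (simp add: tensor_add_tclass tlift_tclass[OF assms])
  qed
qed

text \<open>The representative of a tensor has its entries in the carriers, so only the values of
  \<open>b\<close> and \<open>b'\<close> there are summed.\<close>

lemma tlift_cong:
  assumes "module R M" "module R N" "t \<in> carrier (tensor R M N)"
    and "\<And>x y. x \<in> carrier M \<Longrightarrow> y \<in> carrier N \<Longrightarrow> b x y = b' x y"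
  shows "tlift P b t = tlift P b' t"
  unfolding tlift_def
proof (rule foldr_cong[OF HOL.refl HOL.refl])
  fix a p assume "p \<in> set (formal t)"
  then have "fst p \<in> carrier M" "snd p \<in> carrier N"
    using formal_wf[OF assms(1-3)] by auto
  then show "(case p of (x, y) \<Rightarrow> (\<oplus>\<^bsub>P\<^esub>) (b x y)) a = (case p of (x, y) \<Rightarrow> (\<oplus>\<^bsub>P\<^esub>) (b' x y)) a"
    using assms(4)[of "fst p" "snd p"] by (simp add: case_prod_beta)
qed

lemma rlinear_const_zero: "module R M \<Longrightarrow> module R N \<Longrightarrow> rlinear R M N (\<lambda>x. \<zero>\<^bsub>N\<^esub>)"
proof -
  assume "module R N"
  then interpret N: module R N .
  show ?thesis by (intro rlinearI) auto
qed

lemma rlinear_sum: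
  assumes "module R M" "module R N" "rlinear R M N f" "rlinear R M N g"
  shows "rlinear R M N (\<lambda>x. f x \<oplus>\<^bsub>N\<^esub> g x)"
proof -
  interpret N: module R N by fact
  note c = rlinear_closed[OF assms(3)] rlinear_closed[OF assms(4)]
  show ?thesis
    by (intro rlinearI)
      (simp_all add: c rlinear_add[OF assms(3)] rlinear_add[OF assms(4)] rlinear_smult[OF assms(3)]
        rlinear_smult[OF assms(4)] N.smult_r_distr N.a_ac)
qed

text \<open>The induction runs over the tensor \<open>t\<close> while the parameter \<open>z\<close>
  stays general: zero gives the zero map, a pure tensor a map assumed linear, a sum of tensors a sum
  of linear maps. This is what makes the nested lifts in \<open>tassoc\<close> and
  \<open>tswap\<close> bilinear.\<close>

lemma rlinear_tlift_param:
  assumes M: "module R M" and N: "module R N" and P: "module R P" and Z: "module R Z"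
    and b: "\<And>z. z \<in> carrier Z \<Longrightarrow> bilinear R M N P (b z)"
    and l: "\<And>x y. x \<in> carrier M \<Longrightarrow> y \<in> carrier N \<Longrightarrow> rlinear R Z P (\<lambda>z. b z x y)"
    and t: "t \<in> carrier (tensor R M N)"
  shows "rlinear R Z P (\<lambda>z. tlift P (b z) t)"
  using M N t
proof (induction t rule: tensor_induct)
  case zero
  show ?case
    using rlinear_zero[OF tensor_module[OF M N] P rlinear_tlift[OF M N P b]]
        rlinear_const_zero[OF Z P]
    by (simp cong: rlinear_cong[OF Z])
next
  case (pure x y)
  then show ?case using tlift_pure[OF M N P b] l by (simp cong: rlinear_cong[OF Z])
next
  case (add s t)
  then show ?case
    using rlinear_add[OF rlinear_tlift[OF M N P b]] rlinear_sum[OF Z P]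
        by (simp cong: rlinear_cong[OF Z])
qed

lemma bilinear_tlift_param:
  assumes "module R M" "module R N" "module R P" "module R Z"
    and "\<And>z. z \<in> carrier Z \<Longrightarrow> bilinear R M N P (b z)"
    and "\<And>x y. x \<in> carrier M \<Longrightarrow> y \<in> carrier N \<Longrightarrow> rlinear R Z P (\<lambda>z. b z x y)"
  shows "bilinear R (tensor R M N) Z P (\<lambda>t z. tlift P (b z) t)"
  by (intro bilinearI rlinear_tlift_param[OF assms] rlinear_tlift[OF assms(1-3) assms(5)])

section \<open>Equality of linear maps on iterated tensor products\<close>

lemma rlinear_pure_left:
  "\<lbrakk>module R M; module R N; y \<in> carrier N; rlinear R P M h\<rbrakk>
    \<Longrightarrow> rlinear R P (tensor R M N) (\<lambda>t. pure R M N (h t) y)"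
  by (rule rlinear_comp[OF bilinear_left[OF bilinear_pure]])

lemma rlinear_pure_right:
  "\<lbrakk>module R M; module R N; x \<in> carrier M; rlinear R P N h\<rbrakk>
    \<Longrightarrow> rlinear R P (tensor R M N) (\<lambda>t. pure R M N x (h t))"
  by (rule rlinear_comp[OF bilinear_right[OF bilinear_pure]])

lemma tensor_ball_ext:
  assumes "module R M" "module R N" "module R P"
    and "rlinear R (tensor R M N) P F" "rlinear R (tensor R M N) P G"
    and "\<And>x y. x \<in> carrier M \<Longrightarrow> y \<in> carrier N \<Longrightarrow> F (pure R M N x y) = G (pure R M N x y)"
  shows "\<forall>t\<in>carrier (tensor R M N). F t = G t"
  using tensor_ext[OF assms] by blast

text \<open>The digits in the names of this lemma and its relatives record the bracketing: each
  digit is the number of modules in a group, and groups as well as their contents are bracketed to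
  the left. Thus \<open>12\<close> is \<open>A \<otimes> (B \<otimes> C)\<close> and
  \<open>211\<close> is \<open>((A \<otimes> B) \<otimes> C) \<otimes> D\<close>. In all of them the
  remaining factors are held fixed, insertion of one factor is linear, and \<open>tensor_ext\<close>
  decomposes that factor.\<close>

lemma tensor_ext_21:
  assumes mods: "module R A" "module R B" "module R C" and P: "module R P"
    and F: "rlinear R (tensor R (tensor R A B) C) P F"
        and G: "rlinear R (tensor R (tensor R A B) C) P G"
    and eq: "\<And>a b c. a \<in> carrier A \<Longrightarrow> b \<in> carrier B \<Longrightarrow> c \<in> carrier C \<Longrightarrow>
      F (pure R (tensor R A B) C (pure R A B a b) c)
          = G (pure R (tensor R A B) C (pure R A B a b) c)"
  shows "\<forall>t\<in>carrier (tensor R (tensor R A B) C). F t = G t"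
proof (rule tensor_ball_ext[OF tensor_module[OF mods(1,2)] mods(3) P F G])
  fix s c assume asm: "s \<in> carrier (tensor R A B)" "c \<in> carrier C"
  show "F (pure R (tensor R A B) C s c) = G (pure R (tensor R A B) C s c)"
    by (rule tensor_ext[where F="\<lambda>s. F (pure R (tensor R A B) C s c)"
        and G="\<lambda>s. G (pure R (tensor R A B) C s c)",
          OF mods(1,2) P]; (intro rlinear_comp[OF F] rlinear_comp[OF G] rlinear_pure_left
              tensor_module mods rlinear_id eq asm)?)
qed

lemma tensor_ext_12:
  assumes mods: "module R A" "module R B" "module R C" and P: "module R P"
    and F: "rlinear R (tensor R A (tensor R B C)) P F"
        and G: "rlinear R (tensor R A (tensor R B C)) P G"
    and eq: "\<And>a b c. a \<in> carrier A \<Longrightarrow> b \<in> carrier B \<Longrightarrow> c \<in> carrier C \<Longrightarrow>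
      F (pure R A (tensor R B C) a (pure R B C b c))
          = G (pure R A (tensor R B C) a (pure R B C b c))"
  shows "\<forall>t\<in>carrier (tensor R A (tensor R B C)). F t = G t"
proof (rule tensor_ball_ext[OF mods(1) tensor_module[OF mods(2,3)] P F G])
  fix s a assume asm: "s \<in> carrier (tensor R B C)" "a \<in> carrier A"
  show "F (pure R A (tensor R B C) a s) = G (pure R A (tensor R B C) a s)"
    by (rule tensor_ext[where F="\<lambda>s. F (pure R A (tensor R B C) a s)"
        and G="\<lambda>s. G (pure R A (tensor R B C) a s)",
          OF mods(2,3) P]; (intro rlinear_comp[OF F] rlinear_comp[OF G] rlinear_pure_right
              tensor_module mods rlinear_id eq asm)?)
qed

lemma tensor_ext_211:
  assumes mods: "module R A" "module R B" "module R C" "module R D" and P: "module R P"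
    and F: "rlinear R (tensor R (tensor R (tensor R A B) C) D) P F"
    and G: "rlinear R (tensor R (tensor R (tensor R A B) C) D) P G"
    and eq: "\<And>a b c d. a \<in> carrier A \<Longrightarrow> b \<in> carrier B \<Longrightarrow> c \<in> carrier C \<Longrightarrow> d \<in> carrier D \<Longrightarrow>
      F (pure R (tensor R (tensor R A B) C) D (pure R (tensor R A B) C (pure R A B a b) c) d)
      = G (pure R (tensor R (tensor R A B) C) D (pure R (tensor R A B) C (pure R A B a b) c) d)"
  shows "\<forall>t\<in>carrier (tensor R (tensor R (tensor R A B) C) D). F t = G t"
proof (rule tensor_ext_21[OF tensor_module[OF mods(1,2)] mods(3,4) P F G])
  let ?p = "\<lambda>s c d. pure R (tensor R (tensor R A B) C) D (pure R (tensor R A B) C s c) d"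
  fix s c d assume asm: "s \<in> carrier (tensor R A B)" "c \<in> carrier C" "d \<in> carrier D"
  show "F (?p s c d) = G (?p s c d)"
    by (rule tensor_ext[where F="\<lambda>s. F (?p s c d)" and G="\<lambda>s. G (?p s c d)", OF mods(1,2) P];
        (intro rlinear_comp[OF F] rlinear_comp[OF G] rlinear_pure_left tensor_module mods rlinear_id
        eq asm)?)
qed

lemma tensor_ext_22:
  assumes mods: "module R A" "module R B" "module R C" "module R D" and P: "module R P"
    and F: "rlinear R (tensor R (tensor R A B) (tensor R C D)) P F"
    and G: "rlinear R (tensor R (tensor R A B) (tensor R C D)) P G"
    and eq: "\<And>a b c d. a \<in> carrier A \<Longrightarrow> b \<in> carrier B \<Longrightarrow> c \<in> carrier C \<Longrightarrow> d \<in> carrier D \<Longrightarrow>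
      F (pure R (tensor R A B) (tensor R C D) (pure R A B a b) (pure R C D c d))
      = G (pure R (tensor R A B) (tensor R C D) (pure R A B a b) (pure R C D c d))"
  shows "\<forall>t\<in>carrier (tensor R (tensor R A B) (tensor R C D)). F t = G t"
proof (rule tensor_ext_21[OF mods(1,2) tensor_module[OF mods(3,4)] P F G])
  let ?p = "\<lambda>a b s. pure R (tensor R A B) (tensor R C D) (pure R A B a b) s"
  fix a b s assume asm: "a \<in> carrier A" "b \<in> carrier B" "s \<in> carrier (tensor R C D)"
  show "F (?p a b s) = G (?p a b s)"
    by (rule tensor_ext[where F="\<lambda>s. F (?p a b s)" and G="\<lambda>s. G (?p a b s)", OF mods(3,4) P];
        (intro rlinear_comp[OF F] rlinear_comp[OF G] rlinear_pure_right pure_closed tensor_module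
        mods rlinear_id eq asm)?)
qed

lemma tensor_ext_222:
  assumes mods: "module R A" "module R B" "module R C" "module R D" "module R E" "module R E'"
    and P: "module R P"
    and F: "rlinear R (tensor R (tensor R (tensor R A B) (tensor R C D)) (tensor R E E')) P F"
    and G: "rlinear R (tensor R (tensor R (tensor R A B) (tensor R C D)) (tensor R E E')) P G"
    and eq: "\<And>a b c d e e'. \<lbrakk>a \<in> carrier A; b \<in> carrier B; c \<in> carrier C; d \<in> carrier D; e
        \<in> carrier E; e' \<in> carrier E'\<rbrakk> \<Longrightarrow>
      F (pure R (tensor R (tensor R A B) (tensor R C D)) (tensor R E E')
          (pure R (tensor R A B) (tensor R C D) (pure R A B a b) (pure R C D c d))
              (pure R E E' e e'))
      = G (pure R (tensor R (tensor R A B) (tensor R C D)) (tensor R E E')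
          (pure R (tensor R A B) (tensor R C D) (pure R A B a b) (pure R C D c d))
              (pure R E E' e e'))"
  shows "\<forall>t\<in>carrier (tensor R (tensor R (tensor R A B) (tensor R C D)) (tensor R E E')). F t = G t"
proof (rule tensor_ext_22[OF tensor_module[OF mods(1,2)] tensor_module[OF mods(3,4)] mods(5,6) P F
    G])
  let ?p = "\<lambda>s c e e'. pure R (tensor R (tensor R A B) (tensor R C D)) (tensor R E E')
          (pure R (tensor R A B) (tensor R C D) s c) (pure R E E' e e')"
  fix s u e e' assume asm: "s \<in> carrier (tensor R A B)" "u \<in> carrier (tensor R C D)" "e \<in> carrier E"
      "e' \<in> carrier E'"
  show "F (?p s u e e') = G (?p s u e e')"
  proof (rule tensor_ext[where F="\<lambda>s. F (?p s u e e')" and G="\<lambda>s. G (?p s u e e')", OF mods(1,2) P];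
      (intro rlinear_comp[OF F] rlinear_comp[OF G] rlinear_pure_left rlinear_pure_right pure_closed
      tensor_module mods rlinear_id asm)?)
    fix a b assume ab: "a \<in> carrier A" "b \<in> carrier B"
    show "F (?p (pure R A B a b) u e e') = G (?p (pure R A B a b) u e e')"
      by (rule tensor_ext[where F="\<lambda>u. F (?p (pure R A B a b) u e e')"
          and G="\<lambda>u. G (?p (pure R A B a b) u e e')", OF mods(3,4) P];
          (intro rlinear_comp[OF F] rlinear_comp[OF G] rlinear_pure_left rlinear_pure_right
          pure_closed tensor_module mods rlinear_id eq asm ab)?)
  qed
qed

lemma tensor_ext_33:
  assumes mods: "module R A" "module R B" "module R C" "module R D" "module R E" "module R E'"
    and P: "module R P"
    and F: "rlinear R (tensor R (tensor R (tensor R A B) C) (tensor R (tensor R D E) E')) P F"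
    and G: "rlinear R (tensor R (tensor R (tensor R A B) C) (tensor R (tensor R D E) E')) P G"
    and eq: "\<And>a b c d e e'. \<lbrakk>a \<in> carrier A; b \<in> carrier B; c \<in> carrier C; d \<in> carrier D; e
        \<in> carrier E; e' \<in> carrier E'\<rbrakk> \<Longrightarrow>
      F (pure R (tensor R (tensor R A B) C) (tensor R (tensor R D E) E')
          (pure R (tensor R A B) C (pure R A B a b) c)
              (pure R (tensor R D E) E' (pure R D E d e) e'))
      = G (pure R (tensor R (tensor R A B) C) (tensor R (tensor R D E) E')
          (pure R (tensor R A B) C (pure R A B a b) c)
              (pure R (tensor R D E) E' (pure R D E d e) e'))"
  shows "\<forall>t\<in>carrier (tensor R (tensor R (tensor R A B) C) (tensor R (tensor R D E) E')). F t = G t"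
proof (rule tensor_ext_22[OF tensor_module[OF mods(1,2)] mods(3) tensor_module[OF mods(4,5)] mods(6)
    P F G])
  let ?p = "\<lambda>s c u e'. pure R (tensor R (tensor R A B) C) (tensor R (tensor R D E) E')
          (pure R (tensor R A B) C s c) (pure R (tensor R D E) E' u e')"
  fix s u c e' assume asm: "s \<in> carrier (tensor R A B)" "u \<in> carrier (tensor R D E)" "c \<in> carrier C"
      "e' \<in> carrier E'"
  show "F (?p s c u e') = G (?p s c u e')"
  proof (rule tensor_ext[where F="\<lambda>s. F (?p s c u e')" and G="\<lambda>s. G (?p s c u e')", OF mods(1,2) P];
      (intro rlinear_comp[OF F] rlinear_comp[OF G] rlinear_pure_left rlinear_pure_right pure_closed
      tensor_module mods rlinear_id asm)?)
    fix a b assume ab: "a \<in> carrier A" "b \<in> carrier B"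
    show "F (?p (pure R A B a b) c u e') = G (?p (pure R A B a b) c u e')"
      by (rule tensor_ext[where F="\<lambda>u. F (?p (pure R A B a b) c u e')"
          and G="\<lambda>u. G (?p (pure R A B a b) c u e')", OF mods(4,5) P];
          (intro rlinear_comp[OF F] rlinear_comp[OF G] rlinear_pure_left rlinear_pure_right
          pure_closed tensor_module mods rlinear_id eq asm ab)?)
  qed
qed

section \<open>The maps \<open>tmap\<close>, \<open>tassoc\<close> and \<open>tswap\<close>\<close>

lemma rlinear_tmap:
  assumes "module R M" "module R N" "module R M'" "module R N'" "rlinear R M M' f"
      "rlinear R N N' g"
  shows "rlinear R (tensor R M N) (tensor R M' N') (tmap R M N M' N' f g)"
  unfolding tmap_def
  by (simp add: rlinear_restrict tensor_module assms(1,2))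
    (intro rlinear_tlift tensor_module bilinear_comp[OF bilinear_pure] assms)

lemma tmap_pure:
  assumes "module R M" "module R N" "module R M'" "module R N'" "rlinear R M M' f"
      "rlinear R N N' g"
    "x \<in> carrier M" "y \<in> carrier N"
  shows "tmap R M N M' N' f g (pure R M N x y) = pure R M' N' (f x) (g y)"
  unfolding tmap_def
  by (simp add: pure_closed assms(7,8)
      tlift_pure[OF assms(1,2) tensor_module[OF assms(3,4)]
          bilinear_comp[OF bilinear_pure[OF assms(3,4)] assms(5,6)] assms(7,8)])

lemma bilinear_tassoc:
  assumes "module R M" "module R N" "module R P"
  shows "bilinear R (tensor R M N) P (tensor R M (tensor R N P))
    (\<lambda>s z. tlift (tensor R M (tensor R N P)) (\<lambda>x y. pure R M (tensor R N P) x (pure R N P y z)) s)"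
  by (intro bilinear_tlift_param bilinearI tensor_module rlinear_pure_left rlinear_pure_right
      pure_closed rlinear_id assms)

lemma rlinear_tassoc:
  assumes "module R M" "module R N" "module R P"
  shows "rlinear R (tensor R (tensor R M N) P) (tensor R M (tensor R N P)) (tassoc R M N P)"
  unfolding tassoc_def
  by (simp add: rlinear_restrict tensor_module assms)
    (intro rlinear_tlift tensor_module bilinear_tassoc assms)

lemma tassoc_pure:
  assumes "module R M" "module R N" "module R P" "x \<in> carrier M" "y \<in> carrier N" "z \<in> carrier P"
  shows "tassoc R M N P (pure R (tensor R M N) P (pure R M N x y) z)
      = pure R M (tensor R N P) x (pure R N P y z)"
proof -
  have "tlift (tensor R M (tensor R N P)) (\<lambda>x y. pure R M (tensor R N P) x (pure R N P y z))
      (pure R M N x y)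
    = pure R M (tensor R N P) x (pure R N P y z)"
    using assms
    by (intro tlift_pure bilinearI tensor_module rlinear_pure_left rlinear_pure_right
        pure_closed rlinear_id)
  then show ?thesis
    unfolding tassoc_def
    using tlift_pure[OF tensor_module[OF assms(1,2)] assms(3) _ bilinear_tassoc[OF assms(1-3)]]
    by (simp add: pure_closed tensor_module assms)
qed

lemma bilinear_tswap_aux:
  assumes "module R X" "module R C" "module R Y" "module R D" "x \<in> carrier X" "c \<in> carrier C"
  shows "bilinear R Y D (tensor R (tensor R X Y) (tensor R C D))
    (\<lambda>y d. pure R (tensor R X Y) (tensor R C D) (pure R X Y x y) (pure R C D c d))"
  by (intro bilinearI tensor_module rlinear_pure_left rlinear_pure_right
      pure_closed rlinear_id assms)

lemma bilinear_tswap: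
  assumes "module R X" "module R C" "module R Y" "module R D"
  shows "bilinear R (tensor R X C) (tensor R Y D) (tensor R (tensor R X Y) (tensor R C D))
    (\<lambda>s s'. tlift (tensor R (tensor R X Y) (tensor R C D))
             (\<lambda>x c. tlift (tensor R (tensor R X Y) (tensor R C D))
                (\<lambda>y d. pure R (tensor R X Y) (tensor R C D) (pure R X Y x y) (pure R C D c d)) s')
                    s)"
  by (intro bilinear_tlift_param bilinearI bilinear_tswap_aux
      rlinear_tlift_param[OF assms(3,4)
          tensor_module[OF tensor_module[OF assms(1,3)] tensor_module[OF assms(2,4)]]]
      rlinear_tlift tensor_module rlinear_pure_left rlinear_pure_right pure_closed rlinear_id assms)

lemma rlinear_tswap:
  assumes "module R X" "module R C" "module R Y" "module R D"
  shows "rlinear R (tensor R (tensor R X C) (tensor R Y D)) (tensor R (tensor R X Y) (tensor R C D))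
      (tswap R X C Y D)"
  unfolding tswap_def
  by (simp add: rlinear_restrict tensor_module assms)
    (intro rlinear_tlift tensor_module bilinear_tswap assms)

lemma tswap_pure:
  assumes "module R X" "module R C" "module R Y" "module R D"
    "x \<in> carrier X" "c \<in> carrier C" "y \<in> carrier Y" "d \<in> carrier D"
  shows "tswap R X C Y D (pure R (tensor R X C) (tensor R Y D) (pure R X C x c) (pure R Y D y d))
    = pure R (tensor R X Y) (tensor R C D) (pure R X Y x y) (pure R C D c d)"
proof -
  let ?T = "tensor R (tensor R X Y) (tensor R C D)"
  let ?b = "\<lambda>x c y d. pure R (tensor R X Y) (tensor R C D) (pure R X Y x y) (pure R C D c d)"
  have 1: "tlift ?T (?b x c) (pure R Y D y d) = ?b x c y d"
    by (intro tlift_pure bilinear_tswap_aux tensor_module assms)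
  have "bilinear R X C ?T (\<lambda>x c. tlift ?T (?b x c) (pure R Y D y d))"
    by (intro bilinearI bilinear_tswap_aux
      rlinear_tlift_param[OF assms(3,4)
          tensor_module[OF tensor_module[OF assms(1,3)] tensor_module[OF assms(2,4)]]]
      rlinear_tlift tensor_module rlinear_pure_left rlinear_pure_right pure_closed rlinear_id assms)
  then have "tlift ?T (\<lambda>x c. tlift ?T (?b x c) (pure R Y D y d)) (pure R X C x c) = ?b x c y d"
    using tlift_pure[OF assms(1,2)
        tensor_module[OF tensor_module[OF assms(1,3)] tensor_module[OF assms(2,4)]] _ assms(5,6)] 1
    by simp
  then show ?thesis
    unfolding tswap_def
    using tlift_pure[OF tensor_module[OF assms(1,2)] tensor_module[OF assms(3,4)] _
        bilinear_tswap[OF assms(1-4)]]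
    by (simp add: pure_closed tensor_module assms)
qed

text \<open>\<open>lin_simps\<close> evaluates the structure maps on pure tensors, and
  \<open>lin_intros\<close> proves linearity of a composite by peeling off the outermost map. With
  an extensionality lemma of the right bracketing they settle the coherence identities.\<close>

lemmas lin_simps = tmap_pure tassoc_pure tswap_pure pure_closed tensor_module

lemmas lin_intros = rlinear_id tensor_module pure_closed rlinear_pure_left rlinear_pure_right
  rlinear_comp[OF rlinear_tmap] rlinear_comp[OF rlinear_tassoc] rlinear_comp[OF rlinear_tswap]

lemma tmap_lin:
  assumes "module R M" "module R N" "module R M'" "module R N'" "rlinear R M M' f"
      "rlinear R N N' g"
  shows "tmap R M N M' N' f g \<in> lin R (tensor R M N) (tensor R M' N')"
  using rlinear_tmap[OF assms] by (simp add: lin_def tmap_def)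

lemma tassoc_lin:
  assumes "module R M" "module R N" "module R P"
  shows "tassoc R M N P \<in> lin R (tensor R (tensor R M N) P) (tensor R M (tensor R N P))"
  using rlinear_tassoc[OF assms] by (simp add: lin_def tassoc_def)

section \<open>Functoriality, naturality and coherence\<close>

lemma tmap_comp:
  assumes "module R M" "module R N" "module R M'" "module R N'" "module R M''" "module R N''"
    and f: "rlinear R M M' f" "rlinear R N N' g" "rlinear R M' M'' f'" "rlinear R N' N'' g'"
  shows "\<forall>t\<in>carrier (tensor R M N). tmap R M' N' M'' N'' f' g' (tmap R M N M' N' f g t)
    = tmap R M N M'' N'' (\<lambda>x. f' (f x)) (\<lambda>y. g' (g y)) t"
  by (rule tensor_ball_ext[where P="tensor R M'' N''"];
      (intro lin_intros rlinear_comp[OF f(3)] rlinear_comp[OF f(4)] assms)?)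
    (simp add: lin_simps assms rlinear_comp[OF f(3)] rlinear_comp[OF f(4)] rlinear_closed[OF f(1)]
        rlinear_closed[OF f(2)])

lemma tmap_id:
  assumes "module R M" "module R N"
  shows "\<forall>t\<in>carrier (tensor R M N). tmap R M N M N (\<lambda>x. x) (\<lambda>y. y) t = t"
  by (rule tensor_ball_ext[where P="tensor R M N"]; (intro lin_intros assms)?)
      (simp add: lin_simps assms rlinear_id)

lemma tmap_cong:
  assumes "module R M" "module R N"
    "\<And>x. x \<in> carrier M \<Longrightarrow> f x = f' x" "\<And>y. y \<in> carrier N \<Longrightarrow> g y = g' y"
  shows "tmap R M N M' N' f g = tmap R M N M' N' f' g'"
  unfolding tmap_def
  by (intro restrict_ext tlift_cong[OF assms(1,2)]) (simp_all add: assms(3,4))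

lemma tassoc_natural:
  assumes mods: "module R M" "module R N" "module R P" "module R M'" "module R N'" "module R P'"
    and f: "rlinear R M M' f" "rlinear R N N' g" "rlinear R P P' h"
  shows "\<forall>t\<in>carrier (tensor R (tensor R M N) P).
    tassoc R M' N' P' (tmap R (tensor R M N) P (tensor R M' N') P' (tmap R M N M' N' f g) h t)
    = tmap R M (tensor R N P) M' (tensor R N' P') f (tmap R N P N' P' g h) (tassoc R M N P t)"
  by (rule tensor_ext_21[where P="tensor R M' (tensor R N' P')"]; (intro lin_intros f mods)?)
    (simp add: lin_simps assms rlinear_tmap rlinear_closed[OF f(1)] rlinear_closed[OF f(2)]
        rlinear_closed[OF f(3)])

lemma tassoc_pentagon:
  assumes mods: "module R M" "module R N" "module R P" "module R Q"
  shows "\<forall>t\<in>carrier (tensor R (tensor R (tensor R M N) P) Q).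
    tmap R M (tensor R (tensor R N P) Q) M (tensor R N (tensor R P Q)) (\<lambda>x. x) (tassoc R N P Q)
     (tassoc R M (tensor R N P) Q
       (tmap R (tensor R (tensor R M N) P) Q (tensor R M (tensor R N P)) Q (tassoc R M N P) (\<lambda>x. x)
           t))
    = tassoc R M N (tensor R P Q) (tassoc R (tensor R M N) P Q t)"
  by (rule tensor_ext_211[where P="tensor R M (tensor R N (tensor R P Q))"];
      (intro lin_intros mods)?)
    (simp add: lin_simps assms rlinear_tassoc rlinear_id)

lemma tswap_natural:
  assumes mods: "module R X" "module R C" "module R Y" "module R D" "module R X'" "module R C'"
      "module R Y'" "module R D'"
    and f: "rlinear R X X' k" "rlinear R C C' g" "rlinear R Y Y' k'" "rlinear R D D' g'"
  shows "\<forall>t\<in>carrier (tensor R (tensor R X C) (tensor R Y D)).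
    tswap R X' C' Y' D' (tmap R (tensor R X C) (tensor R Y D) (tensor R X' C') (tensor R Y' D')
        (tmap R X C X' C' k g) (tmap R Y D Y' D' k' g') t)
    = tmap R (tensor R X Y) (tensor R C D) (tensor R X' Y') (tensor R C' D') (tmap R X Y X' Y' k k')
        (tmap R C D C' D' g g') (tswap R X C Y D t)"
  by (rule tensor_ext_22[where P="tensor R (tensor R X' Y') (tensor R C' D')"];
      (intro lin_intros f mods)?)
    (simp add: lin_simps assms rlinear_tmap f[THEN rlinear_closed])

text \<open>Two threefold tensors over \<open>X, C, C'\<close> and \<open>Y, D, D'\<close> can be
  merged factor by factor either before or after reassociating, with the same result.
  Coassociativity of a tensor product of coactions reduces to this.\<close>

lemma tswap_coassoc:
  assumes mods: "module R X" "module R C" "module R C'" "module R Y" "module R D" "module R D'"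
  shows "\<forall>t\<in>carrier (tensor R (tensor R (tensor R X C) C') (tensor R (tensor R Y D) D')).
    tassoc R (tensor R X Y) (tensor R C D) (tensor R C' D')
      (tmap R (tensor R (tensor R X C) (tensor R Y D)) (tensor R C' D')
          (tensor R (tensor R X Y) (tensor R C D)) (tensor R C' D')
        (tswap R X C Y D) (\<lambda>x. x) (tswap R (tensor R X C) C' (tensor R Y D) D' t))
    = tmap R (tensor R X Y) (tensor R (tensor R C C') (tensor R D D')) (tensor R X Y)
        (tensor R (tensor R C D) (tensor R C' D'))
        (\<lambda>x. x) (tswap R C C' D D')
        (tswap R X (tensor R C C') Y (tensor R D D')
          (tmap R (tensor R (tensor R X C) C') (tensor R (tensor R Y D) D')
              (tensor R X (tensor R C C')) (tensor R Y (tensor R D D'))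
            (tassoc R X C C') (tassoc R Y D D') t))"
  by (rule tensor_ext_33[where P="tensor R (tensor R X Y)
      (tensor R (tensor R C D) (tensor R C' D'))"]; (intro lin_intros mods)?)
    (simp add: lin_simps assms rlinear_tassoc rlinear_tswap rlinear_id)

text \<open>Sorting three pairs \<open>(x, c), (y, d), (z, e)\<close> into \<open>x, y, z\<close>
  and \<open>c, d, e\<close> does not depend on which two neighbours are merged first. This is what
  makes the associator compatible with coactions in \<open>coaction_map_tassoc\<close>.\<close>

lemma tswap_tassoc:
  assumes mods: "module R X" "module R C" "module R Y" "module R D" "module R Z" "module R E"
  shows "\<forall>t\<in>carrier (tensor R (tensor R (tensor R X C) (tensor R Y D)) (tensor R Z E)).
    tmap R (tensor R (tensor R X Y) Z) (tensor R (tensor R C D) E) (tensor R X (tensor R Y Z))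
        (tensor R C (tensor R D E))
      (tassoc R X Y Z) (tassoc R C D E)
      (tswap R (tensor R X Y) (tensor R C D) Z E
        (tmap R (tensor R (tensor R X C) (tensor R Y D)) (tensor R Z E)
            (tensor R (tensor R X Y) (tensor R C D)) (tensor R Z E)
          (tswap R X C Y D) (\<lambda>x. x) t))
    = tswap R X C (tensor R Y Z) (tensor R D E)
      (tmap R (tensor R X C) (tensor R (tensor R Y D) (tensor R Z E)) (tensor R X C)
          (tensor R (tensor R Y Z) (tensor R D E))
        (\<lambda>x. x) (tswap R Y D Z E) (tassoc R (tensor R X C) (tensor R Y D) (tensor R Z E) t))"
  by (rule tensor_ext_222[where P="tensor R (tensor R X (tensor R Y Z))
      (tensor R C (tensor R D E))"]; (intro lin_intros mods)?)
    (simp add: lin_simps assms rlinear_tassoc rlinear_tswap rlinear_id)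

text \<open>\<open>coalgebra_tensor R C D\<close> and \<open>tensor R C D\<close> are distinct records, but the constructions on
  modules only look at the fields compared here.\<close>

definition same_module :: "('r, 'm, 'y) module_scheme \<Rightarrow> ('r, 'm, 'z) module_scheme \<Rightarrow> bool" where
  "same_module M N \<longleftrightarrow> carrier M = carrier N \<and> zero M = zero N \<and> add M = add N \<and> smult M = smult N"

lemma same_module_refl: "same_module M M"
  by (simp add: same_module_def)

lemma same_module_sym: "same_module M N \<Longrightarrow> same_module N M"
  by (simp add: same_module_def)

lemma same_module_imp:
  assumes "same_module M N" "module R M"
  shows "module R N"
proof -
  interpret M: module R M by fact
  have eq: "carrier N = carrier M" "zero N = zero M" "add N = add M" "smult N = smult M"
    using assms(1) by (simp_all add: same_module_def)
  show ?thesis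
  proof (rule moduleI[OF M.is_cring])
    show "abelian_group N"
      by (rule abelian_groupI) (auto simp: eq M.a_ac intro: M.l_neg)
  qed (auto simp: eq M.smult_l_distr M.smult_r_distr M.smult_assoc1)
qed

lemma module_same: "same_module M N \<Longrightarrow> module R M \<longleftrightarrow> module R N"
  by (rule iffI) (erule (1) same_module_imp, erule same_module_imp[OF same_module_sym])

lemma rlinear_same: "same_module M M' \<Longrightarrow> same_module N N' \<Longrightarrow> rlinear R M N f \<longleftrightarrow> rlinear R M' N' f"
  by (simp add: rlinear_def same_module_def)

lemma lin_same: "same_module M M' \<Longrightarrow> same_module N N' \<Longrightarrow> lin R M N = lin R M' N'"
  by (simp add: lin_def rlinear_same[of M M' N N'] same_module_def)

lemma tcong_same_imp:
  assumes "same_module M M'" "same_module N N'" "tcong R M N k l"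
  shows "tcong R M' N' k l"
proof -
  have eq: "carrier M = carrier M'" "zero M = zero M'" "add M = add M'" "smult M = smult M'"
    "carrier N = carrier N'" "zero N = zero N'" "add N = add N'" "smult N = smult N'"
    using assms(1,2) by (simp_all add: same_module_def)
  show ?thesis
    using assms(3)
  proof induction
    case (sym k l)
    show ?case using sym.IH by (rule tcong.sym)
  next
    case (trans j k l)
    then show ?case using tcong.trans by blast
  qed (unfold eq, auto intro: tcong.refl tcong.append tcong.comm tcong.add_left tcong.add_right
      tcong.balanced tcong.zero_left)
qed

lemma tcong_same: "same_module M M' \<Longrightarrow> same_module N N' \<Longrightarrow> tcong R M N = tcong R M' N'"
  by (intro ext iffI) (auto intro: tcong_same_imp same_module_sym)

lemma tclass_same: "same_module M M' \<Longrightarrow> same_module N N' \<Longrightarrow> tclass R M N = tclass R M' N'"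
  by (simp add: tclass_def fun_eq_iff tcong_same[of M M' N N'])

text \<open>Representatives are chosen from the congruence class, so equal congruences produce the
  very same record and not merely an isomorphic one; identities between maps on the two tensor
  products can then be transported by rewriting.\<close>

lemma tensor_same: "same_module M M' \<Longrightarrow> same_module N N' \<Longrightarrow> tensor R M N = tensor R M' N'"
  by (simp add: tensor_def tclass_same[of M M' N N']) (simp add: same_module_def)

lemma pure_same: "same_module M M' \<Longrightarrow> same_module N N' \<Longrightarrow> pure R M N = pure R M' N'"
  by (simp add: pure_def fun_eq_iff tclass_same[of M M' N N'])

lemma tlift_same: "same_module M M' \<Longrightarrow> tlift M = tlift M'"
  by (simp add: tlift_def fun_eq_iff same_module_def)

lemma tmap_same:
  assumes "same_module M M1" "same_module N N1" "same_module M' M1'" "same_module N' N1'"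
  shows "tmap R M N M' N' = tmap R M1 N1 M1' N1'"
  by (simp add: tmap_def fun_eq_iff tensor_same[OF assms(1,2)] tensor_same[OF assms(3,4)]
      pure_same[OF assms(3,4)])

lemma tassoc_same:
  assumes "same_module M M1" "same_module N N1" "same_module P P1"
  shows "tassoc R M N P = tassoc R M1 N1 P1"
  by (simp add: tassoc_def assms[THEN tensor_same[OF same_module_refl]]
      assms[THEN tensor_same[OF _ same_module_refl]]
      assms[THEN pure_same[OF same_module_refl]] assms[THEN pure_same[OF _ same_module_refl]])

lemma tswap_same:
  assumes "same_module M M1" "same_module N N1" "same_module P P1" "same_module Q Q1"
  shows "tswap R M N P Q = tswap R M1 N1 P1 Q1"
  by (simp add: tswap_def tensor_same[OF assms(1,2)] tensor_same[OF assms(3,4)]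
      tensor_same[OF assms(1,3)]
      tensor_same[OF assms(2,4)] pure_same[OF assms(1,3)] pure_same[OF assms(2,4)])

lemma same_module_coalgebra_tensor: "same_module (coalgebra_tensor R C D) (tensor R C D)"
  by (simp add: coalgebra_tensor_def module.extend_def same_module_def tensor_def)

lemma same_module_unit_coalgebra: "same_module (unit_coalgebra R) (unit_module R)"
  by (simp add: unit_coalgebra_def module.extend_def same_module_def unit_module_def)

text \<open>One rule per argument position, oriented from left to right. With \<open>M\<close> a
  tensor or unit coalgebra and \<open>M'\<close> its underlying module, rewriting by these rules
  removes the coalgebra record wherever only a module is meant.\<close>

lemma replace_module:
  assumes "same_module M M'"
  shows "carrier M = carrier M'" "module R M \<longleftrightarrow> module R M'"
    "rlinear R M N f \<longleftrightarrow> rlinear R M' N f" "rlinear R N M g \<longleftrightarrow> rlinear R N M' g"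
    "lin R M N = lin R M' N" "lin R N M = lin R N M'"
    "tensor R M N = tensor R M' N" "tensor R N M = tensor R N M'"
    "pure R M N = pure R M' N" "pure R N M = pure R N M'"
    "tlift M = tlift M'" "smult M = smult M'"
    "tmap R M N P Q = tmap R M' N P Q" "tmap R N M P Q = tmap R N M' P Q"
    "tmap R P Q M N = tmap R P Q M' N" "tmap R P Q N M = tmap R P Q N M'"
    "tassoc R M N P = tassoc R M' N P" "tassoc R N M P = tassoc R N M' P"
        "tassoc R N P M = tassoc R N P M'"
    "tswap R M N P Q = tswap R M' N P Q" "tswap R N M P Q = tswap R N M' P Q"
    "tswap R P Q M N = tswap R P Q M' N" "tswap R P Q N M = tswap R P Q N M'"
  by ((rule module_same rlinear_same lin_same tensor_same pure_same tlift_same tmap_same tassoc_same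
      tswap_same;
      rule assms same_module_refl) | (use assms in \<open>simp add: same_module_def\<close>))+

section \<open>The unit module\<close>

lemma module_unit: assumes "cring R" shows "module R (unit_module R)"
proof -
  interpret cring R by fact
  show ?thesis
  proof (rule moduleI[OF assms])
    show "abelian_group (unit_module R)"
    proof (rule abelian_groupI)
      fix x assume "x \<in> carrier (unit_module R)"
      then obtain r where r: "r \<in> carrier R" "x = Scalar r" by (auto simp: unit_module_def)
      then show "\<exists>y\<in>carrier (unit_module R). y \<oplus>\<^bsub>unit_module R\<^esub> x = \<zero>\<^bsub>unit_module R\<^esub>"
        by (intro bexI[of _ "Scalar (\<ominus>\<^bsub>R\<^esub> r)"]) (auto simp: unit_module_def l_neg)
    qed (auto simp: unit_module_def a_ac)
  qed (auto simp: unit_module_def m_assoc l_distr r_distr)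
qed

lemma module_ring_module: assumes "cring R" shows "module R (ring_module R)"
proof -
  interpret cring R by fact
  show ?thesis
  proof (rule moduleI[OF assms])
    show "abelian_group (ring_module R)"
      by (rule abelian_groupI) (auto simp: ring_module_def a_ac intro: l_neg)
  qed (auto simp: ring_module_def m_assoc l_distr r_distr)
qed

lemma unit_carrierE:
  assumes "a \<in> carrier (unit_module R)" obtains r where "r \<in> carrier R" "a = Scalar r"
  using assms by (auto simp: unit_module_def)

lemma Scalar_closed: "Scalar r \<in> carrier (unit_module R) \<longleftrightarrow> r \<in> carrier R"
  by (auto simp: unit_module_def)

lemma rlinear_scalar: "rlinear R (unit_module R) (ring_module R) scalar"
  by (auto simp: rlinear_def unit_module_def ring_module_def)

lemma rlinear_smult_fun:
  assumes "module R M" "module R P" "rlinear R M (ring_module R) e" "x \<in> carrier P"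
  shows "rlinear R M P (\<lambda>c. e c \<odot>\<^bsub>P\<^esub> x)"
proof -
  interpret P: module R P by fact
  have "e c \<in> carrier R" if "c \<in> carrier M" for c
    using rlinear_closed[OF assms(3) that] by (simp add: ring_module_def)
  then show ?thesis
    using rlinear_add[OF assms(3)] rlinear_smult[OF assms(3)] assms(4)
    by (intro rlinearI) (auto simp: ring_module_def P.smult_l_distr P.smult_assoc1)
qed

lemma rlinear_smult_const:
  assumes "module R M" "r \<in> carrier R"
  shows "rlinear R M M (\<lambda>x. r \<odot>\<^bsub>M\<^esub> x)"
proof -
  interpret M: module R M by fact
  show ?thesis
    using assms(2) by (intro rlinearI)
        (auto simp: M.smult_r_distr M.R.m_comm simp flip: M.smult_assoc1)
qed

lemma ring_module_closed:
  "rlinear R M (ring_module R) e \<Longrightarrow> c \<in> carrier M \<Longrightarrow> e c \<in> carrier R"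
  by (auto simp: rlinear_def ring_module_def)

lemma bilinear_counit_left:
  assumes "module R C" "module R X" "rlinear R C (ring_module R) e"
  shows "bilinear R C X X (\<lambda>c y. e c \<odot>\<^bsub>X\<^esub> y)"
  by (intro bilinearI rlinear_smult_const rlinear_smult_fun assms ring_module_closed[OF assms(3)])

lemma bilinear_counit_right:
  assumes "module R C" "module R X" "rlinear R C (ring_module R) e"
  shows "bilinear R X C X (\<lambda>y c. e c \<odot>\<^bsub>X\<^esub> y)"
  by (intro bilinearI rlinear_smult_const rlinear_smult_fun assms ring_module_closed[OF assms(3)])

lemma rlinear_lunit:
  assumes "module R M"
  shows "rlinear R (tensor R (unit_module R) M) M (lin_lunit R M)"
proof -
  have u: "module R (unit_module R)" using assms module_unit by (auto simp: module_def)
  show ?thesis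
    unfolding lin_lunit_def
    by (simp add: rlinear_restrict tensor_module assms u)
      (intro rlinear_tlift bilinear_counit_left assms u rlinear_scalar)
qed

lemma rlinear_runit:
  assumes "module R M"
  shows "rlinear R (tensor R M (unit_module R)) M (lin_runit R M)"
proof -
  have u: "module R (unit_module R)" using assms module_unit by (auto simp: module_def)
  show ?thesis
    unfolding lin_runit_def
    by (simp add: rlinear_restrict tensor_module assms u)
      (intro rlinear_tlift bilinear_counit_right assms u rlinear_scalar)
qed

lemma lin_lunit_pure:
  assumes "module R M" "r \<in> carrier R" "x \<in> carrier M"
  shows "lin_lunit R M (pure R (unit_module R) M (Scalar r) x) = r \<odot>\<^bsub>M\<^esub> x"
proof -
  have u: "module R (unit_module R)" using assms module_unit by (auto simp: module_def)
  show ?thesis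
    unfolding lin_lunit_def
    using tlift_pure[OF u assms(1) assms(1) bilinear_counit_left[OF u assms(1) rlinear_scalar]]
        assms
    by (simp add: pure_closed Scalar_closed)
qed

lemma lin_runit_pure:
  assumes "module R M" "r \<in> carrier R" "x \<in> carrier M"
  shows "lin_runit R M (pure R M (unit_module R) x (Scalar r)) = r \<odot>\<^bsub>M\<^esub> x"
proof -
  have u: "module R (unit_module R)" using assms module_unit by (auto simp: module_def)
  show ?thesis
    unfolding lin_runit_def
    using tlift_pure[OF assms(1) u assms(1) bilinear_counit_right[OF u assms(1) rlinear_scalar]]
        assms
    by (simp add: pure_closed Scalar_closed)
qed

section \<open>Coactions\<close>

text \<open>A coalgebra is a comodule over itself, so that comodules and coalgebras can be treated
  together: for \<open>X = C\<close> and \<open>d = \<Delta>\<close> this is the coalgebra structure up to left counitality.\<close>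

definition coaction where
  "coaction R X C d \<Delta> \<epsilon> \<longleftrightarrow> rlinear R X (tensor R X C) d \<and>
    (\<forall>x\<in>carrier X.
      tassoc R X C C (tmap R X C (tensor R X C) C d (\<lambda>c. c) (d x))
        = tmap R X C X (tensor R C C) (\<lambda>y. y) \<Delta> (d x) \<and>
      tlift X (\<lambda>y c. \<epsilon> c \<odot>\<^bsub>X\<^esub> y) (d x) = x)"

text \<open>For \<open>X = C\<close>, \<open>Y = D\<close> and comultiplications \<open>d\<close>,
  \<open>d'\<close> this is the comultiplication of the tensor coalgebra, so that facts about it
  serve both components of a tensor product of comodules.\<close>

definition coact_tensor where
  "coact_tensor R X C Y D d d'
      = (\<lambda>t. tswap R X C Y D (tmap R X Y (tensor R X C) (tensor R Y D) d d' t))"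

lemma rlinear_coact_tensor:
  assumes "module R X" "module R C" "module R Y" "module R D"
    "rlinear R X (tensor R X C) d" "rlinear R Y (tensor R Y D) d'"
  shows "rlinear R (tensor R X Y) (tensor R (tensor R X Y) (tensor R C D))
      (coact_tensor R X C Y D d d')"
  unfolding coact_tensor_def by (intro lin_intros assms)

lemma coact_tensor_pure:
  assumes "module R X" "module R C" "module R Y" "module R D"
    "rlinear R X (tensor R X C) d" "rlinear R Y (tensor R Y D) d'" "x \<in> carrier X" "y \<in> carrier Y"
  shows "coact_tensor R X C Y D d d' (pure R X Y x y)
      = tswap R X C Y D (pure R (tensor R X C) (tensor R Y D) (d x) (d' y))"
  by (simp add: coact_tensor_def lin_simps assms)

lemma bilinear_mult:
  assumes "cring R" "rlinear R C (ring_module R) e" "rlinear R D (ring_module R) e'"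
  shows "bilinear R C D (ring_module R) (\<lambda>c d. e c \<otimes>\<^bsub>R\<^esub> e' d)"
proof -
  interpret cring R by fact
  show ?thesis
    using rlinear_add[OF assms(2)] rlinear_smult[OF assms(2)] rlinear_add[OF assms(3)]
        rlinear_smult[OF assms(3)]
      ring_module_closed[OF assms(2)] ring_module_closed[OF assms(3)]
    by (intro bilinearI rlinearI) (auto simp: ring_module_def l_distr r_distr m_ac)
qed

definition counit_tensor where
  "counit_tensor R \<epsilon> \<epsilon>' = tlift (ring_module R) (\<lambda>c d. \<epsilon> c \<otimes>\<^bsub>R\<^esub> \<epsilon>' d)"

lemma rlinear_counit_tensor:
  assumes "module R C" "module R D" "rlinear R C (ring_module R) e" "rlinear R D (ring_module R) e'"
  shows "rlinear R (tensor R C D) (ring_module R) (counit_tensor R e e')"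
proof -
  have "cring R" using assms(1) by (simp add: module_def)
  then show ?thesis
    unfolding counit_tensor_def by (intro rlinear_tlift assms module_ring_module bilinear_mult)
qed

lemma counit_tensor_pure:
  assumes "module R C" "module R D" "rlinear R C (ring_module R) e" "rlinear R D (ring_module R) e'"
    "c \<in> carrier C" "d \<in> carrier D"
  shows "counit_tensor R e e' (pure R C D c d) = e c \<otimes>\<^bsub>R\<^esub> e' d"
proof -
  have "cring R" using assms(1) by (simp add: module_def)
  then show ?thesis
    unfolding counit_tensor_def by (intro tlift_pure assms module_ring_module bilinear_mult)
qed

lemma smult_pure_pure:
  assumes "module R M" "module R N" "r \<in> carrier R" "s \<in> carrier R" "x \<in> carrier M" "y \<in> carrier N"
  shows "pure R M N (r \<odot>\<^bsub>M\<^esub> x) (s \<odot>\<^bsub>N\<^esub> y) = (r \<otimes>\<^bsub>R\<^esub> s) \<odot>\<^bsub>tensor R M N\<^esub> pure R M N x y"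
proof -
  interpret T: module R "tensor R M N" using tensor_module assms by blast
  interpret N: module R N by fact
  have "pure R M N (r \<odot>\<^bsub>M\<^esub> x) (s \<odot>\<^bsub>N\<^esub> y) = r \<odot>\<^bsub>tensor R M N\<^esub> (s \<odot>\<^bsub>tensor R M N\<^esub> pure R M N x y)"
    using assms by (simp add: rlinear_smult[OF bilinear_left[OF bilinear_pure]]
        rlinear_smult[OF bilinear_right[OF bilinear_pure]])
  then show ?thesis using assms by (simp add: T.smult_assoc1 pure_closed)
qed

text \<open>After the interchange the counit of \<open>C \<otimes> D\<close> contracts both
  coalgebra factors at once: on pure tensors both sides are
  \<open>(e c)(e' d)(x \<otimes> y)\<close>. The identity is needed for every \<open>u\<close>
  because it is applied to \<open>d x \<otimes> d' y\<close>, where \<open>d x\<close> and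
  \<open>d' y\<close> are arbitrary tensors.\<close>

lemma counit_right_tswap:
  assumes m: "module R X" "module R C" "module R Y" "module R D"
    and e: "rlinear R C (ring_module R) e" "rlinear R D (ring_module R) e'"
  shows "\<forall>u\<in>carrier (tensor R (tensor R X C) (tensor R Y D)).
    tlift (tensor R X Y) (\<lambda>t c. counit_tensor R e e' c \<odot>\<^bsub>tensor R X Y\<^esub> t) (tswap R X C Y D u)
    = tmap R (tensor R X C) (tensor R Y D) X Y (tlift X (\<lambda>x c. e c \<odot>\<^bsub>X\<^esub> x))
        (tlift Y (\<lambda>y d. e' d \<odot>\<^bsub>Y\<^esub> y)) u"
proof -
  note b = bilinear_counit_right[OF m(2,1) e(1)] bilinear_counit_right[OF m(4,3) e(2)]
    bilinear_counit_right[OF tensor_module[OF m(2,4)] tensor_module[OF m(1,3)]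
        rlinear_counit_tensor[OF m(2,4) e]]
  note l = rlinear_tlift[OF m(1,2,1) b(1)] rlinear_tlift[OF m(3,4,3) b(2)]
    rlinear_tlift[OF tensor_module[OF m(1,3)] tensor_module[OF m(2,4)] tensor_module[OF m(1,3)]
        b(3)]
  note p = tlift_pure[OF m(1,2,1) b(1)] tlift_pure[OF m(3,4,3) b(2)]
    tlift_pure[OF tensor_module[OF m(1,3)] tensor_module[OF m(2,4)] tensor_module[OF m(1,3)] b(3)]
  show ?thesis
    by (rule tensor_ext_22[where P="tensor R X Y"]; (intro lin_intros m l rlinear_comp[OF l(3)])?)
      (simp add: lin_simps m l p counit_tensor_pure e smult_pure_pure ring_module_closed[OF e(1)]
          ring_module_closed[OF e(2)])
qed

text \<open>The mirror image, with the coalgebra factors in front. It serves the left counit law of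
  coalgebras, which \<open>coaction\<close> does not contain.\<close>

lemma counit_left_tswap:
  assumes m: "module R X" "module R C" "module R Y" "module R D"
    and e: "rlinear R C (ring_module R) e" "rlinear R D (ring_module R) e'"
  shows "\<forall>u\<in>carrier (tensor R (tensor R C X) (tensor R D Y)).
    tlift (tensor R X Y) (\<lambda>c t. counit_tensor R e e' c \<odot>\<^bsub>tensor R X Y\<^esub> t) (tswap R C X D Y u)
    = tmap R (tensor R C X) (tensor R D Y) X Y (tlift X (\<lambda>c x. e c \<odot>\<^bsub>X\<^esub> x))
        (tlift Y (\<lambda>d y. e' d \<odot>\<^bsub>Y\<^esub> y)) u"
proof -
  note b = bilinear_counit_left[OF m(2,1) e(1)] bilinear_counit_left[OF m(4,3) e(2)]
    bilinear_counit_left[OF tensor_module[OF m(2,4)] tensor_module[OF m(1,3)]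
        rlinear_counit_tensor[OF m(2,4) e]]
  note l = rlinear_tlift[OF m(2,1,1) b(1)] rlinear_tlift[OF m(4,3,3) b(2)]
    rlinear_tlift[OF tensor_module[OF m(2,4)] tensor_module[OF m(1,3)] tensor_module[OF m(1,3)]
        b(3)]
  note p = tlift_pure[OF m(2,1,1) b(1)] tlift_pure[OF m(4,3,3) b(2)]
    tlift_pure[OF tensor_module[OF m(2,4)] tensor_module[OF m(1,3)] tensor_module[OF m(1,3)] b(3)]
  show ?thesis
    by (rule tensor_ext_22[where P="tensor R X Y"]; (intro lin_intros m l rlinear_comp[OF l(3)])?)
      (simp add: lin_simps m l p counit_tensor_pure e smult_pure_pure ring_module_closed[OF e(1)]
          ring_module_closed[OF e(2)])
qed

text \<open>Moves the second use of the coaction in front of the interchange, so that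
  \<open>d\<close> and \<open>d'\<close> act inside their own factors.
  \<open>coact_tensor_coassoc_right\<close> does the same for the comultiplications; the two
  outcomes are joined by \<open>tswap_coassoc\<close>.\<close>

lemma coact_tensor_coassoc_left:
  assumes m: "module R X" "module R C" "module R Y" "module R D"
    and d: "rlinear R X (tensor R X C) d" "rlinear R Y (tensor R Y D) d'"
  shows "\<forall>u\<in>carrier (tensor R (tensor R X C) (tensor R Y D)).
    tmap R (tensor R X Y) (tensor R C D) (tensor R (tensor R X Y) (tensor R C D)) (tensor R C D)
      (coact_tensor R X C Y D d d') (\<lambda>x. x) (tswap R X C Y D u)
    = tmap R (tensor R (tensor R X C) (tensor R Y D)) (tensor R C D)
        (tensor R (tensor R X Y) (tensor R C D)) (tensor R C D)
        (tswap R X C Y D) (\<lambda>x. x) (tswap R (tensor R X C) C (tensor R Y D) D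
          (tmap R (tensor R X C) (tensor R Y D) (tensor R (tensor R X C) C)
              (tensor R (tensor R Y D) D)
            (tmap R X C (tensor R X C) C d (\<lambda>c. c)) (tmap R Y D (tensor R Y D) D d' (\<lambda>c. c)) u))"
  by (rule tensor_ext_22[where P="tensor R (tensor R (tensor R X Y) (tensor R C D))
      (tensor R C D)"];
      (intro lin_intros m d rlinear_coact_tensor)?)
    (simp add: lin_simps m d[THEN rlinear_closed] d rlinear_coact_tensor coact_tensor_pure
        rlinear_tmap rlinear_tswap rlinear_id)

lemma coact_tensor_coassoc_right:
  assumes m: "module R X" "module R C" "module R Y" "module R D"
    and d: "rlinear R C (tensor R C C) d" "rlinear R D (tensor R D D) d'"
  shows "\<forall>u\<in>carrier (tensor R (tensor R X C) (tensor R Y D)).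
    tmap R (tensor R X Y) (tensor R C D) (tensor R X Y) (tensor R (tensor R C D) (tensor R C D))
      (\<lambda>x. x) (coact_tensor R C C D D d d') (tswap R X C Y D u)
    = tmap R (tensor R X Y) (tensor R (tensor R C C) (tensor R D D)) (tensor R X Y)
        (tensor R (tensor R C D) (tensor R C D))
        (\<lambda>x. x) (tswap R C C D D)
        (tswap R X (tensor R C C) Y (tensor R D D)
          (tmap R (tensor R X C) (tensor R Y D) (tensor R X (tensor R C C))
              (tensor R Y (tensor R D D))
            (tmap R X C X (tensor R C C) (\<lambda>x. x) d) (tmap R Y D Y (tensor R D D) (\<lambda>x. x) d') u))"
  by (rule tensor_ext_22[where P="tensor R (tensor R X Y)
      (tensor R (tensor R C D) (tensor R C D))"];
      (intro lin_intros m d rlinear_coact_tensor)?)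
    (simp add: lin_simps m d[THEN rlinear_closed] d rlinear_coact_tensor coact_tensor_pure
        rlinear_tmap rlinear_tswap rlinear_id)

lemma coactionI:
  assumes "rlinear R X (tensor R X C) d"
    and "\<forall>x\<in>carrier X. tassoc R X C C (tmap R X C (tensor R X C) C d (\<lambda>c. c) (d x))
        = tmap R X C X (tensor R C C) (\<lambda>y. y) \<Delta> (d x)"
    and "\<forall>x\<in>carrier X. tlift X (\<lambda>y c. \<epsilon> c \<odot>\<^bsub>X\<^esub> y) (d x) = x"
  shows "coaction R X C d \<Delta> \<epsilon>"
  using assms by (simp add: coaction_def)

lemma coactionD:
  assumes "coaction R X C d \<Delta> \<epsilon>"
  shows "rlinear R X (tensor R X C) d"
    and "x \<in> carrier X \<Longrightarrow> tassoc R X C C (tmap R X C (tensor R X C) C d (\<lambda>c. c) (d x))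
        = tmap R X C X (tensor R C C) (\<lambda>y. y) \<Delta> (d x)"
    and "x \<in> carrier X \<Longrightarrow> tlift X (\<lambda>y c. \<epsilon> c \<odot>\<^bsub>X\<^esub> y) (d x) = x"
  using assms by (simp_all add: coaction_def)

lemma coaction_tensor:
  assumes m: "module R X" "module R C" "module R Y" "module R D"
    and d: "coaction R X C d \<Delta> \<epsilon>" "coaction R Y D d' \<Delta>' \<epsilon>'"
    and c: "rlinear R C (tensor R C C) \<Delta>" "rlinear R D (tensor R D D) \<Delta>'"
    and e: "rlinear R C (ring_module R) \<epsilon>" "rlinear R D (ring_module R) \<epsilon>'"
  shows "coaction R (tensor R X Y) (tensor R C D) (coact_tensor R X C Y D d d')
      (coact_tensor R C C D D \<Delta> \<Delta>') (counit_tensor R \<epsilon> \<epsilon>')"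
proof (rule coactionI)
  note dl = coactionD(1)[OF d(1)] coactionD(1)[OF d(2)]
  note dc = dl[THEN rlinear_closed]
  note cl = rlinear_coact_tensor[OF m dl] and cc = rlinear_coact_tensor[OF m(2,2,4,4) c]
  show "rlinear R (tensor R X Y) (tensor R (tensor R X Y) (tensor R C D))
      (coact_tensor R X C Y D d d')"
    by (rule cl)
  let ?XY = "tensor R X Y" and ?CD = "tensor R C D"
  show "\<forall>t\<in>carrier ?XY. tassoc R ?XY ?CD ?CD
      (tmap R ?XY ?CD (tensor R ?XY ?CD) ?CD (coact_tensor R X C Y D d d') (\<lambda>c. c)
      (coact_tensor R X C Y D d d' t))
     = tmap R ?XY ?CD ?XY (tensor R ?CD ?CD) (\<lambda>y. y) (coact_tensor R C C D D \<Delta> \<Delta>')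
         (coact_tensor R X C Y D d d' t)"
  proof (rule tensor_ball_ext[where P="tensor R ?XY (tensor R ?CD ?CD)"];
      (intro lin_intros m cl cc)?)
    \<comment> \<open>Both sides turn into one and the same regrouping, applied on the left to the
      iterated coactions of \<open>x\<close> and \<open>y\<close> after reassociation and on the
      right to their coactions followed by comultiplication. Coassociativity of the two factors
      identifies the arguments.\<close>
    fix x y assume xy: "x \<in> carrier X" "y \<in> carrier Y"
    then show "tassoc R ?XY ?CD ?CD
        (tmap R ?XY ?CD (tensor R ?XY ?CD) ?CD (coact_tensor R X C Y D d d') (\<lambda>c. c)
        (coact_tensor R X C Y D d d' (pure R X Y x y)))
     = tmap R ?XY ?CD ?XY (tensor R ?CD ?CD) (\<lambda>y. y) (coact_tensor R C C D D \<Delta> \<Delta>')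
         (coact_tensor R X C Y D d d' (pure R X Y x y))"
      using coactionD(2)[OF d(1) xy(1)] coactionD(2)[OF d(2) xy(2)]
        rlinear_closed[OF rlinear_tmap[OF m(1,2) tensor_module[OF m(1,2)] m(2) dl(1) rlinear_id]
            dc(1)[OF xy(1)]]
        rlinear_closed[OF rlinear_tmap[OF m(3,4) tensor_module[OF m(3,4)] m(4) dl(2) rlinear_id]
            dc(2)[OF xy(2)]]
      by (simp add: coact_tensor_pure[OF m dl] coact_tensor_coassoc_left[OF m dl, rule_format]
          coact_tensor_coassoc_right[OF m c, rule_format]
          tswap_coassoc[OF m(1,2,2,3,4,4), rule_format] lin_simps m dc rlinear_tmap rlinear_tassoc
              rlinear_id dl c)
  qed
  show "\<forall>t\<in>carrier ?XY. tlift ?XY (\<lambda>y c. counit_tensor R \<epsilon> \<epsilon>' c \<odot>\<^bsub>?XY\<^esub> y)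
      (coact_tensor R X C Y D d d' t) = t"
  proof (rule tensor_ball_ext[where P="?XY"]; (intro lin_intros m cl cc
        rlinear_comp[OF rlinear_tlift[OF tensor_module[OF m(1,3)] tensor_module[OF m(2,4)]
            tensor_module[OF m(1,3)] bilinear_counit_right[OF tensor_module[OF m(2,4)]
            tensor_module[OF m(1,3)] rlinear_counit_tensor[OF m(2,4) e]]]])?)
    fix x y assume xy: "x \<in> carrier X" "y \<in> carrier Y"
    then show "tlift ?XY (\<lambda>y c. counit_tensor R \<epsilon> \<epsilon>' c \<odot>\<^bsub>?XY\<^esub> y)
        (coact_tensor R X C Y D d d' (pure R X Y x y)) = pure R X Y x y"
      using coactionD(3)[OF d(1) xy(1)] coactionD(3)[OF d(2) xy(2)]
      by (simp add: coact_tensor_pure[OF m dl] counit_right_tswap[OF m e, rule_format] lin_simps m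
          dc
          rlinear_tlift[OF m(1,2,1) bilinear_counit_right[OF m(2,1) e(1)]]
              rlinear_tlift[OF m(3,4,3) bilinear_counit_right[OF m(4,3) e(2)]])
  qed
qed

lemma left_counit_tensor:
  assumes m: "module R C" "module R D"
    and c: "rlinear R C (tensor R C C) \<Delta>" "rlinear R D (tensor R D D) \<Delta>'"
    and e: "rlinear R C (ring_module R) \<epsilon>" "rlinear R D (ring_module R) \<epsilon>'"
    and l: "\<And>c. c \<in> carrier C \<Longrightarrow> tlift C (\<lambda>c1 c2. \<epsilon> c1 \<odot>\<^bsub>C\<^esub> c2) (\<Delta> c) = c"
      "\<And>c. c \<in> carrier D \<Longrightarrow> tlift D (\<lambda>c1 c2. \<epsilon>' c1 \<odot>\<^bsub>D\<^esub> c2) (\<Delta>' c) = c"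
  shows "\<forall>t\<in>carrier (tensor R C D). tlift (tensor R C D)
      (\<lambda>c1 c2. counit_tensor R \<epsilon> \<epsilon>' c1 \<odot>\<^bsub>tensor R C D\<^esub> c2)
    (coact_tensor R C C D D \<Delta> \<Delta>' t) = t"
proof (rule tensor_ball_ext[where P="tensor R C D"]; (intro lin_intros m rlinear_coact_tensor c
        rlinear_comp[OF rlinear_tlift[OF tensor_module[OF m] tensor_module[OF m] tensor_module[OF m]
            bilinear_counit_left[OF tensor_module[OF m] tensor_module[OF m]
            rlinear_counit_tensor[OF m e]]]])?)
  fix x y assume xy: "x \<in> carrier C" "y \<in> carrier D"
  then show "tlift (tensor R C D) (\<lambda>c1 c2. counit_tensor R \<epsilon> \<epsilon>' c1 \<odot>\<^bsub>tensor R C D\<^esub> c2)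
      (coact_tensor R C C D D \<Delta> \<Delta>' (pure R C D x y)) = pure R C D x y"
    using l by (simp add: coact_tensor_pure[OF m(1,1,2,2) c]
        counit_left_tswap[OF m(1,1,2,2) e, rule_format] lin_simps m c[THEN rlinear_closed]
          rlinear_tlift[OF m(1,1,1) bilinear_counit_left[OF m(1,1) e(1)]]
              rlinear_tlift[OF m(2,2,2) bilinear_counit_left[OF m(2,2) e(2)]])
qed

section \<open>Inverses of the associativity and unit maps\<close>

lemma bilinear_flip: "bilinear R L M N b \<Longrightarrow> bilinear R M L N (\<lambda>y x. b x y)"
  by (simp add: bilinear_def)

definition tassoc_inv where
  "tassoc_inv R M N P =
     (\<lambda>t\<in>carrier (tensor R M (tensor R N P)).
        tlift (tensor R (tensor R M N) P)
          (\<lambda>x s. tlift (tensor R (tensor R M N) P)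
             (\<lambda>y z. pure R (tensor R M N) P (pure R M N x y) z) s) t)"

lemma bilinear_tassoc_inv:
  assumes "module R M" "module R N" "module R P"
  shows "bilinear R M (tensor R N P) (tensor R (tensor R M N) P)
    (\<lambda>x s. tlift (tensor R (tensor R M N) P) (\<lambda>y z. pure R (tensor R M N) P (pure R M N x y) z) s)"
  \<comment> \<open>The tensor being lifted is the second argument here, whereas
    \<open>bilinear_tlift_param\<close> has it as the first.\<close>
  by (rule bilinear_flip)
    (intro bilinear_tlift_param bilinearI tensor_module rlinear_pure_left rlinear_pure_right
      pure_closed rlinear_id assms)

lemma rlinear_tassoc_inv:
  assumes "module R M" "module R N" "module R P"
  shows "rlinear R (tensor R M (tensor R N P)) (tensor R (tensor R M N) P) (tassoc_inv R M N P)"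
  unfolding tassoc_inv_def
  by (simp add: rlinear_restrict tensor_module assms)
    (intro rlinear_tlift tensor_module bilinear_tassoc_inv assms)

lemma tassoc_inv_pure:
  assumes "module R M" "module R N" "module R P" "x \<in> carrier M" "y \<in> carrier N" "z \<in> carrier P"
  shows "tassoc_inv R M N P (pure R M (tensor R N P) x (pure R N P y z))
      = pure R (tensor R M N) P (pure R M N x y) z"
proof -
  have "tlift (tensor R (tensor R M N) P) (\<lambda>y z. pure R (tensor R M N) P (pure R M N x y) z)
      (pure R N P y z)
    = pure R (tensor R M N) P (pure R M N x y) z"
    using assms
    by (intro tlift_pure bilinearI tensor_module rlinear_pure_left rlinear_pure_right
        pure_closed rlinear_id)
  then show ?thesis
    unfolding tassoc_inv_def
    using tlift_pure[OF assms(1) tensor_module[OF assms(2,3)] _ bilinear_tassoc_inv[OF assms(1-3)]]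
    by (simp add: pure_closed tensor_module assms)
qed

lemma tassoc_inv_left:
  assumes "module R M" "module R N" "module R P"
  shows "\<forall>t\<in>carrier (tensor R (tensor R M N) P). tassoc_inv R M N P (tassoc R M N P t) = t"
  by (rule tensor_ext_21[where P="tensor R (tensor R M N) P"];
      (intro lin_intros rlinear_comp[OF rlinear_tassoc_inv] assms)?)
    (simp add: lin_simps tassoc_inv_pure assms)

lemma tassoc_inv_right:
  assumes "module R M" "module R N" "module R P"
  shows "\<forall>t\<in>carrier (tensor R M (tensor R N P)). tassoc R M N P (tassoc_inv R M N P t) = t"
  by (rule tensor_ext_12[where P="tensor R M (tensor R N P)"];
      (intro lin_intros rlinear_comp[OF rlinear_tassoc] rlinear_tassoc_inv assms)?)
    (simp add: lin_simps tassoc_inv_pure assms)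

lemma tassoc_inv_lin:
  assumes "module R M" "module R N" "module R P"
  shows "tassoc_inv R M N P \<in> lin R (tensor R M (tensor R N P)) (tensor R (tensor R M N) P)"
  using rlinear_tassoc_inv[OF assms] by (simp add: lin_def tassoc_inv_def)

lemma module_cring: "module R M \<Longrightarrow> cring R"
  by (simp add: module_def)

lemma one_closed: "module R M \<Longrightarrow> \<one>\<^bsub>R\<^esub> \<in> carrier R"
  using module_cring cring.axioms(1) ring.ring_simprules(6) by blast

lemma module_one: "module R M \<Longrightarrow> x \<in> carrier M \<Longrightarrow> \<one>\<^bsub>R\<^esub> \<odot>\<^bsub>M\<^esub> x = x"
  by (rule module.smult_one)

lemma Scalar_smult: "r \<in> carrier R \<Longrightarrow> cring R \<Longrightarrow> r \<odot>\<^bsub>unit_module R\<^esub> Scalar \<one>\<^bsub>R\<^esub> = Scalar r"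
proof -
  assume "r \<in> carrier R" "cring R"
  then interpret cring R by simp
  show ?thesis using \<open>r \<in> carrier R\<close> by (simp add: unit_module_def)
qed

definition lin_lunit_inv where
  "lin_lunit_inv R M = (\<lambda>x\<in>carrier M. pure R (unit_module R) M (Scalar \<one>\<^bsub>R\<^esub>) x)"

definition lin_runit_inv where
  "lin_runit_inv R M = (\<lambda>x\<in>carrier M. pure R M (unit_module R) x (Scalar \<one>\<^bsub>R\<^esub>))"

lemma lin_lunit_inv_lin:
  assumes "module R M"
  shows "lin_lunit_inv R M \<in> lin R M (tensor R (unit_module R) M)"
proof -
  have "rlinear R M (tensor R (unit_module R) M) (\<lambda>x. pure R (unit_module R) M (Scalar \<one>\<^bsub>R\<^esub>) x)"
    by (intro rlinear_pure_right rlinear_id module_unit module_cring[OF assms] assms)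
      (simp add: Scalar_closed one_closed[OF assms])
  then show ?thesis
    by (simp add: lin_lunit_inv_def lin_def rlinear_restrict assms)
qed

lemma lin_runit_inv_lin:
  assumes "module R M"
  shows "lin_runit_inv R M \<in> lin R M (tensor R M (unit_module R))"
proof -
  have "rlinear R M (tensor R M (unit_module R)) (\<lambda>x. pure R M (unit_module R) x (Scalar \<one>\<^bsub>R\<^esub>))"
    by (intro rlinear_pure_left rlinear_id module_unit module_cring[OF assms] assms)
      (simp add: Scalar_closed one_closed[OF assms])
  then show ?thesis
    by (simp add: lin_runit_inv_def lin_def rlinear_restrict assms)
qed

lemma lin_lunit_inv_right:
  assumes "module R M" "x \<in> carrier M"
  shows "lin_lunit R M (lin_lunit_inv R M x) = x"
  using assms by (simp add: lin_lunit_inv_def lin_lunit_pure one_closed module_one)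

lemma lin_runit_inv_right:
  assumes "module R M" "x \<in> carrier M"
  shows "lin_runit R M (lin_runit_inv R M x) = x"
  using assms by (simp add: lin_runit_inv_def lin_runit_pure one_closed module_one)

lemma linD: "f \<in> lin R M N \<Longrightarrow> rlinear R M N f" "f \<in> lin R M N \<Longrightarrow> f \<in> extensional (carrier M)"
  by (simp_all add: lin_def)

lemma lin_closed: "f \<in> lin R M N \<Longrightarrow> x \<in> carrier M \<Longrightarrow> f x \<in> carrier N"
  by (rule rlinear_closed[OF linD(1)])

lemma pure_unit_swap:
  assumes m: "module R M" "module R N" and "r \<in> carrier R" "x \<in> carrier M" "y \<in> carrier N"
  shows "pure R M N (r \<odot>\<^bsub>M\<^esub> x) y = r \<odot>\<^bsub>tensor R M N\<^esub> pure R M N x y"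
    "pure R M N x (r \<odot>\<^bsub>N\<^esub> y) = r \<odot>\<^bsub>tensor R M N\<^esub> pure R M N x y"
  using assms by (simp_all add: rlinear_smult[OF bilinear_left[OF bilinear_pure]]
      rlinear_smult[OF bilinear_right[OF bilinear_pure]])

lemma lin_lunit_inv_left:
  fixes R :: "'a ring" and M :: "('a, ('a, 'b) univ, 'c) module_scheme"
  assumes m: "module R M"
  shows "\<forall>t\<in>carrier (tensor R (unit_module R) M). lin_lunit_inv R M (lin_lunit R M t) = t"
proof (rule tensor_ball_ext[where P="tensor R (unit_module R) M"];
    (intro lin_intros module_unit module_cring[OF m] m
        rlinear_comp[OF linD(1)[OF lin_lunit_inv_lin]] rlinear_lunit)?)
  note u = module_unit[OF module_cring[OF m]]
  fix a x :: "('a, 'b) univ" assume a: "a \<in> carrier (unit_module R)" "x \<in> carrier M"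
  then obtain r where r: "r \<in> carrier R" "a = Scalar r" by (auto elim: unit_carrierE)
  \<comment> \<open>The scalar moves across the tensor sign:
    \<open>1 \<otimes> r x = r 1 \<otimes> x\<close>, and \<open>r 1\<close> is the given element
    \<open>Scalar r\<close> of the unit.\<close>
  have "lin_lunit_inv R M (r \<odot>\<^bsub>M\<^esub> x) = pure R (unit_module R) M (r \<odot>\<^bsub>unit_module R\<^esub> Scalar \<one>\<^bsub>R\<^esub>) x"
    using a r m by (simp add: u lin_lunit_inv_def module_closed pure_unit_swap Scalar_closed
        one_closed[OF m])
  then show "lin_lunit_inv R M (lin_lunit R M (pure R (unit_module R) M a x))
      = pure R (unit_module R) M a x"
    using r a m by (simp add: lin_lunit_pure Scalar_smult module_cring)
qed

lemma lin_runit_inv_left: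
  fixes R :: "'a ring" and M :: "('a, ('a, 'b) univ, 'c) module_scheme"
  assumes m: "module R M"
  shows "\<forall>t\<in>carrier (tensor R M (unit_module R)). lin_runit_inv R M (lin_runit R M t) = t"
proof (rule tensor_ball_ext[where P="tensor R M (unit_module R)"];
    (intro lin_intros module_unit module_cring[OF m] m
        rlinear_comp[OF linD(1)[OF lin_runit_inv_lin]] rlinear_runit)?)
  note u = module_unit[OF module_cring[OF m]]
  fix a x :: "('a, 'b) univ" assume a: "a \<in> carrier (unit_module R)" "x \<in> carrier M"
  then obtain r where r: "r \<in> carrier R" "a = Scalar r" by (auto elim: unit_carrierE)
  have "lin_runit_inv R M (r \<odot>\<^bsub>M\<^esub> x) = pure R M (unit_module R) x (r \<odot>\<^bsub>unit_module R\<^esub> Scalar \<one>\<^bsub>R\<^esub>)"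
    using a r m by (simp add: u lin_runit_inv_def module_closed pure_unit_swap Scalar_closed
        one_closed[OF m])
  then show "lin_runit_inv R M (lin_runit R M (pure R M (unit_module R) x a))
      = pure R M (unit_module R) x a"
    using r a m by (simp add: lin_runit_pure Scalar_smult module_cring)
qed

text \<open>Identities in \<open>Comod\<close> are restricted to carriers, while calculations with
  tensors use the plain \<open>\<lambda>x. x\<close>. This passes from one form to the
  other.\<close>

lemma tmap_restrict:
  assumes "module R M" "module R N"
  shows "tmap R M N M' N' (restrict f (carrier M)) g = tmap R M N M' N' f g"
    "tmap R M N M' N' f (restrict g (carrier N)) = tmap R M N M' N' f g"
  by (rule tmap_cong[OF assms]; simp)+

lemma tmap_closed:
  assumes "module R M" "module R N" "module R M'" "module R N'" "rlinear R M M' f"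
      "rlinear R N N' g" "t \<in> carrier (tensor R M N)"
  shows "tmap R M N M' N' f g t \<in> carrier (tensor R M' N')"
  using rlinear_closed[OF rlinear_tmap[OF assms(1-6)] assms(7)] .

lemma tassoc_closed:
  assumes "module R M" "module R N" "module R P" "t \<in> carrier (tensor R (tensor R M N) P)"
  shows "tassoc R M N P t \<in> carrier (tensor R M (tensor R N P))"
  using rlinear_closed[OF rlinear_tassoc[OF assms(1-3)] assms(4)] .

section \<open>Coherence laws as equations between extensional maps\<close>

lemma tmap_restrict_id:
  assumes "module R M" "module R N"
  shows "tmap R M N M N (\<lambda>x\<in>carrier M. x) (\<lambda>x\<in>carrier N. x) = (\<lambda>t\<in>carrier (tensor R M N). t)"
proof (rule extensionalityI[where A="carrier (tensor R M N)"])
  fix t assume "t \<in> carrier (tensor R M N)"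
  then show "tmap R M N M N (\<lambda>x\<in>carrier M. x) (\<lambda>x\<in>carrier N. x) t
      = (\<lambda>t\<in>carrier (tensor R M N). t) t"
    by (simp add: tmap_restrict assms tmap_id)
qed (auto simp: tmap_def)

lemma tmap_compose:
  assumes m: "module R M" "module R N" "module R M'" "module R N'" "module R M''" "module R N''"
    and f: "f \<in> lin R M M'" "g \<in> lin R N N'" "f' \<in> lin R M' M''" "g' \<in> lin R N' N''"
  shows "tmap R M N M'' N'' (compose (carrier M) f' f) (compose (carrier N) g' g)
    = compose (carrier (tensor R M N)) (tmap R M' N' M'' N'' f' g') (tmap R M N M' N' f g)"
proof (rule extensionalityI[where A="carrier (tensor R M N)"])
  fix t assume "t \<in> carrier (tensor R M N)"
  then show "tmap R M N M'' N'' (compose (carrier M) f' f) (compose (carrier N) g' g) t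
    = compose (carrier (tensor R M N)) (tmap R M' N' M'' N'' f' g') (tmap R M N M' N' f g) t"
    using tmap_comp[OF m f[THEN linD(1)]] by (simp add: compose_def tmap_restrict m)
qed (auto simp: tmap_def compose_def)

lemma tassoc_natural_compose:
  assumes m: "module R M" "module R N" "module R P" "module R M'" "module R N'" "module R P'"
    and f: "f \<in> lin R M M'" "g \<in> lin R N N'" "h \<in> lin R P P'"
  shows "compose (carrier (tensor R (tensor R M N) P)) (tassoc R M' N' P')
      (tmap R (tensor R M N) P (tensor R M' N') P' (tmap R M N M' N' f g) h)
    = compose (carrier (tensor R (tensor R M N) P))
      (tmap R M (tensor R N P) M' (tensor R N' P') f (tmap R N P N' P' g h)) (tassoc R M N P)"
  unfolding compose_def by (rule restrict_ext)
      (rule tassoc_natural[OF m f[THEN linD(1)], rule_format])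

lemma lunit_natural_compose:
  assumes m: "module R M" "module R N" and f: "f \<in> lin R M N"
  shows "compose (carrier (tensor R (unit_module R) M)) (lin_lunit R N)
      (tmap R (unit_module R) M (unit_module R) N (\<lambda>x\<in>carrier (unit_module R). x) f)
    = compose (carrier (tensor R (unit_module R) M)) f (lin_lunit R M)"
proof -
  note u = module_unit[OF module_cring[OF m(1)]] and l = linD(1)[OF f]
  have "\<forall>t\<in>carrier (tensor R (unit_module R) M). lin_lunit R N
      (tmap R (unit_module R) M (unit_module R) N (\<lambda>x. x) f t) = f (lin_lunit R M t)"
    by (rule tensor_ball_ext[where P=N];
        (intro lin_intros rlinear_comp[OF rlinear_lunit] rlinear_comp[OF l] rlinear_lunit m u l)?)
      (auto elim!: unit_carrierE simp: lin_simps m u l rlinear_id lin_lunit_pure rlinear_smult[OF l]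
          rlinear_closed[OF l] Scalar_closed)
  then show ?thesis
    unfolding compose_def by (intro restrict_ext) (simp add: tmap_restrict u m)
qed

lemma runit_natural_compose:
  assumes m: "module R M" "module R N" and f: "f \<in> lin R M N"
  shows "compose (carrier (tensor R M (unit_module R))) (lin_runit R N)
      (tmap R M (unit_module R) N (unit_module R) f (\<lambda>x\<in>carrier (unit_module R). x))
    = compose (carrier (tensor R M (unit_module R))) f (lin_runit R M)"
proof -
  note u = module_unit[OF module_cring[OF m(1)]] and l = linD(1)[OF f]
  have "\<forall>t\<in>carrier (tensor R M (unit_module R)). lin_runit R N
      (tmap R M (unit_module R) N (unit_module R) f (\<lambda>x. x) t) = f (lin_runit R M t)"
    by (rule tensor_ball_ext[where P=N];
        (intro lin_intros rlinear_comp[OF rlinear_runit] rlinear_comp[OF l] rlinear_runit m u l)?)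
      (auto elim!: unit_carrierE simp: lin_simps m u l rlinear_id lin_runit_pure rlinear_smult[OF l]
          rlinear_closed[OF l] Scalar_closed)
  then show ?thesis
    unfolding compose_def by (intro restrict_ext) (simp add: tmap_restrict u m)
qed

lemma pentagon_compose:
  assumes m: "module R M" "module R N" "module R P" "module R Q"
  shows "compose (carrier (tensor R (tensor R (tensor R M N) P) Q))
      (compose (carrier (tensor R (tensor R M (tensor R N P)) Q))
        (tmap R M (tensor R (tensor R N P) Q) M (tensor R N (tensor R P Q)) (\<lambda>x\<in>carrier M. x)
            (tassoc R N P Q))
        (tassoc R M (tensor R N P) Q))
      (tmap R (tensor R (tensor R M N) P) Q (tensor R M (tensor R N P)) Q (tassoc R M N P)
          (\<lambda>x\<in>carrier Q. x))
    = compose (carrier (tensor R (tensor R (tensor R M N) P) Q)) (tassoc R M N (tensor R P Q))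
        (tassoc R (tensor R M N) P Q)"
  unfolding compose_def
  using tassoc_pentagon[OF m]
  by (intro restrict_ext) (simp add: tmap_restrict m tensor_module tmap_closed rlinear_tassoc
      rlinear_id)

text \<open>Both sides send \<open>(x \<otimes> r) \<otimes> y\<close> to
  \<open>r (x \<otimes> y)\<close>; one lets the scalar act on \<open>y\<close>, the other on
  \<open>x\<close>.\<close>

lemma triangle_compose:
  assumes m: "module R M" "module R N"
  shows "compose (carrier (tensor R (tensor R M (unit_module R)) N))
      (tmap R M (tensor R (unit_module R) N) M N (\<lambda>x\<in>carrier M. x) (lin_lunit R N))
          (tassoc R M (unit_module R) N)
    = tmap R (tensor R M (unit_module R)) N M N (lin_runit R M) (\<lambda>x\<in>carrier N. x)"
proof (rule extensionalityI[where A="carrier (tensor R (tensor R M (unit_module R)) N)"])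
  note u = module_unit[OF module_cring[OF m(1)]]
  have *: "\<forall>t\<in>carrier (tensor R (tensor R M (unit_module R)) N).
    tmap R M (tensor R (unit_module R) N) M N (\<lambda>x. x) (lin_lunit R N)
        (tassoc R M (unit_module R) N t)
    = tmap R (tensor R M (unit_module R)) N M N (lin_runit R M) (\<lambda>x. x) t"
    by (rule tensor_ext_21[where P="tensor R M N"];
        (intro lin_intros rlinear_lunit rlinear_runit m u)?)
      (auto elim!: unit_carrierE simp: lin_simps m u rlinear_id rlinear_lunit rlinear_runit
          lin_lunit_pure lin_runit_pure Scalar_closed pure_unit_swap)
  fix t assume "t \<in> carrier (tensor R (tensor R M (unit_module R)) N)"
  with * show "compose (carrier (tensor R (tensor R M (unit_module R)) N))
      (tmap R M (tensor R (unit_module R) N) M N (\<lambda>x\<in>carrier M. x) (lin_lunit R N))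
          (tassoc R M (unit_module R) N) t
    = tmap R (tensor R M (unit_module R)) N M N (lin_runit R M) (\<lambda>x\<in>carrier N. x) t"
    by (simp add: compose_def tmap_restrict m u tensor_module)
qed (auto simp: tmap_def compose_def)

section \<open>Maps of coactions\<close>

text \<open>One equation for both components of an arrow of comodules: for \<open>X = C\<close>,
  \<open>Y = D\<close>, \<open>k = g\<close> and comultiplications as coactions it states that
  \<open>g\<close> is comultiplicative.\<close>

definition coaction_map where
  "coaction_map R X C Y D d d' k g \<longleftrightarrow> (\<forall>x\<in>carrier X. d' (k x) = tmap R X C Y D k g (d x))"

lemma coaction_map_comp:
  assumes m: "module R X" "module R C" "module R Y" "module R D" "module R Z" "module R E"
    and d: "rlinear R X (tensor R X C) d"
    and k: "k \<in> lin R X Y" "g \<in> lin R C D" "k' \<in> lin R Y Z" "g' \<in> lin R D E"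
    and c: "coaction_map R X C Y D d d' k g" "coaction_map R Y D Z E d' d'' k' g'"
  shows "coaction_map R X C Z E d d'' (compose (carrier X) k' k) (compose (carrier C) g' g)"
  unfolding coaction_map_def
proof
  fix x assume x: "x \<in> carrier X"
  note kx = lin_closed[OF k(1) x]
  have "d'' (k' (k x)) = tmap R Y D Z E k' g' (tmap R X C Y D k g (d x))"
    using c x kx by (simp add: coaction_map_def)
  then show "d'' (compose (carrier X) k' k x)
      = tmap R X C Z E (compose (carrier X) k' k) (compose (carrier C) g' g) (d x)"
    using x rlinear_closed[OF d x] by (simp add: tmap_compose[OF m k]) (simp add: compose_def)
qed

lemma coaction_map_id:
  assumes m: "module R X" "module R C" and d: "rlinear R X (tensor R X C) d"
  shows "coaction_map R X C X C d d (\<lambda>x\<in>carrier X. x) (\<lambda>x\<in>carrier C. x)"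
  using rlinear_closed[OF d] by (simp add: coaction_map_def tmap_restrict_id m)

text \<open>Write \<open>y = k (k' y)\<close>. Then \<open>d' y\<close> is the image of
  \<open>d (k' y)\<close> under \<open>k \<otimes> g\<close>, and applying
  \<open>k' \<otimes> g'\<close> cancels that map.\<close>

lemma coaction_map_inverse:
  assumes m: "module R X" "module R C" "module R Y" "module R D"
    and d: "rlinear R X (tensor R X C) d"
    and k: "k \<in> lin R X Y" "g \<in> lin R C D" "k' \<in> lin R Y X" "g' \<in> lin R D C"
    and inv: "\<And>x. x \<in> carrier X \<Longrightarrow> k' (k x) = x" "\<And>x. x \<in> carrier C \<Longrightarrow> g' (g x) = x"
        "\<And>x. x \<in> carrier Y \<Longrightarrow> k (k' x) = x"
    and c: "coaction_map R X C Y D d d' k g"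
  shows "coaction_map R Y D X C d' d k' g'"
  unfolding coaction_map_def
proof
  fix y assume y: "y \<in> carrier Y"
  note k'y = lin_closed[OF k(3) y]
  note dk = rlinear_closed[OF d k'y]
  have "d' y = tmap R X C Y D k g (d (k' y))" using c y inv(3)[OF y] k'y by (metis coaction_map_def)
  then have "tmap R Y D X C k' g' (d' y) = tmap R X C X C (\<lambda>x. k' (k x)) (\<lambda>x. g' (g x)) (d (k' y))"
    using tmap_comp[OF m m(1,2) k[THEN linD(1)]] dk by simp
  also have "\<dots> = tmap R X C X C (\<lambda>x. x) (\<lambda>x. x) (d (k' y))"
    using inv by (simp cong: tmap_cong[OF m(1,2)])
  also have "\<dots> = d (k' y)" using tmap_id[OF m(1,2)] dk by simp
  finally show "d (k' y) = tmap R Y D X C k' g' (d' y)" by simp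
qed

lemma coaction_map_tensor:
  assumes m: "module R X" "module R C" "module R Y" "module R D" "module R X'" "module R C'"
      "module R Y'" "module R D'"
    and d: "rlinear R X (tensor R X C) d" "rlinear R Y (tensor R Y D) d'"
     "rlinear R X' (tensor R X' C') e" "rlinear R Y' (tensor R Y' D') e'"
    and k: "rlinear R X X' k" "rlinear R C C' g" "rlinear R Y Y' k'" "rlinear R D D' g'"
    and c: "coaction_map R X C X' C' d e k g" "coaction_map R Y D Y' D' d' e' k' g'"
  shows "coaction_map R (tensor R X Y) (tensor R C D) (tensor R X' Y') (tensor R C' D')
    (coact_tensor R X C Y D d d') (coact_tensor R X' C' Y' D' e e') (tmap R X Y X' Y' k k')
        (tmap R C D C' D' g g')"
  unfolding coaction_map_def
  by (rule tensor_ball_ext[where P="tensor R (tensor R X' Y') (tensor R C' D')"];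
      (intro lin_intros m k rlinear_coact_tensor d rlinear_comp[OF rlinear_coact_tensor])?)
    (use c in \<open>simp add: lin_simps m k coact_tensor_pure d k[THEN rlinear_closed]
        d[THEN rlinear_closed]
      coaction_map_def tswap_natural[OF m k, rule_format, symmetric] rlinear_tmap\<close>)

abbreviation unit_coact where
  "unit_coact R \<equiv> (\<lambda>a. pure R (unit_module R) (unit_module R) a (Scalar \<one>\<^bsub>R\<^esub>))"

lemma coaction_map_tassoc:
  assumes m: "module R X" "module R C" "module R Y" "module R D" "module R Z" "module R E"
    and d: "rlinear R X (tensor R X C) d" "rlinear R Y (tensor R Y D) d'"
        "rlinear R Z (tensor R Z E) d''"
  shows "coaction_map R (tensor R (tensor R X Y) Z) (tensor R (tensor R C D) E)
      (tensor R X (tensor R Y Z)) (tensor R C (tensor R D E))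
    (coact_tensor R (tensor R X Y) (tensor R C D) Z E (coact_tensor R X C Y D d d') d'')
    (coact_tensor R X C (tensor R Y Z) (tensor R D E) d (coact_tensor R Y D Z E d' d''))
    (tassoc R X Y Z) (tassoc R C D E)"
  unfolding coaction_map_def
proof (rule tensor_ext_21[where P="tensor R (tensor R X (tensor R Y Z))
    (tensor R C (tensor R D E))"];
      (intro lin_intros m rlinear_coact_tensor d rlinear_comp[OF rlinear_coact_tensor]
          rlinear_tassoc)?)
  fix x y z assume xyz: "x \<in> carrier X" "y \<in> carrier Y" "z \<in> carrier Z"
  show "coact_tensor R X C (tensor R Y Z) (tensor R D E) d (coact_tensor R Y D Z E d' d'')
      (tassoc R X Y Z (pure R (tensor R X Y) Z (pure R X Y x y) z))
    = tmap R (tensor R (tensor R X Y) Z) (tensor R (tensor R C D) E) (tensor R X (tensor R Y Z))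
        (tensor R C (tensor R D E))
       (tassoc R X Y Z) (tassoc R C D E)
           (coact_tensor R (tensor R X Y) (tensor R C D) Z E (coact_tensor R X C Y D d d') d''
           (pure R (tensor R X Y) Z (pure R X Y x y) z))"
    \<comment> \<open>Once the three coactions have been applied, what remains is the coherence of
      the interchange at the element \<open>(d x \<otimes> d' y) \<otimes> d'' z\<close>.\<close>
    using tswap_tassoc[OF m, rule_format, of
        "pure R (tensor R (tensor R X C) (tensor R Y D)) (tensor R Z E)
        (pure R (tensor R X C) (tensor R Y D) (d x) (d' y)) (d'' z)"]
    by (simp add: xyz lin_simps m rlinear_coact_tensor coact_tensor_pure d d[THEN rlinear_closed]
        rlinear_tswap rlinear_id)
qed

section \<open>The monoidal category of comodules\<close>

lemma coaction_same:
  assumes "same_module X X'" "same_module C C'"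
  shows "coaction R X C d \<Delta> \<epsilon> = coaction R X' C' d \<Delta> \<epsilon>"
  using assms
  by (simp add: coaction_def replace_module[OF assms(1)] replace_module[OF assms(2)])

lemma coaction_map_same:
  assumes "same_module X X'" "same_module C C'" "same_module Y Y'" "same_module D D'"
  shows "coaction_map R X C Y D = coaction_map R X' C' Y' D'"
  by (simp add: fun_eq_iff coaction_map_def tmap_same[OF assms] replace_module(1)[OF assms(1)])

lemma coact_tensor_same:
  assumes "same_module X X'" "same_module C C'" "same_module Y Y'" "same_module D D'"
  shows "coact_tensor R X C Y D = coact_tensor R X' C' Y' D'"
  by (simp add: fun_eq_iff coact_tensor_def
      tmap_same[OF assms(1,3) same_module_refl same_module_refl] tswap_same[OF assms]
      tensor_same[OF assms(1,2)] tensor_same[OF assms(3,4)])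

lemma replace_module_coaction:
  assumes "same_module M M'"
  shows "coaction R M C = coaction R M' C" "coaction R C M = coaction R C M'"
    "coaction_map R M C P Q = coaction_map R M' C P Q"
        "coaction_map R C M P Q = coaction_map R C M' P Q"
    "coaction_map R P Q M C = coaction_map R P Q M' C"
        "coaction_map R P Q C M = coaction_map R P Q C M'"
    "coact_tensor R M C P Q = coact_tensor R M' C P Q"
        "coact_tensor R C M P Q = coact_tensor R C M' P Q"
    "coact_tensor R P Q M C = coact_tensor R P Q M' C"
        "coact_tensor R P Q C M = coact_tensor R P Q C M'"
  by ((intro ext, rule coaction_same; rule assms same_module_refl)
    | (rule coaction_map_same coact_tensor_same; rule assms same_module_refl))+

text \<open>In \<open>replace_module\<close> the module \<open>N\<close> also occurs inside tensor
  products, which forces its elements into the universe. Here \<open>N\<close> may have elements of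
  any type, as is needed for counits with values in \<open>ring_module R\<close>.\<close>

lemma replace_module_lin:
  assumes "same_module M M'"
  shows "rlinear R M N f \<longleftrightarrow> rlinear R M' N f" "lin R M N = lin R M' N"
  by (rule rlinear_same lin_same; rule assms same_module_refl)+

lemmas tensor_coalgebra_simps = replace_module_lin[OF same_module_coalgebra_tensor]
  replace_module[OF same_module_coalgebra_tensor]
      replace_module_coaction[OF same_module_coalgebra_tensor]
lemmas unit_coalgebra_simps = replace_module_lin[OF same_module_unit_coalgebra]
  replace_module[OF same_module_unit_coalgebra]
      replace_module_coaction[OF same_module_unit_coalgebra]

lemma coalgebra_tensor_sel:
  "comult (coalgebra_tensor R C D) = coact_tensor R C C D D (comult C) (comult D)"
  "counit (coalgebra_tensor R C D) = counit_tensor R (counit C) (counit D)"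
  by (simp_all add: coalgebra_tensor_def module.extend_def coalgebra.fields_def coact_tensor_def
      counit_tensor_def)

lemma comod_tensor_sel:
  "coalg (comod_tensor R X Y) = coalgebra_tensor R (coalg X) (coalg Y)"
  "cospace (comod_tensor R X Y) = tensor R (cospace X) (cospace Y)"
  "coact (comod_tensor R X Y) = coact_tensor R (cospace X) (coalg X) (cospace Y) (coalg Y) (coact X)
      (coact Y)"
  by (simp_all add: comod_tensor_def coact_tensor_def)

lemma unit_comod_sel:
  "coalg (unit_comod R) = unit_coalgebra R"
  "cospace (unit_comod R) = unit_module R"
  "coact (unit_comod R) = (unit_coact R)"
  "comult (unit_coalgebra R) = (unit_coact R)"
  "counit (unit_coalgebra R) = scalar"
  by (simp_all add: unit_comod_def unit_coalgebra_simps)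
    (simp_all add: unit_coalgebra_def module.extend_def coalgebra.fields_def)

section \<open>Comodules and their arrows in terms of coactions\<close>

lemma is_coalgebra_iff:
  "is_coalgebra R C \<longleftrightarrow> module R C \<and> rlinear R C (ring_module R) (counit C) \<and>
    coaction R C C (comult C) (comult C) (counit C) \<and>
    (\<forall>c\<in>carrier C. tlift C (\<lambda>c1 c2. counit C c1 \<odot>\<^bsub>C\<^esub> c2) (comult C c) = c)"
  by (auto simp: is_coalgebra_def coaction_def)

lemma is_comod_iff:
  "is_comod R X \<longleftrightarrow> is_coalgebra R (coalg X) \<and> module R (cospace X) \<and>
    coaction R (cospace X) (coalg X) (coact X) (comult (coalg X)) (counit (coalg X))"
  by (auto simp: is_comod_def coaction_def)

lemma is_comodD:
  assumes "is_comod R X"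
  shows "module R (cospace X)" "module R (coalg X)"
    "rlinear R (cospace X) (tensor R (cospace X) (coalg X)) (coact X)"
    "rlinear R (coalg X) (tensor R (coalg X) (coalg X)) (comult (coalg X))"
    "rlinear R (coalg X) (ring_module R) (counit (coalg X))"
    "coaction R (cospace X) (coalg X) (coact X) (comult (coalg X)) (counit (coalg X))"
    "coaction R (coalg X) (coalg X) (comult (coalg X)) (comult (coalg X)) (counit (coalg X))"
    "c \<in> carrier (coalg X) \<Longrightarrow> tlift (coalg X) (\<lambda>c1 c2. counit (coalg X) c1 \<odot>\<^bsub>coalg X\<^esub> c2)
        (comult (coalg X) c) = c"
  using assms by (auto simp: is_comod_iff is_coalgebra_iff coactionD(1))

lemma is_comod_tensor:
  assumes X: "is_comod R X" and Y: "is_comod R Y"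
  shows "is_comod R (comod_tensor R X Y)"
  unfolding is_comod_iff is_coalgebra_iff comod_tensor_sel coalgebra_tensor_sel
      tensor_coalgebra_simps
  by (intro conjI tensor_module rlinear_counit_tensor coaction_tensor left_counit_tensor
      is_comodD[OF X] is_comodD[OF Y])

lemma coaction_unit:
  assumes "cring R"
  shows "coaction R (unit_module R) (unit_module R) (unit_coact R)
    (unit_coact R) scalar"
proof -
  interpret cring R by fact
  note u = module_unit[OF assms]
  have 1: "Scalar \<one>\<^bsub>R\<^esub> \<in> carrier (unit_module R)" by (simp add: Scalar_closed)
  have l: "rlinear R (unit_module R) (tensor R (unit_module R) (unit_module R)) (unit_coact R)"
    by (intro rlinear_pure_left u 1 rlinear_id)
  show ?thesis
  proof (rule coactionI[OF l]; rule ballI)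
    fix a assume a: "a \<in> carrier (unit_module R)"
    show "tassoc R (unit_module R) (unit_module R) (unit_module R)
       (tmap R (unit_module R) (unit_module R) (tensor R (unit_module R) (unit_module R))
           (unit_module R)
         (unit_coact R) (\<lambda>c. c) (pure R (unit_module R) (unit_module R) a (Scalar \<one>\<^bsub>R\<^esub>)))
      = tmap R (unit_module R) (unit_module R) (unit_module R)
          (tensor R (unit_module R) (unit_module R))
         (\<lambda>y. y) (unit_coact R) (pure R (unit_module R) (unit_module R) a (Scalar \<one>\<^bsub>R\<^esub>))"
      by (simp add: lin_simps u a 1 rlinear_id l)
    show "tlift (unit_module R) (\<lambda>y c. scalar c \<odot>\<^bsub>unit_module R\<^esub> y)
        (pure R (unit_module R) (unit_module R) a (Scalar \<one>\<^bsub>R\<^esub>)) = a"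
      using a by (simp add: tlift_pure[OF u u u bilinear_counit_right[OF u u rlinear_scalar]] 1
          module_one[OF u])
  qed
qed

lemma is_comod_unit:
  fixes R :: "'a ring"
  assumes "cring R"
  shows "is_comod R (unit_comod R :: ('a, 'b) comod)"
proof -
  interpret cring R by fact
  note u = module_unit[OF assms]
  have 1: "Scalar \<one>\<^bsub>R\<^esub> \<in> carrier (unit_module R)" by (simp add: Scalar_closed)
  have "tlift (unit_module R) (\<lambda>c1 c2. scalar c1 \<odot>\<^bsub>unit_module R\<^esub> c2)
      (pure R (unit_module R) (unit_module R) a (Scalar \<one>\<^bsub>R\<^esub>)) = a"
    if "a \<in> carrier (unit_module R)" for a :: "('a, 'b) univ"
    using that by (auto elim!: unit_carrierE
        simp: tlift_pure[OF u u u bilinear_counit_left[OF u u rlinear_scalar]] 1 Scalar_smult assms)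
  then show ?thesis
    by (simp add: is_comod_iff is_coalgebra_iff unit_comod_sel unit_coalgebra_simps u rlinear_scalar
        coaction_unit assms)
qed

text \<open>A comodule map out of the pushforward along \<open>g\<close> applies
  \<open>1 \<otimes> g\<close> first and \<open>k \<otimes> 1\<close> afterwards, and by
  functoriality the composite is \<open>k \<otimes> g\<close>. An arrow is thus a pair of linear
  maps under conditions that no longer mention the pushforward.\<close>

lemma comod_arrs_iff:
  assumes X: "is_comod R X" and Y: "is_comod R Y"
  shows "u \<in> comod_arrs R X Y \<longleftrightarrow>
    fst u \<in> lin R (cospace X) (cospace Y) \<and> snd u \<in> lin R (coalg X) (coalg Y) \<and>
    coaction_map R (cospace X) (coalg X) (cospace Y) (coalg Y) (coact X) (coact Y) (fst u) (snd u) \<and>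
    coaction_map R (coalg X) (coalg X) (coalg Y) (coalg Y) (comult (coalg X)) (comult (coalg Y))
        (snd u) (snd u) \<and>
    (\<forall>c\<in>carrier (coalg X). counit (coalg Y) (snd u c) = counit (coalg X) c)"
proof -
  note m = is_comodD(1,2)[OF X] is_comodD(1,2)[OF Y]
  have "tmap R (cospace X) (coalg Y) (cospace Y) (coalg Y) (fst u) (\<lambda>d. d)
       (tmap R (cospace X) (coalg X) (cospace X) (coalg Y) (\<lambda>y. y) (snd u) (coact X x))
     = tmap R (cospace X) (coalg X) (cospace Y) (coalg Y) (fst u) (snd u) (coact X x)"
    if "x \<in> carrier (cospace X)" "fst u \<in> lin R (cospace X) (cospace Y)"
        "snd u \<in> lin R (coalg X) (coalg Y)" for x
    using tmap_comp[OF m(1,2,1,4,3,4) rlinear_id linD(1)[OF that(3)] linD(1)[OF that(2)] rlinear_id]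
      rlinear_closed[OF is_comodD(3)[OF X] that(1)] by simp
  then show ?thesis
    by (cases u) (auto simp: comod_arrs_def coalgebra_maps_def comodule_maps_def pushforward_def
        coaction_map_def)
qed

section \<open>The category structure and tensor products of arrows\<close>

lemma Comod_sel:
  "Obj (Comod R) = {X. is_comod R X}" "Arr (Comod R) = comod_arrs R" "Idn (Comod R) = comod_id"
  "Cmp (Comod R) X Y Z v u = comod_cmp X v u" "Unt (Comod R) = unit_comod R"
      "TObj (Comod R) = comod_tensor R"
  "TArr (Comod R) X Y X' Y' u v =
       (tmap R (cospace X) (cospace Y) (cospace X') (cospace Y') (fst u) (fst v),
        tmap R (coalg X) (coalg Y) (coalg X') (coalg Y') (snd u) (snd v))"
  "Assoc (Comod R) X Y Z = (tassoc R (cospace X) (cospace Y) (cospace Z), tassoc R (coalg X)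
      (coalg Y) (coalg Z))"
  "Lunit (Comod R) X = (lin_lunit R (cospace X), lin_lunit R (coalg X))"
  "Runit (Comod R) X = (lin_runit R (cospace X), lin_runit R (coalg X))"
  by (simp_all add: Comod_def)

lemma lin_id: "module R M \<Longrightarrow> (\<lambda>x\<in>carrier M. x) \<in> lin R M M"
  by (simp add: lin_def rlinear_restrict rlinear_id)

lemma lin_compose: "module R M \<Longrightarrow> f \<in> lin R M N \<Longrightarrow> g \<in> lin R N P
    \<Longrightarrow> compose (carrier M) g f \<in> lin R M P"
  by (auto simp: lin_def compose_def rlinear_restrict intro: rlinear_comp)

lemma comod_id_arr:
  assumes X: "is_comod R X"
  shows "comod_id X \<in> comod_arrs R X X"
  by (simp add: comod_arrs_iff assms comod_id_def lin_id is_comodD[OF X] coaction_map_id)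

lemma comod_cmp_arr:
  assumes X: "is_comod R X" and Y: "is_comod R Y" and Z: "is_comod R Z"
    and u: "u \<in> comod_arrs R X Y" and v: "v \<in> comod_arrs R Y Z"
  shows "comod_cmp X v u \<in> comod_arrs R X Z"
proof -
  note m = is_comodD(1,2)[OF X] is_comodD(1,2)[OF Y] is_comodD(1,2)[OF Z]
  note u' = u[unfolded comod_arrs_iff[OF X Y]] and v' = v[unfolded comod_arrs_iff[OF Y Z]]
  show ?thesis
    unfolding comod_arrs_iff[OF X Z] comod_cmp_def fst_conv snd_conv
  proof (intro conjI)
    show "compose (carrier (cospace X)) (fst v) (fst u) \<in> lin R (cospace X) (cospace Z)"
      "compose (carrier (coalg X)) (snd v) (snd u) \<in> lin R (coalg X) (coalg Z)"
      using u' v' m by (auto intro: lin_compose)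
    show "coaction_map R (cospace X) (coalg X) (cospace Z) (coalg Z) (coact X) (coact Z)
       (compose (carrier (cospace X)) (fst v) (fst u))
           (compose (carrier (coalg X)) (snd v) (snd u))"
      using u' v' by (intro coaction_map_comp[OF m is_comodD(3)[OF X]]) auto
    show "coaction_map R (coalg X) (coalg X) (coalg Z) (coalg Z) (comult (coalg X))
        (comult (coalg Z))
       (compose (carrier (coalg X)) (snd v) (snd u)) (compose (carrier (coalg X)) (snd v) (snd u))"
      using u' v' by (intro coaction_map_comp[OF m(2,2,4,4,6,6) is_comodD(4)[OF X]]) auto
    show "\<forall>c\<in>carrier (coalg X). counit (coalg Z) (compose (carrier (coalg X)) (snd v) (snd u) c)
        = counit (coalg X) c"
    proof
      fix c assume c: "c \<in> carrier (coalg X)"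
      have "snd u \<in> lin R (coalg X) (coalg Y)" using u' by simp
      from lin_closed[OF this c] have "snd u c \<in> carrier (coalg Y)" .
      then show "counit (coalg Z) (compose (carrier (coalg X)) (snd v) (snd u) c)
          = counit (coalg X) c"
        using u' v' c by (simp add: compose_def)
    qed
  qed
qed

lemma comod_arrs_lin:
  assumes "is_comod R X" "is_comod R Y" "u \<in> comod_arrs R X Y"
  shows "fst u \<in> lin R (cospace X) (cospace Y)" "snd u \<in> lin R (coalg X) (coalg Y)"
  using assms(3) by (simp_all add: comod_arrs_iff[OF assms(1,2)])

lemma category_Comod: "category (Comod R)"
proof (rule category.intro)
  fix X :: "('a, 'b) comod" assume "X \<in> Obj (Comod R)"
  then show "Idn (Comod R) X \<in> Arr (Comod R) X X" by (simp add: Comod_sel comod_id_arr)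
next
  fix X Y Z :: "('a, 'b) comod" and f g assume "X \<in> Obj (Comod R)" "Y \<in> Obj (Comod R)"
      "Z \<in> Obj (Comod R)"
    "f \<in> Arr (Comod R) X Y" "g \<in> Arr (Comod R) Y Z"
  then show "Cmp (Comod R) X Y Z g f \<in> Arr (Comod R) X Z" by (simp add: Comod_sel comod_cmp_arr)
next
  fix X Y :: "('a, 'b) comod" and f assume a: "X \<in> Obj (Comod R)" "Y \<in> Obj (Comod R)"
      "f \<in> Arr (Comod R) X Y"
  then have "fst f \<in> lin R (cospace X) (cospace Y)" "snd f \<in> lin R (coalg X) (coalg Y)"
    by (auto simp: Comod_sel comod_arrs_lin)
  then show "Cmp (Comod R) X X Y f (Idn (Comod R) X) = f"
      "Cmp (Comod R) X Y Y (Idn (Comod R) Y) f = f"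
    by (auto simp: Comod_sel comod_cmp_def comod_id_def compose_def prod_eq_iff lin_closed
        intro!: extensionalityI[OF _ linD(2)])
next
  fix X Y Z W :: "('a, 'b) comod" and f g h assume a: "X \<in> Obj (Comod R)" "Y \<in> Obj (Comod R)"
      "Z \<in> Obj (Comod R)"
    "W \<in> Obj (Comod R)" "f \<in> Arr (Comod R) X Y" "g \<in> Arr (Comod R) Y Z" "h \<in> Arr (Comod R) Z W"
  then have "fst f \<in> lin R (cospace X) (cospace Y)" "snd f \<in> lin R (coalg X) (coalg Y)"
    by (auto simp: Comod_sel comod_arrs_lin)
  then show "Cmp (Comod R) X Z W h (Cmp (Comod R) X Y Z g f)
      = Cmp (Comod R) X Y W (Cmp (Comod R) Y Z W h g) f"
    by (auto simp: Comod_sel comod_cmp_def compose_def lin_closed intro!: restrict_ext)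
qed

lemma comod_tarr_arr:
  assumes X: "is_comod R X" and Y: "is_comod R Y" and X': "is_comod R X'" and Y': "is_comod R Y'"
    and u: "u \<in> comod_arrs R X X'" and v: "v \<in> comod_arrs R Y Y'"
  shows "TArr (Comod R) X Y X' Y' u v \<in> comod_arrs R (comod_tensor R X Y) (comod_tensor R X' Y')"
proof -
  note m = is_comodD(1,2)[OF X] is_comodD(1,2)[OF Y] is_comodD(1,2)[OF X'] is_comodD(1,2)[OF Y']
  note u' = u[unfolded comod_arrs_iff[OF X X']] and v' = v[unfolded comod_arrs_iff[OF Y Y']]
  have l: "rlinear R (cospace X) (cospace X') (fst u)" "rlinear R (coalg X) (coalg X') (snd u)"
    "rlinear R (cospace Y) (cospace Y') (fst v)" "rlinear R (coalg Y) (coalg Y') (snd v)"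
    using u' v' linD(1) by auto
  note d = is_comodD(3)[OF X] is_comodD(3)[OF Y] is_comodD(3)[OF X'] is_comodD(3)[OF Y']
    and c = is_comodD(4)[OF X] is_comodD(4)[OF Y] is_comodD(4)[OF X'] is_comodD(4)[OF Y']
    and e = is_comodD(5)[OF X] is_comodD(5)[OF Y] is_comodD(5)[OF X'] is_comodD(5)[OF Y']
  show ?thesis
    unfolding comod_arrs_iff[OF is_comod_tensor[OF X Y] is_comod_tensor[OF X' Y']] Comod_sel
        fst_conv snd_conv
      comod_tensor_sel coalgebra_tensor_sel tensor_coalgebra_simps
  proof (intro conjI)
    show "\<forall>t\<in>carrier (tensor R (coalg X) (coalg Y)). counit_tensor R (counit (coalg X'))
        (counit (coalg Y'))
           (tmap R (coalg X) (coalg Y) (coalg X') (coalg Y') (snd u) (snd v) t)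
               = counit_tensor R (counit (coalg X)) (counit (coalg Y)) t"
    proof (rule tensor_ball_ext[where P="ring_module R"];
        (intro m rlinear_counit_tensor rlinear_comp[OF rlinear_counit_tensor[OF m(6,8) e(3,4)]]
            rlinear_tmap l e module_ring_module module_cring[OF m(1)])?)
      fix x y assume "x \<in> carrier (coalg X)" "y \<in> carrier (coalg Y)"
      then show "counit_tensor R (counit (coalg X')) (counit (coalg Y'))
           (tmap R (coalg X) (coalg Y) (coalg X') (coalg Y') (snd u) (snd v)
               (pure R (coalg X) (coalg Y) x y))
         = counit_tensor R (counit (coalg X)) (counit (coalg Y)) (pure R (coalg X) (coalg Y) x y)"
        using u' v' by (simp add: tmap_pure m l counit_tensor_pure e l[THEN rlinear_closed])
    qed
  qed (use u' v' in \<open>auto intro!: tmap_lin m l coaction_map_tensor d c\<close>)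
qed

text \<open>Linear inverses of the two components automatically form an arrow: compatibility with
  coactions passes to inverses, and so does preservation of counits. Invertibility of the
  constraints is thereby reduced to linear algebra.\<close>

lemma comod_arr_inverse:
  assumes X: "is_comod R X" and Y: "is_comod R Y" and u: "u \<in> comod_arrs R X Y"
    and v: "fst v \<in> lin R (cospace Y) (cospace X)" "snd v \<in> lin R (coalg Y) (coalg X)"
    and inv: "\<And>x. x \<in> carrier (cospace X) \<Longrightarrow> fst v (fst u x) = x"
        "\<And>x. x \<in> carrier (coalg X) \<Longrightarrow> snd v (snd u x) = x"
      "\<And>x. x \<in> carrier (cospace Y) \<Longrightarrow> fst u (fst v x) = x"
          "\<And>x. x \<in> carrier (coalg Y) \<Longrightarrow> snd u (snd v x) = x"
  shows "inverse_arr (Comod R) X Y u v"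
proof -
  note m = is_comodD(1,2)[OF X] is_comodD(1,2)[OF Y]
  note u' = u[unfolded comod_arrs_iff[OF X Y]]
  have "counit (coalg X) (snd v c) = counit (coalg Y) c" if "c \<in> carrier (coalg Y)" for c
    using u' lin_closed[OF v(2) that] inv(4)[OF that] by force
  then have "v \<in> comod_arrs R Y X"
    unfolding comod_arrs_iff[OF Y X]
    using u' v inv
    by (auto intro!: coaction_map_inverse[OF m is_comodD(3)[OF X], where k="fst u" and g="snd u"]
        coaction_map_inverse[OF m(2,2,4,4) is_comodD(4)[OF X], where k="snd u" and g="snd u"])
  moreover have "comod_cmp X v u = comod_id X" "comod_cmp Y u v = comod_id Y"
    using inv by (auto simp: comod_cmp_def comod_id_def compose_def intro!: restrict_ext)
  ultimately show ?thesis using u by (simp add: inverse_arr_def Comod_sel)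
qed

section \<open>Associativity and unit constraints\<close>

lemma comod_assoc_arr:
  assumes X: "is_comod R X" and Y: "is_comod R Y" and Z: "is_comod R Z"
  shows "Assoc (Comod R) X Y Z
      \<in> comod_arrs R (comod_tensor R (comod_tensor R X Y) Z)
      (comod_tensor R X (comod_tensor R Y Z))"
proof -
  note m = is_comodD(1,2)[OF X] is_comodD(1,2)[OF Y] is_comodD(1,2)[OF Z]
  note d = is_comodD(3)[OF X] is_comodD(3)[OF Y] is_comodD(3)[OF Z]
    and c = is_comodD(4)[OF X] is_comodD(4)[OF Y] is_comodD(4)[OF Z]
    and e = is_comodD(5)[OF X] is_comodD(5)[OF Y] is_comodD(5)[OF Z]
  interpret cring R by (rule module_cring[OF m(1)])
  show ?thesis
    unfolding comod_arrs_iff[OF is_comod_tensor[OF is_comod_tensor[OF X Y] Z]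
        is_comod_tensor[OF X is_comod_tensor[OF Y Z]]] Comod_sel fst_conv snd_conv
      comod_tensor_sel coalgebra_tensor_sel tensor_coalgebra_simps
  proof (intro conjI tassoc_lin coaction_map_tassoc m d c)
    show "\<forall>t\<in>carrier (tensor R (tensor R (coalg X) (coalg Y)) (coalg Z)).
       counit_tensor R (counit (coalg X)) (counit_tensor R (counit (coalg Y)) (counit (coalg Z)))
           (tassoc R (coalg X) (coalg Y) (coalg Z) t)
      = counit_tensor R (counit_tensor R (counit (coalg X)) (counit (coalg Y))) (counit (coalg Z))
          t"
      by (rule tensor_ext_21[where P="ring_module R"];
        (intro m tensor_module rlinear_counit_tensor
          rlinear_comp[OF rlinear_counit_tensor[OF m(2) tensor_module[OF m(4,6)] e(1)
              rlinear_counit_tensor[OF m(4,6) e(2,3)]]] rlinear_tassoc e module_ring_module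
              module_cring[OF m(1)])?)
        (simp add: lin_simps m counit_tensor_pure rlinear_counit_tensor e m_assoc
            e[THEN ring_module_closed])
  qed
qed

lemma comod_assoc_iso:
  assumes X: "is_comod R X" and Y: "is_comod R Y" and Z: "is_comod R Z"
  shows "iso_arr (Comod R) (comod_tensor R (comod_tensor R X Y) Z)
      (comod_tensor R X (comod_tensor R Y Z)) (Assoc (Comod R) X Y Z)"
  unfolding iso_arr_def
proof
  note m = is_comodD(1,2)[OF X] is_comodD(1,2)[OF Y] is_comodD(1,2)[OF Z]
  show "inverse_arr (Comod R) (comod_tensor R (comod_tensor R X Y) Z)
      (comod_tensor R X (comod_tensor R Y Z)) (Assoc (Comod R) X Y Z)
    (tassoc_inv R (cospace X) (cospace Y) (cospace Z), tassoc_inv R (coalg X) (coalg Y) (coalg Z))"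
    by (rule comod_arr_inverse[OF is_comod_tensor[OF is_comod_tensor[OF X Y] Z]
        is_comod_tensor[OF X is_comod_tensor[OF Y Z]] comod_assoc_arr[OF X Y Z]])
      (simp_all add: comod_tensor_sel Comod_sel tensor_coalgebra_simps tassoc_inv_lin
          tassoc_inv_left tassoc_inv_right m)
qed

lemma coaction_map_lunit:
  assumes m: "module R X" "module R C" and d: "rlinear R X (tensor R X C) d"
  shows "coaction_map R (tensor R (unit_module R) X) (tensor R (unit_module R) C) X C
    (coact_tensor R (unit_module R) (unit_module R) X C (unit_coact R) d) d
    (lin_lunit R X) (lin_lunit R C)"
proof -
  interpret cring R by (rule module_cring[OF m(1)])
  let ?I = "unit_module R"
  note u = module_unit[OF module_cring[OF m(1)]]
  have 1: "Scalar \<one>\<^bsub>R\<^esub> \<in> carrier (unit_module R)" by (simp add: Scalar_closed)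
  have l: "rlinear R ?I (tensor R ?I ?I) (\<lambda>a. pure R ?I ?I a (Scalar \<one>\<^bsub>R\<^esub>))"
    by (intro rlinear_pure_left u 1 rlinear_id)
  \<comment> \<open>The interchange and the unit maps are computed for a general \<open>s\<close>,
    since \<open>d x\<close> is an arbitrary tensor. The coaction of the unit contributes
    \<open>r \<otimes> 1\<close>, the outcome is \<open>r s\<close>, and linearity of
    \<open>d\<close> identifies it with \<open>d (r x)\<close> when \<open>s = d x\<close>.\<close>
  have *: "\<forall>s\<in>carrier (tensor R X C). tmap R (tensor R ?I X) (tensor R ?I C) X C (lin_lunit R X)
      (lin_lunit R C)
      (tswap R ?I ?I X C (pure R (tensor R ?I ?I) (tensor R X C)
          (pure R ?I ?I (Scalar r) (Scalar \<one>\<^bsub>R\<^esub>)) s)) = r \<odot>\<^bsub>tensor R X C\<^esub> s"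
    if "r \<in> carrier R" for r
    by (rule tensor_ball_ext[where P="tensor R X C"];
        (intro lin_intros m u rlinear_lunit 1 rlinear_smult_const that)?)
      (simp_all add: lin_simps m u 1 Scalar_closed that rlinear_lunit lin_lunit_pure pure_unit_swap
          module_one)
  show ?thesis
    unfolding coaction_map_def
    by (rule tensor_ball_ext[where P="tensor R X C"];
      (intro lin_intros m u rlinear_comp[OF d] rlinear_lunit rlinear_coact_tensor d l
          rlinear_comp[OF rlinear_coact_tensor])?)
      (auto elim!: unit_carrierE simp: coact_tensor_pure m u d l Scalar_closed lin_lunit_pure *
          rlinear_closed[OF d] rlinear_smult[OF d])
qed

lemma coaction_map_runit:
  assumes m: "module R X" "module R C" and d: "rlinear R X (tensor R X C) d"
  shows "coaction_map R (tensor R X (unit_module R)) (tensor R C (unit_module R)) X C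
    (coact_tensor R X C (unit_module R) (unit_module R) d (unit_coact R)) d
    (lin_runit R X) (lin_runit R C)"
proof -
  interpret cring R by (rule module_cring[OF m(1)])
  let ?I = "unit_module R"
  note u = module_unit[OF module_cring[OF m(1)]]
  have 1: "Scalar \<one>\<^bsub>R\<^esub> \<in> carrier (unit_module R)" by (simp add: Scalar_closed)
  have l: "rlinear R ?I (tensor R ?I ?I) (\<lambda>a. pure R ?I ?I a (Scalar \<one>\<^bsub>R\<^esub>))"
    by (intro rlinear_pure_left u 1 rlinear_id)
  have *: "\<forall>s\<in>carrier (tensor R X C). tmap R (tensor R X ?I) (tensor R C ?I) X C (lin_runit R X)
      (lin_runit R C)
      (tswap R X C ?I ?I (pure R (tensor R X C) (tensor R ?I ?I) s
          (pure R ?I ?I (Scalar r) (Scalar \<one>\<^bsub>R\<^esub>)))) = r \<odot>\<^bsub>tensor R X C\<^esub> s"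
    if "r \<in> carrier R" for r
    by (rule tensor_ball_ext[where P="tensor R X C"];
        (intro lin_intros m u rlinear_runit 1 rlinear_smult_const that)?)
      (simp_all add: lin_simps m u 1 Scalar_closed that rlinear_runit lin_runit_pure pure_unit_swap
          module_one)
  show ?thesis
    unfolding coaction_map_def
    by (rule tensor_ball_ext[where P="tensor R X C"];
      (intro lin_intros m u rlinear_comp[OF d] rlinear_runit rlinear_coact_tensor d l
          rlinear_comp[OF rlinear_coact_tensor])?)
      (auto elim!: unit_carrierE simp: coact_tensor_pure m u d l Scalar_closed lin_runit_pure *
          rlinear_closed[OF d] rlinear_smult[OF d])
qed

lemma comod_lunit_arr:
  assumes X: "is_comod R X"
  shows "Lunit (Comod R) X \<in> comod_arrs R (comod_tensor R (unit_comod R) X) X"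
proof -
  note m = is_comodD(1,2)[OF X] and d = is_comodD(3,4)[OF X] and e = is_comodD(5)[OF X]
  note cr = module_cring[OF m(1)] and u = module_unit[OF module_cring[OF m(1)]]
  interpret cring R by (rule cr)
  show ?thesis
    unfolding comod_arrs_iff[OF is_comod_tensor[OF is_comod_unit[OF cr] X] X] Comod_sel fst_conv
        snd_conv
      comod_tensor_sel coalgebra_tensor_sel tensor_coalgebra_simps unit_comod_sel
          unit_coalgebra_simps
  proof (intro conjI coaction_map_lunit m d)
    show "lin_lunit R (cospace X) \<in> lin R (tensor R (unit_module R) (cospace X)) (cospace X)"
      "lin_lunit R (coalg X) \<in> lin R (tensor R (unit_module R) (coalg X)) (coalg X)"
      using rlinear_lunit[OF m(1)] rlinear_lunit[OF m(2)]
          by (simp_all add: lin_def) (simp_all add: lin_lunit_def)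
    show "\<forall>c\<in>carrier (tensor R (unit_module R) (coalg X)).
       counit (coalg X) (lin_lunit R (coalg X) c) = counit_tensor R scalar (counit (coalg X)) c"
      by (rule tensor_ball_ext[where P="ring_module R"];
        (intro m u tensor_module rlinear_counit_tensor rlinear_comp[OF e] rlinear_lunit e
            module_ring_module cr rlinear_scalar)?)
        (auto elim!: unit_carrierE simp: lin_lunit_pure m u e counit_tensor_pure rlinear_scalar
            Scalar_closed rlinear_smult[OF e], simp add: ring_module_def)
  qed
qed

lemma comod_runit_arr:
  assumes X: "is_comod R X"
  shows "Runit (Comod R) X \<in> comod_arrs R (comod_tensor R X (unit_comod R)) X"
proof -
  note m = is_comodD(1,2)[OF X] and d = is_comodD(3,4)[OF X] and e = is_comodD(5)[OF X]
  note cr = module_cring[OF m(1)] and u = module_unit[OF module_cring[OF m(1)]]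
  interpret cring R by (rule cr)
  show ?thesis
    unfolding comod_arrs_iff[OF is_comod_tensor[OF X is_comod_unit[OF cr]] X] Comod_sel fst_conv
        snd_conv
      comod_tensor_sel coalgebra_tensor_sel tensor_coalgebra_simps unit_comod_sel
          unit_coalgebra_simps
  proof (intro conjI coaction_map_runit m d)
    show "lin_runit R (cospace X) \<in> lin R (tensor R (cospace X) (unit_module R)) (cospace X)"
      "lin_runit R (coalg X) \<in> lin R (tensor R (coalg X) (unit_module R)) (coalg X)"
      using rlinear_runit[OF m(1)] rlinear_runit[OF m(2)]
          by (simp_all add: lin_def) (simp_all add: lin_runit_def)
    show "\<forall>c\<in>carrier (tensor R (coalg X) (unit_module R)).
       counit (coalg X) (lin_runit R (coalg X) c) = counit_tensor R (counit (coalg X)) scalar c"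
      by (rule tensor_ball_ext[where P="ring_module R"];
        (intro m u tensor_module rlinear_counit_tensor rlinear_comp[OF e] rlinear_runit e
            module_ring_module cr rlinear_scalar)?)
        (auto elim!: unit_carrierE simp: lin_runit_pure m u e counit_tensor_pure rlinear_scalar
            Scalar_closed rlinear_smult[OF e], simp add: ring_module_def m_comm
            ring_module_closed[OF e])
  qed
qed

lemma comod_lunit_inverse:
  assumes X: "is_comod R X"
  shows "inverse_arr (Comod R) (comod_tensor R (unit_comod R) X) X (Lunit (Comod R) X)
    (lin_lunit_inv R (cospace X), lin_lunit_inv R (coalg X))"
proof -
  note m = is_comodD(1,2)[OF X]
  show ?thesis
    by (rule comod_arr_inverse[OF is_comod_tensor[OF is_comod_unit[OF module_cring[OF m(1)]] X] X
        comod_lunit_arr[OF X]])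
      (simp_all add: comod_tensor_sel Comod_sel tensor_coalgebra_simps unit_comod_sel
          unit_coalgebra_simps
        lin_lunit_inv_lin lin_lunit_inv_left lin_lunit_inv_right m)
qed

lemma comod_runit_inverse:
  assumes X: "is_comod R X"
  shows "inverse_arr (Comod R) (comod_tensor R X (unit_comod R)) X (Runit (Comod R) X)
    (lin_runit_inv R (cospace X), lin_runit_inv R (coalg X))"
proof -
  note m = is_comodD(1,2)[OF X]
  show ?thesis
    by (rule comod_arr_inverse[OF is_comod_tensor[OF X is_comod_unit[OF module_cring[OF m(1)]]] X
        comod_runit_arr[OF X]])
      (simp_all add: comod_tensor_sel Comod_sel tensor_coalgebra_simps unit_comod_sel
          unit_coalgebra_simps
        lin_runit_inv_lin lin_runit_inv_left lin_runit_inv_right m)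
qed

lemma monoidal_category_Comod:
  fixes R :: "'a ring"
  assumes cr: "cring R"
  shows "monoidal_category (Comod R)"
proof -
  let ?W = "Comod R :: (('a, 'b) comod, ('a, 'b) comod_arr) moncat"
  let ?T = "comod_tensor R :: ('a, 'b) comod \<Rightarrow> _" and ?I = "unit_comod R :: ('a, 'b) comod"
  show ?thesis
  proof (intro monoidal_category.intro category_Comod monoidal_category_axioms.intro;
      unfold Comod_sel(1,2,5,6) mem_Collect_eq)
    show "is_comod R ?I" by (rule is_comod_unit[OF cr])
  next
    fix X Y :: "('a, 'b) comod" assume X: "is_comod R X" and Y: "is_comod R Y"
    then show "is_comod R (?T X Y)" by (rule is_comod_tensor)
    show "TArr ?W X Y X Y (Idn ?W X) (Idn ?W Y) = Idn ?W (?T X Y)"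
      by (simp add: Comod_sel comod_id_def comod_tensor_sel tensor_coalgebra_simps tmap_restrict_id
          is_comodD[OF X] is_comodD[OF Y])
    show "Cmp ?W (?T (?T X ?I) Y) (?T X (?T ?I Y))
          (?T X Y) (TArr ?W X (?T ?I Y) X Y (Idn ?W X) (Lunit ?W Y))
          (Assoc ?W X ?I Y)
        = TArr ?W (?T X ?I) Y X Y (Runit ?W X) (Idn ?W Y)"
      by (simp add: Comod_sel comod_id_def comod_cmp_def comod_tensor_sel tensor_coalgebra_simps
          unit_comod_sel unit_coalgebra_simps
          triangle_compose is_comodD[OF X] is_comodD[OF Y])
  next
    fix X Y X' Y' :: "('a, 'b) comod" and f g
    assume "is_comod R X" "is_comod R Y" "is_comod R X'" "is_comod R Y'" "f \<in> comod_arrs R X X'"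
        "g \<in> comod_arrs R Y Y'"
    then show "TArr ?W X Y X' Y' f g \<in> comod_arrs R (?T X Y) (?T X' Y')"
      by (rule comod_tarr_arr)
  next
    fix X Y X' Y' X'' Y'' :: "('a, 'b) comod" and f f' g g'
    assume o: "is_comod R X" "is_comod R Y" "is_comod R X'" "is_comod R Y'" "is_comod R X''"
        "is_comod R Y''"
      and a: "f \<in> comod_arrs R X X'" "f' \<in> comod_arrs R X' X''" "g \<in> comod_arrs R Y Y'"
          "g' \<in> comod_arrs R Y' Y''"
    show "TArr ?W X Y X'' Y'' (Cmp ?W X X' X'' f' f) (Cmp ?W Y Y' Y'' g' g)
      = Cmp ?W (?T X Y) (?T X' Y') (?T X'' Y'')
          (TArr ?W X' Y' X'' Y'' f' g') (TArr ?W X Y X' Y' f g)"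
      using o[THEN is_comodD(1)] o[THEN is_comodD(2)] comod_arrs_lin[OF o(1,3) a(1)]
          comod_arrs_lin[OF o(3,5) a(2)]
        comod_arrs_lin[OF o(2,4) a(3)] comod_arrs_lin[OF o(4,6) a(4)]
      by (simp add: Comod_sel comod_cmp_def comod_tensor_sel tensor_coalgebra_simps tmap_compose)
  next
    fix X Y Z :: "('a, 'b) comod"
    assume "is_comod R X" "is_comod R Y" "is_comod R Z"
    then show "iso_arr ?W (?T (?T X Y) Z) (?T X (?T Y Z)) (Assoc ?W X Y Z)"
      by (rule comod_assoc_iso)
  next
    fix X :: "('a, 'b) comod"
    assume "is_comod R X"
    then show "iso_arr ?W (?T ?I X) X (Lunit ?W X)"
      "iso_arr ?W (?T X ?I) X (Runit ?W X)"
      unfolding iso_arr_def using comod_lunit_inverse comod_runit_inverse by blast+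
  next
    fix X Y Z X' Y' Z' :: "('a, 'b) comod" and f g h
    assume o: "is_comod R X" "is_comod R Y" "is_comod R Z" "is_comod R X'" "is_comod R Y'"
        "is_comod R Z'"
      and a: "f \<in> comod_arrs R X X'" "g \<in> comod_arrs R Y Y'" "h \<in> comod_arrs R Z Z'"
    show "Cmp ?W (?T (?T X Y) Z) (?T (?T X' Y') Z') (?T X' (?T Y' Z'))
          (Assoc ?W X' Y' Z') (TArr ?W (?T X Y) Z (?T X' Y') Z' (TArr ?W X Y X' Y' f g) h)
        = Cmp ?W (?T (?T X Y) Z) (?T X (?T Y Z)) (?T X' (?T Y' Z'))
          (TArr ?W X (?T Y Z) X' (?T Y' Z') f (TArr ?W Y Z Y' Z' g h)) (Assoc ?W X Y Z)"
      using o[THEN is_comodD(1)] o[THEN is_comodD(2)] comod_arrs_lin[OF o(1,4) a(1)]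
          comod_arrs_lin[OF o(2,5) a(2)]
        comod_arrs_lin[OF o(3,6) a(3)]
      by (simp add: Comod_sel comod_cmp_def comod_tensor_sel tensor_coalgebra_simps
          tassoc_natural_compose)
  next
    fix X Y :: "('a, 'b) comod" and f
    assume o: "is_comod R X" "is_comod R Y" and a: "f \<in> comod_arrs R X Y"
    note s = o[THEN is_comodD(1)] o[THEN is_comodD(2)] comod_arrs_lin[OF o a]
    show "Cmp ?W (?T ?I X) (?T ?I Y) Y (Lunit ?W Y)
        (TArr ?W ?I X ?I Y (Idn ?W ?I) f)
      = Cmp ?W (?T ?I X) X Y f (Lunit ?W X)"
      using s by (simp add: Comod_sel comod_cmp_def comod_id_def comod_tensor_sel
          tensor_coalgebra_simps unit_comod_sel unit_coalgebra_simps lunit_natural_compose)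
    show "Cmp ?W (?T X ?I) (?T Y ?I) Y (Runit ?W Y)
        (TArr ?W X ?I Y ?I f (Idn ?W ?I))
      = Cmp ?W (?T X ?I) X Y f (Runit ?W X)"
      using s by (simp add: Comod_sel comod_cmp_def comod_id_def comod_tensor_sel
          tensor_coalgebra_simps unit_comod_sel unit_coalgebra_simps runit_natural_compose)
  next
    fix V X Y Z :: "('a, 'b) comod"
    assume o: "is_comod R V" "is_comod R X" "is_comod R Y" "is_comod R Z"
    show "Cmp ?W (?T (?T (?T V X) Y) Z) (?T (?T V (?T X Y)) Z)
        (?T V (?T X (?T Y Z)))
        (Cmp ?W (?T (?T V (?T X Y)) Z) (?T V (?T (?T X Y) Z))
          (?T V (?T X (?T Y Z)))
          (TArr ?W V (?T (?T X Y) Z) V (?T X (?T Y Z)) (Idn ?W V) (Assoc ?W X Y Z))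
          (Assoc ?W V (?T X Y) Z))
        (TArr ?W (?T (?T V X) Y) Z (?T V (?T X Y)) Z (Assoc ?W V X Y) (Idn ?W Z))
      = Cmp ?W (?T (?T (?T V X) Y) Z) (?T (?T V X) (?T Y Z))
        (?T V (?T X (?T Y Z)))
        (Assoc ?W V X (?T Y Z)) (Assoc ?W (?T V X) Y Z)"
      using o[THEN is_comodD(1)] o[THEN is_comodD(2)]
      by (simp add: Comod_sel comod_cmp_def comod_id_def comod_tensor_sel tensor_coalgebra_simps
          pentagon_compose)
  qed
qed

section \<open>Measurings\<close>

text \<open>A linear map from \<open>L\<close> into the module of linear maps
  \<open>X \<rightarrow> N\<close>, with linearity in \<open>L\<close> expressed pointwise. In this
  form no module structure on the space of maps has to be named, and composites can be treated by
  evaluation.\<close>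

definition pairing where
  "pairing R L X N p \<longleftrightarrow> p \<in> extensional (carrier L) \<and> (\<forall>l\<in>carrier L. p l \<in> lin R X N) \<and>
    (\<forall>x\<in>carrier X. rlinear R L N (\<lambda>l. p l x))"

text \<open>For \<open>X = C\<close>, \<open>d = \<Delta>\<close> and \<open>fL\<close>, \<open>fN\<close> the multiplications this is the multiplicativity of a
  pairing \<open>A \<rightarrow> Hom(C,B)\<close>; for a coaction \<open>d\<close> and the flipped actions \<open>fL\<close>, \<open>fN\<close> it is the
  compatibility of \<open>M \<rightarrow> Hom(X,N)\<close> with the actions. The actions are flipped because \<open>d\<close> takes
  values in \<open>X \<otimes> C\<close>.\<close>

definition is_measuring where
  "is_measuring L L1 X N d fL fN p s \<longleftrightarrow> (\<forall>l\<in>carrier L. \<forall>l1\<in>carrier L1. \<forall>x\<in>carrier X.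
    p (fL l l1) x = tlift N (\<lambda>x0 x1. fN (p l x0) (s l1 x1)) (d x))"

lemma pairingD:
  assumes "pairing R L X N p"
  shows "p \<in> extensional (carrier L)" "l \<in> carrier L \<Longrightarrow> p l \<in> lin R X N"
    "l \<in> carrier L \<Longrightarrow> rlinear R X N (p l)"
    "x \<in> carrier X \<Longrightarrow> rlinear R L N (\<lambda>l. p l x)"
    "l \<in> carrier L \<Longrightarrow> x \<in> carrier X \<Longrightarrow> p l x \<in> carrier N"
  using assms by (auto simp: pairing_def dest: linD(1) lin_closed)

lemma replace_module_pairing:
  assumes "same_module M M'"
  shows "pairing R L M N = pairing R L M' N" "is_measuring L L1 M N = is_measuring L L1 M' N"
  using assms by (simp_all add: fun_eq_iff pairing_def is_measuring_def same_module_def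
      lin_same[OF assms same_module_refl])

text \<open>Stated for any record \<open>H\<close> with the pointwise operations because two records
  of this kind occur: \<open>hom_module\<close> for the module component and
  \<open>conv_algebra\<close> for the algebra component.\<close>

lemma pairing_iff_lin:
  assumes L: "module R L" and H: "carrier H = lin R X N"
    "add H = (\<lambda>f g. \<lambda>x\<in>carrier X. f x \<oplus>\<^bsub>N\<^esub> g x)" "smult H = (\<lambda>r f. \<lambda>x\<in>carrier X. r \<odot>\<^bsub>N\<^esub> f x)"
  shows "p \<in> lin R L H \<longleftrightarrow> pairing R L X N p"
proof
  assume p: "p \<in> lin R L H"
  have l: "p l \<in> lin R X N" if "l \<in> carrier L" for l
    using lin_closed[OF p that] H(1) by simp
  have "rlinear R L N (\<lambda>l. p l x)" if x: "x \<in> carrier X" for x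
    using rlinear_add[OF linD(1)[OF p]] rlinear_smult[OF linD(1)[OF p]] x
    by (intro rlinearI) (auto simp: H(2,3) intro: lin_closed[OF l])
  then show "pairing R L X N p" using l linD(2)[OF p] by (simp add: pairing_def)
next
  assume p: "pairing R L X N p"
  have e: "p l \<in> extensional (carrier X)" if "l \<in> carrier L" for l
    using linD(2)[OF pairingD(2)[OF p that]] .
  note cl = module_closed[OF L]
  have "rlinear R L H p"
  proof (rule rlinearI)
    fix l assume l: "l \<in> carrier L"
    then show "p l \<in> carrier H" by (simp add: H(1) pairingD(2)[OF p])
    fix r assume r: "r \<in> carrier R"
    show "p (r \<odot>\<^bsub>L\<^esub> l) = r \<odot>\<^bsub>H\<^esub> p l"
      by (rule extensionalityI[where A="carrier X"])
        (simp_all add: H(3) e cl r l rlinear_smult[OF pairingD(4)[OF p]])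
  next
    fix l l' assume l: "l \<in> carrier L" "l' \<in> carrier L"
    show "p (l \<oplus>\<^bsub>L\<^esub> l') = p l \<oplus>\<^bsub>H\<^esub> p l'"
      by (rule extensionalityI[where A="carrier X"])
        (simp_all add: H(2) e cl l rlinear_add[OF pairingD(4)[OF p]])
  qed
  then show "p \<in> lin R L H" using pairingD(1)[OF p] by (simp add: lin_def)
qed

lemma is_amodD:
  assumes "is_amod R M"
  shows "module R (space M)" "module R (alg M)" "\<one>\<^bsub>alg M\<^esub> \<in> carrier (alg M)"
    "bilinear R (alg M) (alg M) (alg M) (mult (alg M))"
    "bilinear R (space M) (alg M) (space M) (\<lambda>m a. act M a m)"
    "a \<in> carrier (alg M) \<Longrightarrow> m \<in> carrier (space M) \<Longrightarrow> act M a m \<in> carrier (space M)"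
    "a \<in> carrier (alg M) \<Longrightarrow> b \<in> carrier (alg M) \<Longrightarrow> a \<otimes>\<^bsub>alg M\<^esub> b \<in> carrier (alg M)"
proof -
  have a: "ring (alg M)" "module R (alg M)" "bilinear R (alg M) (alg M) (alg M) (mult (alg M))"
    "module R (space M)" "bilinear R (alg M) (space M) (space M) (act M)"
    using assms by (simp_all add: is_amod_def is_algebra_def)
  show "module R (space M)" "module R (alg M)" "bilinear R (alg M) (alg M) (alg M) (mult (alg M))"
    "bilinear R (space M) (alg M) (space M) (\<lambda>m a. act M a m)"
    using a bilinear_flip by auto
  show "\<one>\<^bsub>alg M\<^esub> \<in> carrier (alg M)" using a(1) by (rule ring.ring_simprules)
  show "a \<in> carrier (alg M) \<Longrightarrow> m \<in> carrier (space M) \<Longrightarrow> act M a m \<in> carrier (space M)"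
    by (rule bilinear_closed[OF a(5)])
  show "a \<in> carrier (alg M) \<Longrightarrow> b \<in> carrier (alg M) \<Longrightarrow> a \<otimes>\<^bsub>alg M\<^esub> b \<in> carrier (alg M)"
    by (rule bilinear_closed[OF a(3)])
qed

lemma mod_arrs_iff:
  "w \<in> mod_arrs R M N \<longleftrightarrow> fst w \<in> lin R (space M) (space N) \<and> snd w \<in> lin R (alg M) (alg N) \<and>
    snd w \<one>\<^bsub>alg M\<^esub> = \<one>\<^bsub>alg N\<^esub> \<and>
    (\<forall>a\<in>carrier (alg M). \<forall>b\<in>carrier (alg M). snd w (a \<otimes>\<^bsub>alg M\<^esub> b) = snd w a \<otimes>\<^bsub>alg N\<^esub> snd w b) \<and>
    (\<forall>m\<in>carrier (space M). \<forall>a\<in>carrier (alg M). fst w (act M a m) = act N (snd w a) (fst w m))"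
  by (cases w) (auto simp: mod_arrs_def algebra_maps_def module_maps_def pullback_def)

text \<open>Pairings take extensional values, so each equation between maps in
  \<open>Hom_amod\<close>, where unit, product and action are restricted to carriers, is equivalent
  to its pointwise form. Arrows into \<open>Hom(X,N)\<close> are from here on handled as pairs of
  measurings.\<close>

lemma Hom_arrs_iff:
  assumes M: "is_amod R M"
  shows "w \<in> mod_arrs R M (Hom_amod R X N) \<longleftrightarrow>
    pairing R (space M) (cospace X) (space N) (fst w) \<and> pairing R (alg M) (coalg X) (alg N) (snd w)
        \<and>
    (\<forall>c\<in>carrier (coalg X). snd w \<one>\<^bsub>alg M\<^esub> c = counit (coalg X) c \<odot>\<^bsub>alg N\<^esub> \<one>\<^bsub>alg N\<^esub>) \<and>
    is_measuring (alg M) (alg M) (coalg X) (alg N) (comult (coalg X)) (mult (alg M)) (mult (alg N))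
        (snd w) (snd w) \<and>
    is_measuring (space M) (alg M) (cospace X) (space N) (coact X) (\<lambda>m a. act M a m)
        (\<lambda>n b. act N b n) (fst w) (snd w)"
    (is "_ \<longleftrightarrow> ?P \<and> ?S \<and> ?rest")
proof -
  have 1: "fst w \<in> lin R (space M) (space (Hom_amod R X N)) \<longleftrightarrow> ?P"
    by (rule pairing_iff_lin[OF is_amodD(1)[OF M]]) (simp_all add: Hom_amod_def hom_module_def)
  have 2: "snd w \<in> lin R (alg M) (alg (Hom_amod R X N)) \<longleftrightarrow> ?S"
    by (rule pairing_iff_lin[OF is_amodD(2)[OF M]]) (simp_all add: Hom_amod_def conv_algebra_def)
  have "(snd w \<one>\<^bsub>alg M\<^esub> = \<one>\<^bsub>alg (Hom_amod R X N)\<^esub> \<and>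
    (\<forall>a\<in>carrier (alg M). \<forall>b\<in>carrier (alg M). snd w (a \<otimes>\<^bsub>alg M\<^esub> b) = snd w a
        \<otimes>\<^bsub>alg (Hom_amod R X N)\<^esub> snd w b) \<and>
    (\<forall>m\<in>carrier (space M). \<forall>a\<in>carrier (alg M). fst w (act M a m)
        = act (Hom_amod R X N) (snd w a) (fst w m)))
    \<longleftrightarrow> ?rest" if P: ?P and S: ?S
  proof -
    have eP: "fst w m = restrict f (carrier (cospace X))
        \<longleftrightarrow> (\<forall>x\<in>carrier (cospace X). fst w m x = f x)"
      if "m \<in> carrier (space M)" for m f
      using linD(2)[OF pairingD(2)[OF P that]] by (auto simp: fun_eq_iff extensional_def)
    have eS: "snd w m = restrict f (carrier (coalg X)) \<longleftrightarrow> (\<forall>x\<in>carrier (coalg X). snd w m x = f x)"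
      if "m \<in> carrier (alg M)" for m f
      using linD(2)[OF pairingD(2)[OF S that]] by (auto simp: fun_eq_iff extensional_def)
    show ?thesis
      by (simp add: Hom_amod_def conv_algebra_def is_measuring_def eP eS is_amodD[OF M])
  qed
  with 1 2 show ?thesis unfolding mod_arrs_iff by blast
qed

text \<open>A linear map may be moved inside a Sweedler sum: both sides are linear in
  \<open>t\<close> and agree on pure tensors.\<close>

lemma tlift_push:
  assumes "module R M" "module R N" "module R P" "module R P'" "bilinear R M N P b"
      "rlinear R P P' h"
    "t \<in> carrier (tensor R M N)"
  shows "h (tlift P b t) = tlift P' (\<lambda>x y. h (b x y)) t"
  using assms(7)
  by (rule tensor_ext[OF assms(1,2,4) rlinear_comp[OF assms(6) rlinear_tlift[OF assms(1-3,5)]]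
        rlinear_tlift[OF assms(1,2,4) bilinear_compose_rlinear[OF assms(6,5)]], rotated])
    (simp add: tlift_pure[OF assms(1-3,5)]
        tlift_pure[OF assms(1,2,4) bilinear_compose_rlinear[OF assms(6,5)]])

section \<open>Composition of pairings\<close>

definition pairing_comp where
  "pairing_comp R L X Y N p q = (\<lambda>l\<in>carrier L. \<lambda>t\<in>carrier (tensor R X Y). tlift N
      (\<lambda>x y. p (q l y) x) t)"

context
  fixes R :: "('r, 's) ring_scheme" and X :: "('r, ('r, 'x) univ, 'y) module_scheme"
    and Y :: "('r, ('r, 'x) univ, 'z) module_scheme" and L N M p q
  assumes m: "module R L" "module R X" "module R Y" "module R N" "module R M"
    and p: "pairing R M X N p" and q: "pairing R L Y M q"
begin

lemma bilinear_pairing_comp: "l \<in> carrier L \<Longrightarrow> bilinear R X Y N (\<lambda>x y. p (q l y) x)"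
  by (intro bilinearI pairingD(3)[OF p] pairingD(5)[OF q]
      rlinear_comp[OF pairingD(4)[OF p] pairingD(3)[OF q]])

lemma pairing_pairing_comp: "pairing R L (tensor R X Y) N (pairing_comp R L X Y N p q)"
  unfolding pairing_def
proof (intro conjI ballI)
  fix l assume l: "l \<in> carrier L"
  show "pairing_comp R L X Y N p q l \<in> lin R (tensor R X Y) N"
    using l by (simp add: pairing_comp_def lin_def rlinear_restrict tensor_module m rlinear_tlift
        bilinear_pairing_comp)
next
  fix t assume t: "t \<in> carrier (tensor R X Y)"
  have "rlinear R L N (\<lambda>l. tlift N (\<lambda>x y. p (q l y) x) t)"
    by (intro rlinear_tlift_param[OF m(2,3,4,1) _ _ t] bilinear_pairing_comp
        rlinear_comp[OF pairingD(4)[OF p] pairingD(4)[OF q]])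
  then show "rlinear R L N (\<lambda>l. pairing_comp R L X Y N p q l t)"
    using t by (simp add: pairing_comp_def cong: rlinear_cong[OF m(1)])
qed (simp add: pairing_comp_def)

lemma pairing_comp_pure:
  "l \<in> carrier L \<Longrightarrow> x \<in> carrier X \<Longrightarrow> y \<in> carrier Y \<Longrightarrow>
    pairing_comp R L X Y N p q l (pure R X Y x y) = p (q l y) x"
  by (simp add: pairing_comp_def pure_closed tlift_pure[OF m(2,3,4) bilinear_pairing_comp])

end

text \<open>In Sweedler notation, with a dot for each action, \<open>p(q(l . l1)(y))(x)\<close> is
  the sum of \<open>p(q(l)(y0) . t(l1)(y1))(x)\<close> because \<open>q\<close> is measuring, hence
  the sum of \<open>p(q(l)(y0))(x0) . s(t(l1)(y1))(x1)\<close> because \<open>p\<close> is. Since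
  \<open>x \<otimes> y\<close> has coaction
  \<open>(x0 \<otimes> y0) \<otimes> (x1 \<otimes> y1)\<close>, this is the claim. With algebras
  throughout it gives multiplicativity, with modules and algebras compatibility with the
  actions.\<close>

lemma is_measuring_comp:
  assumes m: "module R L" "module R L1" "module R M" "module R M1" "module R N" "module R N1"
     "module R X" "module R C" "module R Y" "module R D"
    and p: "pairing R M X N p" and s: "pairing R M1 C N1 s" and q: "pairing R L Y M q"
        and t: "pairing R L1 D M1 t"
    and d: "rlinear R X (tensor R X C) d" "rlinear R Y (tensor R Y D) d'"
    and f: "bilinear R L L1 L fL" "bilinear R M M1 M fM" "bilinear R N N1 N fN"
    and c: "is_measuring M M1 X N d fM fN p s" "is_measuring L L1 Y M d' fL fM q t"
  shows "is_measuring L L1 (tensor R X Y) N (coact_tensor R X C Y D d d') fL fN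
      (pairing_comp R L X Y N p q) (pairing_comp R L1 C D N1 s t)"
  unfolding is_measuring_def
proof (rule ballI, rule ballI)
  note P = pairing_pairing_comp[OF m(1,7,9,5,3) p q] and S
      = pairing_pairing_comp[OF m(2,8,10,6,4) s t]
  fix l l1 assume l: "l \<in> carrier L" "l1 \<in> carrier L1"
  note fl = bilinear_closed[OF f(1) l]
  let ?B = "\<lambda>u v. fN (pairing_comp R L X Y N p q l u) (pairing_comp R L1 C D N1 s t l1 v)"
  let ?T = "tensor R (tensor R X C) (tensor R Y D)"
  have B: "bilinear R (tensor R X Y) (tensor R C D) N ?B"
    by (rule bilinear_comp[OF f(3) pairingD(3)[OF P l(1)] pairingD(3)[OF S l(2)]])
  note lB = rlinear_tlift[OF tensor_module[OF m(7,9)] tensor_module[OF m(8,10)] m(5) B]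
  let ?b = "\<lambda>y0 y1 x0 x1. fN (p (q l y0) x0) (s (t l1 y1) x1)"
  have b: "bilinear R X C N (?b y0 y1)" if "y0 \<in> carrier Y" "y1 \<in> carrier D" for y0 y1
    by (intro bilinear_comp[OF f(3)] pairingD(3)[OF p] pairingD(3)[OF s] pairingD(5)[OF q]
        pairingD(5)[OF t] l that)
  have b': "bilinear R Y D N (\<lambda>y0 y1. ?b y0 y1 x0 x1)" if "x0 \<in> carrier X" "x1 \<in> carrier C" for x0
      x1
    by (intro bilinear_comp[OF f(3)] rlinear_comp[OF pairingD(4)[OF p] pairingD(3)[OF q]]
        rlinear_comp[OF pairingD(4)[OF s] pairingD(3)[OF t]] l that)
  have b2: "bilinear R Y D N (\<lambda>y0 y1. tlift N (?b y0 y1) S)" if S: "S \<in> carrier (tensor R X C)"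
      for S
    by (intro bilinearI rlinear_tlift_param[OF m(7,8,5)] m b S bilinear_left[OF b']
        bilinear_right[OF b'])
  \<comment> \<open>The single sum over the interchanged tensor equals an iterated sum, outer over
    \<open>T\<close> and inner over \<open>S\<close>. Both tensors are general, as the coactions of
    \<open>x\<close> and \<open>y\<close> will be substituted for them; the equation is checked by
    decomposing first \<open>T\<close> and then \<open>S\<close>.\<close>
  have key: "tlift N ?B (tswap R X C Y D (pure R (tensor R X C) (tensor R Y D) S T))
      = tlift N (\<lambda>y0 y1. tlift N (?b y0 y1) S) T"
    if S: "S \<in> carrier (tensor R X C)" and T: "T \<in> carrier (tensor R Y D)" for S T
  proof -
    have "\<forall>T\<in>carrier (tensor R Y D). tlift N ?B
        (tswap R X C Y D (pure R (tensor R X C) (tensor R Y D) S T))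
        = tlift N (\<lambda>y0 y1. tlift N (?b y0 y1) S) T"
    proof (rule tensor_ball_ext[OF m(9,10,5)])
      show "rlinear R (tensor R Y D) N
          (\<lambda>T. tlift N ?B (tswap R X C Y D (pure R (tensor R X C) (tensor R Y D) S T)))"
        by (intro rlinear_comp[OF lB] lin_intros m S)
      show "rlinear R (tensor R Y D) N (tlift N (\<lambda>y0 y1. tlift N (?b y0 y1) S))"
        by (rule rlinear_tlift[OF m(9,10,5) b2[OF S]])
      fix y0 y1 assume y: "y0 \<in> carrier Y" "y1 \<in> carrier D"
      have "\<forall>S\<in>carrier (tensor R X C). tlift N ?B
          (tswap R X C Y D (pure R (tensor R X C) (tensor R Y D) S (pure R Y D y0 y1)))
          = tlift N (?b y0 y1) S"
      proof (rule tensor_ball_ext[OF m(7,8,5)])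
        show "rlinear R (tensor R X C) N
            (\<lambda>S. tlift N ?B (tswap R X C Y D
            (pure R (tensor R X C) (tensor R Y D) S (pure R Y D y0 y1))))"
          by (intro rlinear_comp[OF lB] lin_intros m y)
        show "rlinear R (tensor R X C) N (tlift N (?b y0 y1))"
          by (rule rlinear_tlift[OF m(7,8,5) b[OF y]])
        fix x0 x1 assume x: "x0 \<in> carrier X" "x1 \<in> carrier C"
        show "tlift N ?B (tswap R X C Y D
            (pure R (tensor R X C) (tensor R Y D) (pure R X C x0 x1) (pure R Y D y0 y1)))
            = tlift N (?b y0 y1) (pure R X C x0 x1)"
          by (simp add: tswap_pure m x y
              tlift_pure[OF tensor_module[OF m(7,9)] tensor_module[OF m(8,10)] m(5) B] pure_closed
              tlift_pure[OF m(7,8,5) b[OF y]] pairing_comp_pure[OF m(1,7,9,5,3) p q l(1)]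
                  pairing_comp_pure[OF m(2,8,10,6,4) s t l(2)])
      qed
      then show "tlift N ?B (tswap R X C Y D
          (pure R (tensor R X C) (tensor R Y D) S (pure R Y D y0 y1)))
          = tlift N (\<lambda>y0 y1. tlift N (?b y0 y1) S) (pure R Y D y0 y1)"
        using S by (simp add: tlift_pure[OF m(9,10,5) b2[OF S] y])
    qed
    with T show ?thesis by blast
  qed
  show "\<forall>x\<in>carrier (tensor R X Y). pairing_comp R L X Y N p q (fL l l1) x
      = tlift N ?B (coact_tensor R X C Y D d d' x)"
  proof (rule tensor_ball_ext[OF m(7,9,5)])
    show "rlinear R (tensor R X Y) N (pairing_comp R L X Y N p q (fL l l1))"
        by (rule pairingD(3)[OF P fl])
    show "rlinear R (tensor R X Y) N (\<lambda>x. tlift N ?B (coact_tensor R X C Y D d d' x))"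
      by (intro rlinear_comp[OF lB] rlinear_coact_tensor m d)
    fix x y assume xy: "x \<in> carrier X" "y \<in> carrier Y"
    note dx = rlinear_closed[OF d(1) xy(1)] and dy = rlinear_closed[OF d(2) xy(2)]
    have "tlift N ?B (coact_tensor R X C Y D d d' (pure R X Y x y))
        = tlift N (\<lambda>y0 y1. tlift N (?b y0 y1) (d x)) (d' y)"
      using key[OF dx dy] by (simp add: coact_tensor_pure m d xy)
    \<comment> \<open>The inner sum collapses because \<open>p\<close> is measuring. The outer one
      collapses because \<open>q\<close> is, after evaluation of \<open>p\<close> at
      \<open>x\<close>, a linear map, has been taken out of the sum.\<close>
    also have "\<dots> = tlift N (\<lambda>y0 y1. p (fM (q l y0) (t l1 y1)) x) (d' y)"
      by (rule tlift_cong[OF m(9,10) dy])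
        (use c(1) xy(1) l pairingD(5)[OF q] pairingD(5)[OF t] in \<open>simp add: is_measuring_def\<close>)
    also have "\<dots> = p (tlift M (\<lambda>y0 y1. fM (q l y0) (t l1 y1)) (d' y)) x"
      by (rule tlift_push[symmetric, where h="\<lambda>v. p v x", OF m(9,10,3,5) _ pairingD(4)[OF p xy(1)]
          dy])
        (rule bilinear_comp[OF f(2) pairingD(3)[OF q l(1)] pairingD(3)[OF t l(2)]])
    also have "tlift M (\<lambda>y0 y1. fM (q l y0) (t l1 y1)) (d' y) = q (fL l l1) y"
      using c(2) l xy(2) by (simp add: is_measuring_def)
    finally show "pairing_comp R L X Y N p q (fL l l1) (pure R X Y x y)
        = tlift N ?B (coact_tensor R X C Y D d d' (pure R X Y x y))"
      by (simp add: pairing_comp_pure[OF m(1,7,9,5,3) p q fl xy])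
  qed
qed

lemma Hom_arrs_comp:
  assumes L: "is_amod R L" and M: "is_amod R M" and N: "is_amod R N" and X: "is_comod R X"
      and Y: "is_comod R Y"
    and v: "v \<in> mod_arrs R M (Hom_amod R X N)" and w: "w \<in> mod_arrs R L (Hom_amod R Y M)"
  shows "(pairing_comp R (space L) (cospace X) (cospace Y) (space N) (fst v) (fst w),
     pairing_comp R (alg L) (coalg X) (coalg Y) (alg N) (snd v) (snd w))
         \<in> mod_arrs R L (Hom_amod R (comod_tensor R X Y) N)"
proof -
  note v' = v[unfolded Hom_arrs_iff[OF M]] and w' = w[unfolded Hom_arrs_iff[OF L]]
  note mm = is_amodD(1,2)[OF L] is_amodD(1,2)[OF M] is_amodD(1,2)[OF N] is_comodD(1,2)[OF X]
      is_comodD(1,2)[OF Y]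
  have ps: "pairing R (space M) (cospace X) (space N) (fst v)"
      "pairing R (alg M) (coalg X) (alg N) (snd v)"
    "pairing R (space L) (cospace Y) (space M) (fst w)"
        "pairing R (alg L) (coalg Y) (alg M) (snd w)"
    using v' w' by auto
  have unit: "\<forall>c\<in>carrier (tensor R (coalg X) (coalg Y)).
      pairing_comp R (alg L) (coalg X) (coalg Y) (alg N) (snd v) (snd w) \<one>\<^bsub>alg L\<^esub> c
      = counit_tensor R (counit (coalg X)) (counit (coalg Y)) c \<odot>\<^bsub>alg N\<^esub> \<one>\<^bsub>alg N\<^esub>"
  proof (rule tensor_ball_ext[OF mm(8,10,6)])
    show "rlinear R (tensor R (coalg X) (coalg Y)) (alg N)
        (pairing_comp R (alg L) (coalg X) (coalg Y) (alg N) (snd v) (snd w) \<one>\<^bsub>alg L\<^esub>)"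
      by (rule pairingD(3)[OF pairing_pairing_comp[OF mm(2,8,10,6,4) ps(2,4)] is_amodD(3)[OF L]])
    show "rlinear R (tensor R (coalg X) (coalg Y)) (alg N)
        (\<lambda>c. counit_tensor R (counit (coalg X)) (counit (coalg Y)) c \<odot>\<^bsub>alg N\<^esub> \<one>\<^bsub>alg N\<^esub>)"
      by (intro rlinear_smult_fun tensor_module mm rlinear_counit_tensor is_comodD[OF X]
          is_comodD[OF Y] is_amodD[OF N])
    fix c d assume cd: "c \<in> carrier (coalg X)" "d \<in> carrier (coalg Y)"
    note e = ring_module_closed[OF is_comodD(5)[OF X] cd(1)]
        ring_module_closed[OF is_comodD(5)[OF Y] cd(2)]
    interpret B: module R "alg N" by (rule mm)
    \<comment> \<open>The inner pairing sends the unit, evaluated at \<open>d\<close>, to a scalar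
      multiple of the unit, and linearity of the outer pairing in its algebra argument extracts the
      scalar.\<close>
    have "snd v (snd w \<one>\<^bsub>alg L\<^esub> d) c = counit (coalg Y) d
        \<odot>\<^bsub>alg N\<^esub> (counit (coalg X) c \<odot>\<^bsub>alg N\<^esub> \<one>\<^bsub>alg N\<^esub>)"
      using v' w' cd rlinear_smult[OF pairingD(4)[OF ps(2) cd(1)] e(2) is_amodD(3)[OF M]] by simp
    then show "pairing_comp R (alg L) (coalg X) (coalg Y) (alg N) (snd v) (snd w) \<one>\<^bsub>alg L\<^esub>
        (pure R (coalg X) (coalg Y) c d)
      = counit_tensor R (counit (coalg X)) (counit (coalg Y)) (pure R (coalg X) (coalg Y) c d)
          \<odot>\<^bsub>alg N\<^esub> \<one>\<^bsub>alg N\<^esub>"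
      by (simp add: pairing_comp_pure[OF mm(2,8,10,6,4) ps(2,4) is_amodD(3)[OF L] cd]
          counit_tensor_pure mm cd
          is_comodD[OF X] is_comodD[OF Y] e is_amodD(3)[OF N] B.smult_assoc1[symmetric] B.R.m_comm)
  qed
  have "is_measuring (alg L) (alg L) (tensor R (coalg X) (coalg Y)) (alg N)
      (coact_tensor R (coalg X) (coalg X) (coalg Y) (coalg Y) (comult (coalg X)) (comult (coalg Y)))
     (mult (alg L)) (mult (alg N))
         (pairing_comp R (alg L) (coalg X) (coalg Y) (alg N) (snd v) (snd w))
         (pairing_comp R (alg L) (coalg X) (coalg Y) (alg N) (snd v) (snd w))"
    by (rule is_measuring_comp[OF mm(2,2,4,4,6,6,8,8,10,10) ps(2,2,4,4) is_comodD(4)[OF X]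
        is_comodD(4)[OF Y] is_amodD(4)[OF L] is_amodD(4)[OF M] is_amodD(4)[OF N]])
      (use v' w' in auto)
  moreover have "is_measuring (space L) (alg L) (tensor R (cospace X) (cospace Y)) (space N)
      (coact_tensor R (cospace X) (coalg X) (cospace Y) (coalg Y) (coact X) (coact Y))
     (\<lambda>m a. act L a m) (\<lambda>n b. act N b n)
         (pairing_comp R (space L) (cospace X) (cospace Y) (space N) (fst v) (fst w))
         (pairing_comp R (alg L) (coalg X) (coalg Y) (alg N) (snd v) (snd w))"
    by (rule is_measuring_comp[OF mm(1-10) ps is_comodD(3)[OF X] is_comodD(3)[OF Y]
        is_amodD(5)[OF L] is_amodD(5)[OF M] is_amodD(5)[OF N]])
      (use v' w' in auto)
  moreover have "pairing R (space L) (tensor R (cospace X) (cospace Y)) (space N)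
      (pairing_comp R (space L) (cospace X) (cospace Y) (space N) (fst v) (fst w))"
    "pairing R (alg L) (tensor R (coalg X) (coalg Y)) (alg N)
        (pairing_comp R (alg L) (coalg X) (coalg Y) (alg N) (snd v) (snd w))"
    by (rule pairing_pairing_comp[OF mm(1,7,9,5,3) ps(1,3)],
        rule pairing_pairing_comp[OF mm(2,8,10,6,4) ps(2,4)])
  ultimately show ?thesis
    using unit unfolding Hom_arrs_iff[OF L]
        by (simp add: comod_tensor_sel coalgebra_tensor_sel tensor_coalgebra_simps
        replace_module_pairing[OF same_module_coalgebra_tensor])
qed

section \<open>Pairings over the unit comodule\<close>

definition unit_pairing where
  "unit_pairing R M N h = (\<lambda>m\<in>carrier M. \<lambda>a\<in>carrier (unit_module R). scalar a \<odot>\<^bsub>N\<^esub> h m)"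

lemma pairing_unit_pairing:
  assumes m: "module R M" "module R N" and h: "rlinear R M N h"
  shows "pairing R M (unit_module R) N (unit_pairing R M N h)"
  unfolding pairing_def
proof (intro conjI ballI)
  note u = module_unit[OF module_cring[OF m(1)]]
  fix l assume l: "l \<in> carrier M"
  show "unit_pairing R M N h l \<in> lin R (unit_module R) N"
    using l by (simp add: unit_pairing_def lin_def rlinear_restrict u rlinear_smult_fun m
        rlinear_scalar rlinear_closed[OF h])
next
  fix a assume "a \<in> carrier (unit_module R)"
  then have a: "a \<in> carrier (unit_module R)" "scalar a \<in> carrier R" by (auto elim: unit_carrierE)
  show "rlinear R M N (\<lambda>l. unit_pairing R M N h l a)"
    using a rlinear_comp[OF rlinear_smult_const[OF m(2) a(2)] h]
    by (simp add: unit_pairing_def cong: rlinear_cong[OF m(1)])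
qed (simp add: unit_pairing_def)

text \<open>The coaction of the unit is \<open>a \<mapsto> a \<otimes> 1\<close>, so the Sweedler
  sum has a single term, in which the second pairing takes the value
  \<open>1 (f l1) = f l1\<close>.\<close>

lemma is_measuring_unit_pairing:
  fixes R :: "'r ring"
  assumes m: "module R M" "module R M1" "module R N" "module R N1"
    and h: "rlinear R M N h" "rlinear R M1 N1 f"
    and fM: "bilinear R M M1 M fM" and fN: "bilinear R N N1 N fN"
    and eq: "\<And>l l1. l \<in> carrier M \<Longrightarrow> l1 \<in> carrier M1 \<Longrightarrow> h (fM l l1) = fN (h l) (f l1)"
  shows "is_measuring M M1 (unit_module R :: ('r, 'x) umod) N (unit_coact R) fM fN
    (unit_pairing R M N h) (unit_pairing R M1 N1 f)"
  unfolding is_measuring_def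
proof (intro ballI)
  note u = module_unit[OF module_cring[OF m(1)]]
  fix l l1 and a :: "('r, 'x) univ" assume l: "l \<in> carrier M" "l1 \<in> carrier M1"
      and "a \<in> carrier (unit_module R)"
  then obtain r where r: "r \<in> carrier R" "a = Scalar r" by (auto elim: unit_carrierE)
  note hc = rlinear_closed[OF h(1) l(1)] rlinear_closed[OF h(2) l(2)]
  have b: "bilinear R (unit_module R :: ('r, 'x) umod) (unit_module R :: ('r, 'x) umod) N
      (\<lambda>x0 x1. fN (unit_pairing R M N h l x0) (unit_pairing R M1 N1 f l1 x1))"
    by (rule bilinear_comp[OF fN pairingD(3)[OF pairing_unit_pairing[OF m(1,3) h(1)] l(1)]
        pairingD(3)[OF pairing_unit_pairing[OF m(2,4) h(2)] l(2)]])
  have "tlift N (\<lambda>x0 x1. fN (unit_pairing R M N h l x0) (unit_pairing R M1 N1 f l1 x1))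
      (pure R (unit_module R) (unit_module R) a (Scalar \<one>\<^bsub>R\<^esub>))
      = fN (unit_pairing R M N h l a) (unit_pairing R M1 N1 f l1 (Scalar \<one>\<^bsub>R\<^esub> :: ('r, 'x) univ))"
    by (rule tlift_pure[OF u u m(3) b]) (simp_all add: r Scalar_closed one_closed[OF m(1)])
  then show "unit_pairing R M N h (fM l l1) a
      = tlift N (\<lambda>x0 x1. fN (unit_pairing R M N h l x0) (unit_pairing R M1 N1 f l1 x1))
          (pure R (unit_module R) (unit_module R) a (Scalar \<one>\<^bsub>R\<^esub>))"
    using r l hc rlinear_smult[OF bilinear_left[OF fN hc(2)] r(1) hc(1)]
    by (simp add: Scalar_closed one_closed[OF m(1)] unit_pairing_def bilinear_closed[OF fM] eq
        module_one[OF m(4)])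
qed

lemma unit_pairing_arr:
  assumes M: "is_amod R M" and N: "is_amod R N" and w: "w \<in> mod_arrs R M N"
  shows "(unit_pairing R (space M) (space N) (fst w), unit_pairing R (alg M) (alg N) (snd w))
      \<in> mod_arrs R M (Hom_amod R (unit_comod R) N)"
proof -
  note m = is_amodD(1,2)[OF M] is_amodD(1,2)[OF N]
  note w' = w[unfolded mod_arrs_iff]
  have l: "rlinear R (space M) (space N) (fst w)" "rlinear R (alg M) (alg N) (snd w)"
    using w' linD(1) by auto
  show ?thesis
    unfolding Hom_arrs_iff[OF M] unit_comod_sel fst_conv snd_conv
      replace_module_pairing[OF same_module_unit_coalgebra] unit_coalgebra_simps
  proof (intro conjI pairing_unit_pairing m l is_measuring_unit_pairing is_amodD(4)[OF M]
      is_amodD(4)[OF N] is_amodD(5)[OF M] is_amodD(5)[OF N])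
    show "\<forall>c\<in>carrier (unit_module R). unit_pairing R (alg M) (alg N) (snd w) \<one>\<^bsub>alg M\<^esub> c = scalar c
        \<odot>\<^bsub>alg N\<^esub> \<one>\<^bsub>alg N\<^esub>"
      using w' by (simp add: unit_pairing_def is_amodD(3)[OF M])
  qed (use w' in auto)
qed

definition unit_value where
  "unit_value R M p = (\<lambda>m\<in>carrier M. p m (Scalar \<one>\<^bsub>R\<^esub>))"

lemma unit_value_lin:
  assumes "pairing R L (unit_module R) N p" "module R L"
  shows "unit_value R L p \<in> lin R L N"
  using pairingD(4)[OF assms(1)]
  by (simp add: unit_value_def lin_def rlinear_restrict assms Scalar_closed one_closed[OF assms(2)])

lemma unit_value_arr:
  assumes M: "is_amod R M" and N: "is_amod R N"
      and w: "w \<in> mod_arrs R M (Hom_amod R (unit_comod R) N)"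
  shows "(unit_value R (space M) (fst w), unit_value R (alg M) (snd w)) \<in> mod_arrs R M N"
proof -
  note m = is_amodD(1,2)[OF M] is_amodD(1,2)[OF N]
  note u = module_unit[OF module_cring[OF m(1)]]
  note w' = w[unfolded Hom_arrs_iff[OF M] unit_comod_sel fst_conv snd_conv
      replace_module_pairing[OF same_module_unit_coalgebra] unit_coalgebra_simps]
  have p: "pairing R (space M) (unit_module R) (space N) (fst w)"
      and s: "pairing R (alg M) (unit_module R) (alg N) (snd w)"
    using w' by auto
  have 1: "Scalar \<one>\<^bsub>R\<^esub> \<in> carrier (unit_module R)" by (simp add: Scalar_closed one_closed[OF m(1)])
  have bs: "bilinear R (unit_module R) (unit_module R) (alg N)
      (\<lambda>x0 x1. snd w a x0 \<otimes>\<^bsub>alg N\<^esub> snd w b x1)"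
    if "a \<in> carrier (alg M)" "b \<in> carrier (alg M)" for a b
    by (rule bilinear_comp[OF is_amodD(4)[OF N] pairingD(3)[OF s that(1)]
        pairingD(3)[OF s that(2)]])
  have bp: "bilinear R (unit_module R) (unit_module R) (space N)
      (\<lambda>x0 x1. act N (snd w a x1) (fst w l x0))"
    if "a \<in> carrier (alg M)" "l \<in> carrier (space M)" for a l
    by (rule bilinear_comp[OF is_amodD(5)[OF N] pairingD(3)[OF p that(2)]
        pairingD(3)[OF s that(1)]])
  show ?thesis
    using w' is_amodD(6,7)[OF M]
    by (simp add: mod_arrs_iff unit_value_lin[OF p] unit_value_lin[OF s] m)
      (simp add: unit_value_def is_amodD(3)[OF M] is_amodD(3)[OF N] is_measuring_def 1
          module_one[OF m(4)]
        tlift_pure[OF u u m(4) bs] tlift_pure[OF u u m(3) bp])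
qed

text \<open>Every scalar is a multiple of 1, so linearity determines a pairing over the unit by its
  values at 1. This makes \<open>unit_pairing\<close> inverse to \<open>unit_value\<close>.\<close>

lemma unit_pairing_value:
  assumes m: "module R M" "module R N" and p: "pairing R M (unit_module R) N p"
      and l: "l \<in> carrier M" and r: "r \<in> carrier R"
  shows "p l (Scalar r) = r \<odot>\<^bsub>N\<^esub> p l (Scalar \<one>\<^bsub>R\<^esub>)"
proof -
  have "p l (r \<odot>\<^bsub>unit_module R\<^esub> Scalar \<one>\<^bsub>R\<^esub>) = r \<odot>\<^bsub>N\<^esub> p l (Scalar \<one>\<^bsub>R\<^esub>)"
    by (rule rlinear_smult[OF pairingD(3)[OF p l] r]) (simp add: Scalar_closed one_closed[OF m(1)])
  then show ?thesis by (simp add: Scalar_smult r module_cring[OF m(1)])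
qed

lemma unit_pairing_unit_value:
  fixes R :: "'r ring" and p :: "'m \<Rightarrow> ('r, 'x) univ \<Rightarrow> 'n"
  assumes m: "module R M" "module R N" and p: "pairing R M (unit_module R) N p"
  shows "unit_pairing R M N (unit_value R M p) = p"
proof (rule extensionalityI[OF _ pairingD(1)[OF p]])
  fix l assume l: "l \<in> carrier M"
  have "(\<lambda>a\<in>carrier (unit_module R). scalar a \<odot>\<^bsub>N\<^esub> p l (Scalar \<one>\<^bsub>R\<^esub>)) = p l"
  proof (rule extensionalityI[OF _ linD(2)[OF pairingD(2)[OF p l]]])
    fix a :: "('r, 'x) univ" assume a: "a \<in> carrier (unit_module R)"
    then obtain r where "r \<in> carrier R" "a = Scalar r" by (rule unit_carrierE)
    then show "(\<lambda>a\<in>carrier (unit_module R). scalar a \<odot>\<^bsub>N\<^esub> p l (Scalar \<one>\<^bsub>R\<^esub>)) a = p l a"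
      using unit_pairing_value[OF m p l] by (simp add: Scalar_closed)
  qed simp
  then show "unit_pairing R M N (unit_value R M p) l = p l"
    using l by (simp add: unit_pairing_def unit_value_def)
qed (simp add: unit_pairing_def)

section \<open>The universal property\<close>

text \<open>The bijection corresponding to \<open>e : M \<rightarrow> Hom(Q,N)\<close> under the Yoneda lemma.\<close>

definition Hom_pull where
  "Hom_pull M X e u = ((\<lambda>m\<in>carrier (space M). \<lambda>x\<in>carrier (cospace X). fst e m (fst u x)),
     (\<lambda>a\<in>carrier (alg M). \<lambda>c\<in>carrier (coalg X). snd e a (snd u c)))"

text \<open>Replaces a natural family of bijections by one element \<open>e\<close> and an explicit
  formula for the whole family, so that arrows into \<open>Q\<close> can be produced and compared
  through values of \<open>e\<close>.\<close>

definition universal_pairing where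
  "universal_pairing R M N Q e \<longleftrightarrow> is_comod R Q \<and> e \<in> mod_arrs R M (Hom_amod R Q N) \<and>
    (\<forall>X. is_comod R X \<longrightarrow> bij_betw (Hom_pull M X e) (comod_arrs R X Q)
        (mod_arrs R M (Hom_amod R X N)))"

lemma universal_pairing_exists:
  assumes M: "is_amod R M" and U: "universal_measuring_comodule R M N Q"
  shows "\<exists>e. universal_pairing R M N Q e"
proof -
  have Q: "is_comod R Q" using U by (simp add: universal_measuring_comodule_def Comod_sel)
  obtain \<Phi> where \<Phi>: "\<forall>X\<in>Obj (Comod R). bij_betw (\<Phi> X) (Arr (Comod R) X Q)
      (mod_arrs R M (Hom_amod R X N))"
    "\<forall>X\<in>Obj (Comod R). \<forall>X'\<in>Obj (Comod R). \<forall>u\<in>Arr (Comod R) X' X. \<forall>v\<in>Arr (Comod R) X Q.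
      \<Phi> X' (Cmp (Comod R) X' X Q v u) = mod_cmp M (Hom_precomp R X' X N u) (\<Phi> X v)"
    using U unfolding universal_measuring_comodule_def by blast
  have bij: "\<And>X. is_comod R X \<Longrightarrow> bij_betw (\<Phi> X) (comod_arrs R X Q) (mod_arrs R M (Hom_amod R X N))"
    and nat: "\<And>X X' u v. is_comod R X \<Longrightarrow> is_comod R X' \<Longrightarrow> u \<in> comod_arrs R X' X \<Longrightarrow> v \<in> comod_arrs R X Q
        \<Longrightarrow>
      \<Phi> X' (comod_cmp X' v u) = mod_cmp M (Hom_precomp R X' X N u) (\<Phi> X v)"
    using \<Phi>[unfolded Comod_sel mem_Collect_eq] by blast+
  \<comment> \<open>The universal element is the image of the identity of \<open>Q\<close>.
    Naturality, applied to the identity precomposed with an arrow \<open>u\<close>, then forces the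
    formula for the bijection at \<open>u\<close>.\<close>
  let ?e = "\<Phi> Q (comod_id Q)"
  have e: "?e \<in> mod_arrs R M (Hom_amod R Q N)"
    using bij_betwE[OF bij[OF Q]] comod_id_arr[OF Q] by blast
  note e' = e[unfolded Hom_arrs_iff[OF M]]
  have l: "fst ?e m \<in> lin R (cospace Q) (space N)" "snd ?e a \<in> lin R (coalg Q) (alg N)"
    if "m \<in> carrier (space M)" "a \<in> carrier (alg M)" for m a
    using e' that by (auto intro: pairingD(2))
  have eq: "\<Phi> X u = Hom_pull M X ?e u" if X: "is_comod R X" and u: "u \<in> comod_arrs R X Q" for X u
  proof -
    note ul = comod_arrs_lin[OF X Q u]
    have "comod_cmp X (comod_id Q) u = u"
      using ul by (auto simp: comod_cmp_def comod_id_def compose_def prod_eq_iff lin_closed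
          intro!: extensionalityI[OF _ linD(2)])
    with nat[OF Q X u comod_id_arr[OF Q]] have "\<Phi> X u = mod_cmp M (Hom_precomp R X Q N u) ?e"
        by simp
    also have "\<dots> = Hom_pull M X ?e u"
      using pairingD(2)[OF conjunct1[OF e']] pairingD(2)[OF conjunct1[OF conjunct2[OF e']]]
      by (auto simp: mod_cmp_def Hom_precomp_def Hom_pull_def compose_def intro!: restrict_ext)
    finally show ?thesis .
  qed
  have "bij_betw (Hom_pull M X ?e) (comod_arrs R X Q) (mod_arrs R M (Hom_amod R X N))" if
      X: "is_comod R X" for X
    using bij_betw_cong[of "comod_arrs R X Q" "\<Phi> X" "Hom_pull M X ?e"] eq[OF X] bij[OF X] by blast
  then show ?thesis using Q e unfolding universal_pairing_def by blast
qed

text \<open>Injectivity of \<open>Hom_pull\<close> in pointwise form. The axioms of the enriched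
  category are all verified by this criterion.\<close>

lemma universal_pairing_eqI:
  assumes E: "universal_pairing R M N Q e" and X: "is_comod R X"
    and uv: "u \<in> comod_arrs R X Q" "v \<in> comod_arrs R X Q"
    and "\<And>m x. m \<in> carrier (space M) \<Longrightarrow> x \<in> carrier (cospace X)
        \<Longrightarrow> fst e m (fst u x) = fst e m (fst v x)"
    and "\<And>a c. a \<in> carrier (alg M) \<Longrightarrow> c \<in> carrier (coalg X) \<Longrightarrow> snd e a (snd u c) = snd e a (snd v c)"
  shows "u = v"
proof -
  have "Hom_pull M X e u = Hom_pull M X e v"
    using assms(5,6) by (auto simp: Hom_pull_def intro!: restrict_ext)
  moreover have "inj_on (Hom_pull M X e) (comod_arrs R X Q)"
    using E X by (auto simp: universal_pairing_def bij_betw_def)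
  ultimately show ?thesis using uv by (auto dest: inj_onD)
qed

text \<open>Surjectivity of \<open>Hom_pull\<close> in pointwise form, the source of the composition
  and identity arrows.\<close>

lemma universal_pairing_obtain:
  assumes E: "universal_pairing R M N Q e" and X: "is_comod R X"
      and w: "w \<in> mod_arrs R M (Hom_amod R X N)"
  shows "\<exists>u\<in>comod_arrs R X Q. (\<forall>m\<in>carrier (space M). \<forall>x\<in>carrier (cospace X). fst e m (fst u x)
      = fst w m x) \<and>
    (\<forall>a\<in>carrier (alg M). \<forall>c\<in>carrier (coalg X). snd e a (snd u c) = snd w a c)"
proof -
  have "w \<in> Hom_pull M X e ` comod_arrs R X Q"
    using E X w by (auto simp: universal_pairing_def bij_betw_def)
  then obtain u where u: "u \<in> comod_arrs R X Q" "w = Hom_pull M X e u" by blast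
  show ?thesis
    by (rule bexI[OF _ u(1)]) (simp add: u(2) Hom_pull_def)
qed

text \<open>The modules stand for components of hom-objects: \<open>A\<close> for
  \<open>Q(N,P)\<close>, \<open>B\<close> for \<open>Q(M,N)\<close>, \<open>D\<close> for
  \<open>Q(L,M)\<close>, \<open>E\<close> for \<open>Q(M,P)\<close>, \<open>F\<close> for
  \<open>Q(L,N)\<close> and \<open>G\<close> for \<open>Q(L,P)\<close>, while \<open>g\<close>,
  \<open>eD\<close> and \<open>eF\<close> are evaluations at one fixed element. By the assumptions
  \<open>h\<close> both sides send \<open>(a \<otimes> b) \<otimes> d\<close> to
  \<open>eA (eB (eD d) b) a\<close>.\<close>

lemma comp_eval_assoc:
  assumes m: "module R A" "module R B" "module R D" "module R E" "module R F" "module R G"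
      "module R P"
    and k: "rlinear R (tensor R A B) E kE" "rlinear R (tensor R E D) G kG"
        "rlinear R (tensor R B D) F kF" "rlinear R (tensor R A F) G kG'"
    and e: "rlinear R G P g"
    and h: "\<And>x d. x \<in> carrier E \<Longrightarrow> d \<in> carrier D \<Longrightarrow> g (kG (pure R E D x d)) = eE (eD d) x"
      "\<And>a b d. a \<in> carrier A \<Longrightarrow> b \<in> carrier B \<Longrightarrow> d \<in> carrier D
          \<Longrightarrow> eE (eD d) (kE (pure R A B a b)) = eA (eB (eD d) b) a"
      "\<And>a x. a \<in> carrier A \<Longrightarrow> x \<in> carrier F \<Longrightarrow> g (kG' (pure R A F a x)) = eA (eF x) a"
      "\<And>b d. b \<in> carrier B \<Longrightarrow> d \<in> carrier D \<Longrightarrow> eF (kF (pure R B D b d)) = eB (eD d) b"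
  shows "\<forall>t\<in>carrier (tensor R (tensor R A B) D).
    g (kG (tmap R (tensor R A B) D E D kE (\<lambda>x. x) t))
        = g (kG' (tmap R A (tensor R B D) A F (\<lambda>x. x) kF (tassoc R A B D t)))"
  by (rule tensor_ext_21[where P=P];
      (intro lin_intros m rlinear_comp[OF e] rlinear_comp[OF k(2)] rlinear_comp[OF k(4)] k)?)
    (simp add: lin_simps m k rlinear_id k[THEN rlinear_closed] h)

text \<open>Here \<open>B\<close> stands for a hom-object, \<open>A\<close> for the endomorphism
  object of its target, \<open>i\<close> for the identity and \<open>e\<close> for evaluation at a
  fixed element. By \<open>h\<close> the identity acts through scalar multiplication, as the unit
  constraint does. In \<open>comp_eval_runit\<close> the object \<open>A\<close> belongs to the
  source instead.\<close>

lemma comp_eval_lunit: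
  assumes m: "module R A" "module R B" "module R P"
    and l: "rlinear R (unit_module R) A i" "rlinear R (tensor R A B) B k" "rlinear R B P e"
    and h: "\<And>r b. r \<in> carrier R \<Longrightarrow> b \<in> carrier B \<Longrightarrow> e (k (pure R A B (i (Scalar r)) b)) = r \<odot>\<^bsub>P\<^esub> e b"
  shows "\<forall>t\<in>carrier (tensor R (unit_module R) B).
    e (k (tmap R (unit_module R) B A B i (\<lambda>x. x) t)) = e (lin_lunit R B t)"
proof -
  note u = module_unit[OF module_cring[OF m(1)]]
  show ?thesis
    by (rule tensor_ball_ext[OF u m(2,3)];
        (intro lin_intros m u rlinear_comp[OF l(3)] rlinear_lunit rlinear_comp[OF l(2)] l)?)
      (auto elim!: unit_carrierE simp: lin_simps m u l rlinear_id Scalar_closed lin_lunit_pure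
        rlinear_smult[OF l(3)] h)
qed

lemma comp_eval_runit:
  assumes m: "module R A" "module R B" "module R P"
    and l: "rlinear R (unit_module R) A i" "rlinear R (tensor R B A) B k" "rlinear R B P e"
    and h: "\<And>r b. r \<in> carrier R \<Longrightarrow> b \<in> carrier B \<Longrightarrow> e (k (pure R B A b (i (Scalar r)))) = r \<odot>\<^bsub>P\<^esub> e b"
  shows "\<forall>t\<in>carrier (tensor R B (unit_module R)).
    e (k (tmap R B (unit_module R) B A (\<lambda>x. x) i t)) = e (lin_runit R B t)"
proof -
  note u = module_unit[OF module_cring[OF m(1)]]
  show ?thesis
    by (rule tensor_ball_ext[OF m(2) u m(3)];
        (intro lin_intros m u rlinear_comp[OF l(3)] rlinear_runit rlinear_comp[OF l(2)] l)?)
      (auto elim!: unit_carrierE simp: lin_simps m u l rlinear_id Scalar_closed lin_runit_pure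
        rlinear_smult[OF l(3)] h)
qed

text \<open>The universal pairings \<open>ev\<close> are a parameter, so that composition and
  identities refer to one fixed evaluation for each pair of objects.\<close>

locale measuring_family =
  fixes R :: "'r ring" and Q :: "('r, 'a, 'm) amod \<Rightarrow> ('r, 'a, 'm) amod \<Rightarrow> ('r, 'x) comod"
    and ev :: "('r, 'a, 'm) amod \<Rightarrow> ('r, 'a, 'm) amod \<Rightarrow> ('m \<Rightarrow> ('r, 'x) univ \<Rightarrow> 'm) \<times>
        ('a \<Rightarrow> ('r, 'x) univ \<Rightarrow> 'a)"
  assumes cring: "cring R"
    and universal: "is_amod R M \<Longrightarrow> is_amod R N \<Longrightarrow> universal_pairing R M N (Q M N) (ev M N)"
begin

section \<open>Composition and identities of the enriched category\<close>

lemma Q_comod: "is_amod R M \<Longrightarrow> is_amod R N \<Longrightarrow> is_comod R (Q M N)"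
  using universal by (simp add: universal_pairing_def)

lemma ev_arr: "is_amod R M \<Longrightarrow> is_amod R N \<Longrightarrow> ev M N \<in> mod_arrs R M (Hom_amod R (Q M N) N)"
  using universal by (simp add: universal_pairing_def)

lemma ev_pairing:
  assumes "is_amod R M" "is_amod R N"
  shows "pairing R (space M) (cospace (Q M N)) (space N) (fst (ev M N))"
    "pairing R (alg M) (coalg (Q M N)) (alg N) (snd (ev M N))"
  using ev_arr[OF assms] by (simp_all add: Hom_arrs_iff assms)

text \<open>The arrow corresponding to the composite of the universal pairings \<open>ev M N\<close>
  and \<open>ev L M\<close>. It exists by \<open>universal_pairing_obtain\<close> and
  \<open>Hom_arrs_comp\<close>, and \<open>universal_pairing_eqI\<close> shows that the conditions
  determine it.\<close>

definition comp where
  "comp L M N = (SOME u. u \<in> comod_arrs R (comod_tensor R (Q M N) (Q L M)) (Q L N) \<and>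
    (\<forall>l\<in>carrier (space L). \<forall>t\<in>carrier (tensor R (cospace (Q M N)) (cospace (Q L M))). fst (ev L N) l
        (fst u t)
      = pairing_comp R (space L) (cospace (Q M N)) (cospace (Q L M)) (space N) (fst (ev M N))
          (fst (ev L M)) l t) \<and>
    (\<forall>a\<in>carrier (alg L). \<forall>t\<in>carrier (tensor R (coalg (Q M N)) (coalg (Q L M))). snd (ev L N) a
        (snd u t)
      = pairing_comp R (alg L) (coalg (Q M N)) (coalg (Q L M)) (alg N) (snd (ev M N)) (snd (ev L M))
          a t))"

definition ident where
  "ident M = (SOME u. u \<in> comod_arrs R (unit_comod R) (Q M M) \<and>
    (\<forall>m\<in>carrier (space M). \<forall>x\<in>carrier (unit_module R). fst (ev M M) m (fst u x) = scalar x
        \<odot>\<^bsub>space M\<^esub> m) \<and>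
    (\<forall>a\<in>carrier (alg M). \<forall>c\<in>carrier (unit_module R). snd (ev M M) a (snd u c) = scalar c
        \<odot>\<^bsub>alg M\<^esub> a))"

lemma comp_spec:
  assumes L: "is_amod R L" and M: "is_amod R M" and N: "is_amod R N"
  shows "comp L M N \<in> comod_arrs R (comod_tensor R (Q M N) (Q L M)) (Q L N)"
    "l \<in> carrier (space L) \<Longrightarrow> x \<in> carrier (cospace (Q M N)) \<Longrightarrow> y \<in> carrier (cospace (Q L M)) \<Longrightarrow>
      fst (ev L N) l (fst (comp L M N) (pure R (cospace (Q M N)) (cospace (Q L M)) x y))
          = fst (ev M N) (fst (ev L M) l y) x"
    "a \<in> carrier (alg L) \<Longrightarrow> c \<in> carrier (coalg (Q M N)) \<Longrightarrow> d \<in> carrier (coalg (Q L M)) \<Longrightarrow>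
      snd (ev L N) a (snd (comp L M N) (pure R (coalg (Q M N)) (coalg (Q L M)) c d))
          = snd (ev M N) (snd (ev L M) a d) c"
proof -
  note X = Q_comod[OF M N] and Y = Q_comod[OF L M]
  have "comp L M N \<in> comod_arrs R (comod_tensor R (Q M N) (Q L M)) (Q L N) \<and>
    (\<forall>l\<in>carrier (space L). \<forall>t\<in>carrier (tensor R (cospace (Q M N)) (cospace (Q L M))). fst (ev L N) l
        (fst (comp L M N) t)
      = pairing_comp R (space L) (cospace (Q M N)) (cospace (Q L M)) (space N) (fst (ev M N))
          (fst (ev L M)) l t) \<and>
    (\<forall>a\<in>carrier (alg L). \<forall>t\<in>carrier (tensor R (coalg (Q M N)) (coalg (Q L M))). snd (ev L N) a
        (snd (comp L M N) t)
      = pairing_comp R (alg L) (coalg (Q M N)) (coalg (Q L M)) (alg N) (snd (ev M N)) (snd (ev L M))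
          a t)"
    (is "?P (comp L M N)")
  proof -
    have "\<exists>u. ?P u"
      using universal_pairing_obtain[OF universal[OF L N] is_comod_tensor[OF X Y]
          Hom_arrs_comp[OF L M N X Y ev_arr[OF M N] ev_arr[OF L M]]]
      unfolding comod_tensor_sel tensor_coalgebra_simps fst_conv snd_conv by blast
    then show ?thesis unfolding comp_def by (rule someI_ex)
  qed
  then show "comp L M N \<in> comod_arrs R (comod_tensor R (Q M N) (Q L M)) (Q L N)"
    "l \<in> carrier (space L) \<Longrightarrow> x \<in> carrier (cospace (Q M N)) \<Longrightarrow> y \<in> carrier (cospace (Q L M)) \<Longrightarrow>
      fst (ev L N) l (fst (comp L M N) (pure R (cospace (Q M N)) (cospace (Q L M)) x y))
          = fst (ev M N) (fst (ev L M) l y) x"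
    "a \<in> carrier (alg L) \<Longrightarrow> c \<in> carrier (coalg (Q M N)) \<Longrightarrow> d \<in> carrier (coalg (Q L M)) \<Longrightarrow>
      snd (ev L N) a (snd (comp L M N) (pure R (coalg (Q M N)) (coalg (Q L M)) c d))
          = snd (ev M N) (snd (ev L M) a d) c"
    by (simp_all add: pure_closed
        pairing_comp_pure[OF is_amodD(1)[OF L] is_comodD(1)[OF X] is_comodD(1)[OF Y]
            is_amodD(1)[OF N] is_amodD(1)[OF M] ev_pairing(1)[OF M N] ev_pairing(1)[OF L M]]
        pairing_comp_pure[OF is_amodD(2)[OF L] is_comodD(2)[OF X] is_comodD(2)[OF Y]
            is_amodD(2)[OF N] is_amodD(2)[OF M] ev_pairing(2)[OF M N] ev_pairing(2)[OF L M]])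
qed

lemma mod_id_arr: "is_amod R M \<Longrightarrow> mod_id M \<in> mod_arrs R M M"
  by (auto simp: mod_arrs_iff mod_id_def lin_id is_amodD)

lemma ident_spec:
  assumes M: "is_amod R M"
  shows "ident M \<in> comod_arrs R (unit_comod R) (Q M M)"
    "m \<in> carrier (space M) \<Longrightarrow> r \<in> carrier R
        \<Longrightarrow> fst (ev M M) m (fst (ident M) (Scalar r)) = r \<odot>\<^bsub>space M\<^esub> m"
    "a \<in> carrier (alg M) \<Longrightarrow> r \<in> carrier R \<Longrightarrow> snd (ev M M) a (snd (ident M) (Scalar r)) = r \<odot>\<^bsub>alg M\<^esub> a"
proof -
  have "ident M \<in> comod_arrs R (unit_comod R) (Q M M) \<and>
    (\<forall>m\<in>carrier (space M). \<forall>x\<in>carrier (unit_module R). fst (ev M M) m (fst (ident M) x) = scalar x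
        \<odot>\<^bsub>space M\<^esub> m) \<and>
    (\<forall>a\<in>carrier (alg M). \<forall>c\<in>carrier (unit_module R). snd (ev M M) a (snd (ident M) c) = scalar c
        \<odot>\<^bsub>alg M\<^esub> a)"
    (is "?P (ident M)")
  proof -
    \<comment> \<open>The identity of \<open>M\<close>, extended from 1 to all scalars by
      \<open>unit_pairing\<close>, is the pairing \<open>m \<mapsto> (r \<mapsto> r m)\<close> that
      the arrow has to represent.\<close>
    obtain u where "u \<in> comod_arrs R (unit_comod R) (Q M M)"
      "\<forall>m\<in>carrier (space M). \<forall>x\<in>carrier (unit_module R). fst (ev M M) m (fst u x)
          = unit_pairing R (space M) (space M) (fst (mod_id M)) m x"
      "\<forall>a\<in>carrier (alg M). \<forall>c\<in>carrier (unit_module R). snd (ev M M) a (snd u c)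
          = unit_pairing R (alg M) (alg M) (snd (mod_id M)) a c"
      using universal_pairing_obtain[OF universal[OF M M] is_comod_unit[OF cring]
          unit_pairing_arr[OF M M mod_id_arr[OF M]]]
      unfolding unit_comod_sel unit_coalgebra_simps fst_conv snd_conv by blast
    then have "?P u" by (simp add: unit_pairing_def mod_id_def)
    then have "\<exists>u. ?P u" by (rule exI)
    then show ?thesis unfolding ident_def by (rule someI_ex)
  qed
  then show "ident M \<in> comod_arrs R (unit_comod R) (Q M M)"
    "m \<in> carrier (space M) \<Longrightarrow> r \<in> carrier R
        \<Longrightarrow> fst (ev M M) m (fst (ident M) (Scalar r)) = r \<odot>\<^bsub>space M\<^esub> m"
    "a \<in> carrier (alg M) \<Longrightarrow> r \<in> carrier R \<Longrightarrow> snd (ev M M) a (snd (ident M) (Scalar r)) = r \<odot>\<^bsub>alg M\<^esub> a"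
    by (simp_all add: Scalar_closed)
qed

definition K where
  "K = \<lparr>EObj = Obj (Mod R), EHom = Q, EComp = comp, EId = ident\<rparr>"

lemma K_sel: "EObj K = {M. is_amod R M}" "EHom K = Q" "EComp K = comp" "EId K = ident"
  by (simp_all add: K_def Mod_def)

lemma arr_simps:
  assumes "is_comod R X" "is_comod R Y" "u \<in> comod_arrs R X Y"
  shows "rlinear R (cospace X) (cospace Y) (fst u)" "rlinear R (coalg X) (coalg Y) (snd u)"
    "x \<in> carrier (cospace X) \<Longrightarrow> fst u x \<in> carrier (cospace Y)"
    "c \<in> carrier (coalg X) \<Longrightarrow> snd u c \<in> carrier (coalg Y)"
  using comod_arrs_lin[OF assms] by (auto dest: linD(1) lin_closed)

lemma comp_lin:
  assumes L: "is_amod R L" and M: "is_amod R M" and N: "is_amod R N"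
  shows "rlinear R (tensor R (cospace (Q M N)) (cospace (Q L M))) (cospace (Q L N))
      (fst (comp L M N))"
    "rlinear R (tensor R (coalg (Q M N)) (coalg (Q L M))) (coalg (Q L N)) (snd (comp L M N))"
  using arr_simps[OF is_comod_tensor[OF Q_comod[OF M N] Q_comod[OF L M]] Q_comod[OF L N]
      comp_spec(1)[OF L M N]]
  by (simp_all add: comod_tensor_sel tensor_coalgebra_simps)

lemma ident_lin:
  assumes M: "is_amod R M"
  shows "rlinear R (unit_module R) (cospace (Q M M)) (fst (ident M))"
    "rlinear R (unit_module R) (coalg (Q M M)) (snd (ident M))"
  using arr_simps[OF is_comod_unit[OF cring] Q_comod[OF M M] ident_spec(1)[OF M]]
  by (simp_all add: unit_comod_sel unit_coalgebra_simps)

lemma comp_assoc: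
  assumes L: "is_amod R L" and M: "is_amod R M" and N: "is_amod R N" and P: "is_amod R P"
  shows "Cmp (Comod R) (comod_tensor R (comod_tensor R (Q N P) (Q M N)) (Q L M))
      (comod_tensor R (Q M P) (Q L M)) (Q L P)
      (comp L M P) (TArr (Comod R) (comod_tensor R (Q N P) (Q M N)) (Q L M) (Q M P) (Q L M)
          (comp M N P) (Idn (Comod R) (Q L M)))
    = Cmp (Comod R) (comod_tensor R (comod_tensor R (Q N P) (Q M N)) (Q L M))
        (comod_tensor R (Q N P) (comod_tensor R (Q M N) (Q L M))) (Q L P)
      (Cmp (Comod R) (comod_tensor R (Q N P) (comod_tensor R (Q M N) (Q L M)))
          (comod_tensor R (Q N P) (Q L N)) (Q L P)
        (comp L N P) (TArr (Comod R) (Q N P) (comod_tensor R (Q M N) (Q L M)) (Q N P) (Q L N)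
            (Idn (Comod R) (Q N P)) (comp L M N)))
      (Assoc (Comod R) (Q N P) (Q M N) (Q L M))"
    (is "?l = ?r")
proof (rule universal_pairing_eqI[OF universal[OF L P]])
  note q = Q_comod[OF N P] Q_comod[OF M N] Q_comod[OF L M] Q_comod[OF M P] Q_comod[OF L N]
      Q_comod[OF L P]
  note t = is_comod_tensor
  show "is_comod R (comod_tensor R (comod_tensor R (Q N P) (Q M N)) (Q L M))" by (intro t q)
  show "?l \<in> comod_arrs R (comod_tensor R (comod_tensor R (Q N P) (Q M N)) (Q L M)) (Q L P)"
    unfolding Comod_sel(3,4)
    by (rule comod_cmp_arr[OF _ _ _ comod_tarr_arr]; (intro t q comp_spec comod_id_arr L M N P)?)
  show "?r \<in> comod_arrs R (comod_tensor R (comod_tensor R (Q N P) (Q M N)) (Q L M)) (Q L P)"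
    unfolding Comod_sel(3,4)
    by (rule comod_cmp_arr[OF _ _ _ comod_assoc_arr comod_cmp_arr[OF _ _ _ comod_tarr_arr]];
        (intro t q comp_spec comod_id_arr L M N P)?)
  note m = q[THEN is_comodD(1)] and m' = q[THEN is_comodD(2)]
  note k = comp_lin(1)[OF M N P] comp_lin(1)[OF L M P] comp_lin(1)[OF L M N] comp_lin(1)[OF L N P]
    and k' = comp_lin(2)[OF M N P] comp_lin(2)[OF L M P] comp_lin(2)[OF L M N] comp_lin(2)[OF L N P]
  note e = ev_pairing[OF L M, THEN pairingD(5)] ev_pairing[OF M N, THEN pairingD(5)]
  {
    \<comment> \<open>With \<open>l\<close> fixed, evaluation at \<open>l\<close> is linear on
      \<open>Q L P\<close>, so that the comparison becomes an instance of the evaluation lemma; the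
      same is repeated below for the coalgebra component.\<close>
    fix l x assume l: "l \<in> carrier (space L)"
        and x: "x \<in> carrier (cospace (comod_tensor R (comod_tensor R (Q N P) (Q M N)) (Q L M)))"
    show "fst (ev L P) l (fst ?l x) = fst (ev L P) l (fst ?r x)"
      using x comp_eval_assoc[OF m is_amodD(1)[OF P] k pairingD(3)[OF ev_pairing(1)[OF L P] l],
          where eE="fst (ev M P)" and eD="fst (ev L M) l" and eA="fst (ev N P)"
              and eB="fst (ev M N)" and eF="fst (ev L N) l", rule_format]
      by (simp add: Comod_sel comod_cmp_def comod_id_def compose_def comod_tensor_sel tmap_restrict
          m tensor_module tassoc_closed
          comp_spec[OF L M P] comp_spec[OF M N P] comp_spec[OF L N P] comp_spec[OF L M N] e l)
  }
  {
    fix l x assume l: "l \<in> carrier (alg L)"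
        and x: "x \<in> carrier (coalg (comod_tensor R (comod_tensor R (Q N P) (Q M N)) (Q L M)))"
    show "snd (ev L P) l (snd ?l x) = snd (ev L P) l (snd ?r x)"
      using x comp_eval_assoc[OF m' is_amodD(2)[OF P] k' pairingD(3)[OF ev_pairing(2)[OF L P] l],
          where eE="snd (ev M P)" and eD="snd (ev L M) l" and eA="snd (ev N P)"
              and eB="snd (ev M N)" and eF="snd (ev L N) l", rule_format]
      by (simp add: Comod_sel comod_cmp_def comod_id_def compose_def comod_tensor_sel
          tensor_coalgebra_simps tmap_restrict m' tensor_module tassoc_closed
          comp_spec[OF L M P] comp_spec[OF M N P] comp_spec[OF L N P] comp_spec[OF L M N] e l)
  }
qed

lemma comp_ident_left:
  assumes M: "is_amod R M" and N: "is_amod R N"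
  shows "Cmp (Comod R) (comod_tensor R (unit_comod R) (Q M N)) (comod_tensor R (Q N N) (Q M N))
      (Q M N)
      (comp M N N) (TArr (Comod R) (unit_comod R) (Q M N) (Q N N) (Q M N) (ident N)
          (Idn (Comod R) (Q M N)))
    = Lunit (Comod R) (Q M N)"
    (is "?l = ?r")
proof (rule universal_pairing_eqI[OF universal[OF M N]])
  note q = Q_comod[OF M N] Q_comod[OF N N] is_comod_unit[OF cring]
  note t = is_comod_tensor
  show "is_comod R (comod_tensor R (unit_comod R) (Q M N))" by (intro t q)
  show "?l \<in> comod_arrs R (comod_tensor R (unit_comod R) (Q M N)) (Q M N)"
    unfolding Comod_sel(3,4)
    by (rule comod_cmp_arr[OF _ _ _ comod_tarr_arr];
        (intro t q comp_spec ident_spec comod_id_arr M N)?)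
  show "?r \<in> comod_arrs R (comod_tensor R (unit_comod R) (Q M N)) (Q M N)"
    by (rule comod_lunit_arr[OF q(1)])
  note m = q(1,2)[THEN is_comodD(1)] and m' = q(1,2)[THEN is_comodD(2)] and u
      = module_unit[OF cring]
  {
    fix l x assume l: "l \<in> carrier (space M)"
        and x: "x \<in> carrier (cospace (comod_tensor R (unit_comod R) (Q M N)))"
    note e = pairingD(3)[OF ev_pairing(1)[OF M N] l]
    note eval = comp_eval_lunit[OF m(2,1) is_amodD(1)[OF N] ident_lin(1)[OF N] comp_lin(1)[OF M N N]
        e, rule_format]
    show "fst (ev M N) l (fst ?l x) = fst (ev M N) l (fst ?r x)"
      using x by (simp add: eval comp_spec[OF M N N] ident_spec[OF N]
          rlinear_closed[OF ident_lin(1)[OF N]] Scalar_closed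
          pairingD(5)[OF ev_pairing(1)[OF M N] l] l Comod_sel comod_cmp_def comod_id_def compose_def
          comod_tensor_sel unit_comod_sel tmap_restrict m u)
  }
  {
    fix l x assume l: "l \<in> carrier (alg M)"
        and x: "x \<in> carrier (coalg (comod_tensor R (unit_comod R) (Q M N)))"
    note e = pairingD(3)[OF ev_pairing(2)[OF M N] l]
    note eval = comp_eval_lunit[OF m'(2,1) is_amodD(2)[OF N] ident_lin(2)[OF N]
        comp_lin(2)[OF M N N] e, rule_format]
    show "snd (ev M N) l (snd ?l x) = snd (ev M N) l (snd ?r x)"
      using x by (simp add: eval comp_spec[OF M N N] ident_spec[OF N]
          rlinear_closed[OF ident_lin(2)[OF N]] Scalar_closed
          pairingD(5)[OF ev_pairing(2)[OF M N] l] l Comod_sel comod_cmp_def comod_id_def compose_def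
          comod_tensor_sel unit_comod_sel tensor_coalgebra_simps unit_coalgebra_simps tmap_restrict
          m' u)
  }
qed

lemma comp_ident_right:
  assumes M: "is_amod R M" and N: "is_amod R N"
  shows "Cmp (Comod R) (comod_tensor R (Q M N) (unit_comod R)) (comod_tensor R (Q M N) (Q M M))
      (Q M N)
      (comp M M N) (TArr (Comod R) (Q M N) (unit_comod R) (Q M N) (Q M M) (Idn (Comod R) (Q M N))
          (ident M))
    = Runit (Comod R) (Q M N)"
    (is "?l = ?r")
proof (rule universal_pairing_eqI[OF universal[OF M N]])
  note q = Q_comod[OF M N] Q_comod[OF M M] is_comod_unit[OF cring]
  note t = is_comod_tensor
  show "is_comod R (comod_tensor R (Q M N) (unit_comod R))" by (intro t q)
  show "?l \<in> comod_arrs R (comod_tensor R (Q M N) (unit_comod R)) (Q M N)"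
    unfolding Comod_sel(3,4)
    by (rule comod_cmp_arr[OF _ _ _ comod_tarr_arr];
        (intro t q comp_spec ident_spec comod_id_arr M N)?)
  show "?r \<in> comod_arrs R (comod_tensor R (Q M N) (unit_comod R)) (Q M N)"
    by (rule comod_runit_arr[OF q(1)])
  note m = q(1,2)[THEN is_comodD(1)] and m' = q(1,2)[THEN is_comodD(2)] and u
      = module_unit[OF cring]
  {
    fix l x assume l: "l \<in> carrier (space M)"
        and x: "x \<in> carrier (cospace (comod_tensor R (Q M N) (unit_comod R)))"
    note e = pairingD(3)[OF ev_pairing(1)[OF M N] l]
    note eval = comp_eval_runit[OF m(2,1) is_amodD(1)[OF N] ident_lin(1)[OF M] comp_lin(1)[OF M M N]
        e, rule_format]
    \<comment> \<open>On this side the identity multiplies the argument \<open>l\<close> of the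
      evaluation by the scalar, and linearity of the pairing in that argument brings the scalar out.
      On the left side the identity multiplies the value directly.\<close>
    show "fst (ev M N) l (fst ?l x) = fst (ev M N) l (fst ?r x)"
      using x by (simp add: eval comp_spec[OF M M N] ident_spec[OF M]
          rlinear_closed[OF ident_lin(1)[OF M]] Scalar_closed
          rlinear_smult[OF pairingD(4)[OF ev_pairing(1)[OF M N]]] l Comod_sel comod_cmp_def
          comod_id_def compose_def comod_tensor_sel unit_comod_sel tmap_restrict m u)
  }
  {
    fix l x assume l: "l \<in> carrier (alg M)"
        and x: "x \<in> carrier (coalg (comod_tensor R (Q M N) (unit_comod R)))"
    note e = pairingD(3)[OF ev_pairing(2)[OF M N] l]
    note eval = comp_eval_runit[OF m'(2,1) is_amodD(2)[OF N] ident_lin(2)[OF M]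
        comp_lin(2)[OF M M N] e, rule_format]
    show "snd (ev M N) l (snd ?l x) = snd (ev M N) l (snd ?r x)"
      using x by (simp add: eval comp_spec[OF M M N] ident_spec[OF M]
          rlinear_closed[OF ident_lin(2)[OF M]] Scalar_closed
          rlinear_smult[OF pairingD(4)[OF ev_pairing(2)[OF M N]]] l Comod_sel comod_cmp_def
          comod_id_def compose_def comod_tensor_sel unit_comod_sel tensor_coalgebra_simps
          unit_coalgebra_simps tmap_restrict m' u)
  }
qed

lemma enriched_category_K: "enriched_category (Comod R) K"
proof (intro enriched_category.intro monoidal_category_Comod cring enriched_category_axioms.intro;
    unfold K_sel Comod_sel(1,2,5,6) mem_Collect_eq)
qed (simp_all only: Q_comod comp_spec(1) ident_spec(1) comp_assoc comp_ident_left comp_ident_right)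

section \<open>The underlying category\<close>

definition underlying_fun where
  "underlying_fun M N u = (unit_value R (space M) (\<lambda>m a. fst (ev M N) m (fst u a)), unit_value R
      (alg M) (\<lambda>m a. snd (ev M N) m (snd u a)))"

text \<open>An arrow \<open>u\<close> from the unit is turned into a morphism by evaluating
  \<open>ev M N\<close> at the elements \<open>u(1)\<close> of comodule and coalgebra. Here this is
  factored as \<open>unit_value\<close> after \<open>Hom_pull\<close>, each of which is a bijection
  on the arrows concerned.\<close>

lemma underlying_fun_pull:
  "underlying_fun M N u = (unit_value R (space M) (fst (Hom_pull M (unit_comod R) (ev M N) u)),
      unit_value R (alg M) (snd (Hom_pull M (unit_comod R) (ev M N) u)))"
proof -
  have "\<one>\<^bsub>R\<^esub> \<in> carrier R" by (rule one_closed[OF module_ring_module[OF cring]])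
  then show ?thesis
    by (auto simp: underlying_fun_def unit_value_def Hom_pull_def unit_comod_sel
        unit_coalgebra_simps Scalar_closed intro!: restrict_ext)
qed

lemma underlying_fun_bij:
  assumes M: "is_amod R M" and N: "is_amod R N"
  shows "bij_betw (underlying_fun M N) (comod_arrs R (unit_comod R) (Q M N)) (mod_arrs R M N)"
proof -
  let ?I = "unit_comod R :: ('r, 'x) comod"
  let ?V = "\<lambda>w :: ('m \<Rightarrow> ('r, 'x) univ \<Rightarrow> 'm) \<times> ('a \<Rightarrow> ('r, 'x) univ \<Rightarrow> 'a).
      (unit_value R (space M) (fst w), unit_value R (alg M) (snd w))"
  let ?U = "\<lambda>w. (unit_pairing R (space M) (space N) (fst w) :: 'm \<Rightarrow> ('r, 'x) univ \<Rightarrow> 'm,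
    unit_pairing R (alg M) (alg N) (snd w) :: 'a \<Rightarrow> ('r, 'x) univ \<Rightarrow> 'a)"
  note m = is_amodD(1,2)[OF M] is_amodD(1,2)[OF N]
  have 1: "\<one>\<^bsub>R\<^esub> \<in> carrier R" by (rule one_closed[OF module_ring_module[OF cring]])
  \<comment> \<open>Evaluation at 1 and extension by scalars are mutually inverse: one composite is
    the identity because \<open>1 x = x\<close>, the other because a pairing over the unit is
    determined by its values at 1.\<close>
  have "bij_betw ?V (mod_arrs R M (Hom_amod R ?I N)) (mod_arrs R M N)"
  proof (rule bij_betw_byWitness[where f'="?U"])
    show "?V ` mod_arrs R M (Hom_amod R ?I N) \<subseteq> mod_arrs R M N"
      using unit_value_arr[OF M N] by auto
    show "?U ` mod_arrs R M N \<subseteq> mod_arrs R M (Hom_amod R ?I N)"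
      using unit_pairing_arr[OF M N] by auto
    show "\<forall>w\<in>mod_arrs R M N. ?V (?U w) = w"
    proof
      fix w assume w: "w \<in> mod_arrs R M N"
      then have l: "fst w \<in> lin R (space M) (space N)" "snd w \<in> lin R (alg M) (alg N)"
          by (auto simp: mod_arrs_iff)
      show "?V (?U w) = w"
        by (rule prod_eqI; rule extensionalityI[OF _ linD(2)[OF l(1)]]
            extensionalityI[OF _ linD(2)[OF l(2)]])
          (auto simp: unit_value_def unit_pairing_def Scalar_closed 1 module_one m
              lin_closed[OF l(1)] lin_closed[OF l(2)])
    qed
    show "\<forall>w\<in>mod_arrs R M (Hom_amod R ?I N). ?U (?V w) = w"
    proof
      fix w :: "('m \<Rightarrow> ('r, 'x) univ \<Rightarrow> 'm) \<times> ('a \<Rightarrow> ('r, 'x) univ \<Rightarrow> 'a)"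
      assume "w \<in> mod_arrs R M (Hom_amod R ?I N)"
      then have p: "pairing R (space M) (unit_module R) (space N) (fst w)"
          "pairing R (alg M) (unit_module R) (alg N) (snd w)"
        by (auto simp: Hom_arrs_iff[OF M] unit_comod_sel
            replace_module_pairing[OF same_module_unit_coalgebra])
      then show "?U (?V w) = w" using m by (simp add: unit_pairing_unit_value)
    qed
  qed
  moreover have "bij_betw (Hom_pull M ?I (ev M N)) (comod_arrs R ?I (Q M N))
      (mod_arrs R M (Hom_amod R ?I N))"
    using universal[OF M N] by (simp add: universal_pairing_def is_comod_unit[OF cring])
  ultimately have "bij_betw (?V \<circ> Hom_pull M ?I (ev M N)) (comod_arrs R ?I (Q M N))
      (mod_arrs R M N)"
    by (rule bij_betw_trans[rotated])
  moreover have "?V \<circ> Hom_pull M ?I (ev M N) = underlying_fun M N"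
    by (rule ext) (simp add: underlying_fun_pull)
  ultimately show ?thesis by simp
qed

text \<open>Composition in \<open>underlying_cat\<close> starts with the inverse of the left unit
  constraint, and \<open>inv_arr\<close> is a definite description. Uniqueness of inverses in a
  category identifies it with \<open>r \<mapsto> 1 \<otimes> r\<close> on both components.\<close>

lemma inv_arr_unit:
  "inv_arr (Comod R) (comod_tensor R (unit_comod R) (unit_comod R)) (unit_comod R)
      (Lunit (Comod R) (unit_comod R) :: ('r, 'x) comod_arr)
    = (lin_lunit_inv R (unit_module R), lin_lunit_inv R (unit_module R))"
proof -
  let ?I = "unit_comod R :: ('r, 'x) comod"
  interpret category "Comod R :: (('r, 'x) comod, ('r, 'x) comod_arr) moncat"
      by (rule category_Comod)
  note I = is_comod_unit[OF cring]
  have inv: "inverse_arr (Comod R) (comod_tensor R ?I ?I) ?I (Lunit (Comod R) ?I)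
      (lin_lunit_inv R (unit_module R), lin_lunit_inv R (unit_module R))"
    using comod_lunit_inverse[OF I]
        by (simp add: unit_comod_sel) (simp add: lin_lunit_inv_def unit_coalgebra_simps)
  have uniq: "g = g'" if g: "inverse_arr (Comod R) X Y f g" "inverse_arr (Comod R) X Y f g'"
      and XY: "X \<in> Obj (Comod R)" "Y \<in> Obj (Comod R)" for X Y :: "('r, 'x) comod" and f g g'
  proof -
    have "g = Cmp (Comod R) Y X X (Cmp (Comod R) X Y X g' f) g"
      using g XY cmp_id_left by (simp add: inverse_arr_def)
    also have "\<dots> = Cmp (Comod R) Y Y X g' (Cmp (Comod R) Y X Y f g)"
      using g XY cmp_assoc[of Y X Y X g f g'] by (simp add: inverse_arr_def)
    also have "\<dots> = g'" using g XY cmp_id_right by (simp add: inverse_arr_def)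
    finally show ?thesis .
  qed
  show ?thesis
    unfolding inv_arr_def
    by (rule the_equality, rule inv, rule uniq[OF _ inv])
        (simp_all add: Comod_sel(1) I is_comod_tensor)
qed

lemma underlying_cat_iso: "iso_over_objects (underlying_cat (Comod R) K) (Mod R) underlying_fun"
  unfolding iso_over_objects_def
proof (intro conjI ballI)
  have 1: "\<one>\<^bsub>R\<^esub> \<in> carrier R" by (rule one_closed[OF module_ring_module[OF cring]])
  have sel: "Obj (underlying_cat (Comod R) K) = {M. is_amod R M}"
      "Idn (underlying_cat (Comod R) K) = ident"
    "Arr (underlying_cat (Comod R) K) M N = comod_arrs R (unit_comod R) (Q M N)" for M N
    by (simp_all add: underlying_cat_def K_sel Comod_sel)
  have selM: "Obj (Mod R) = {M. is_amod R M}" "Idn (Mod R) M = mod_id M"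
      "Arr (Mod R) M N = mod_arrs R M N"
    "Cmp (Mod R) L M N v u = mod_cmp L v u" for L M N :: "('r, 'a, 'm) amod" and u v
    by (simp_all add: Mod_def)
  show "Obj (underlying_cat (Comod R) K) = Obj (Mod R)" by (simp add: sel selM)
  {
    fix M N assume "M \<in> Obj (underlying_cat (Comod R) K)" "N \<in> Obj (underlying_cat (Comod R) K)"
    then show "bij_betw (underlying_fun M N) (Arr (underlying_cat (Comod R) K) M N)
        (Arr (Mod R) M N)"
      by (simp add: sel selM underlying_fun_bij)
  }
  {
    fix M assume "M \<in> Obj (underlying_cat (Comod R) K)"
    then have M: "is_amod R M" by (simp add: sel)
    show "underlying_fun M M (Idn (underlying_cat (Comod R) K) M) = Idn (Mod R) M"
      by (simp add: sel selM underlying_fun_def unit_value_def mod_id_def ident_spec[OF M] 1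
          module_one is_amodD[OF M] cong: restrict_cong)
  }
  fix L M N u v
  assume "L \<in> Obj (underlying_cat (Comod R) K)" "M \<in> Obj (underlying_cat (Comod R) K)"
      "N \<in> Obj (underlying_cat (Comod R) K)"
    and "u \<in> Arr (underlying_cat (Comod R) K) L M" "v \<in> Arr (underlying_cat (Comod R) K) M N"
  then have L: "is_amod R L" and M: "is_amod R M" and N: "is_amod R N"
    and u: "u \<in> comod_arrs R (unit_comod R) (Q L M)"
        and v: "v \<in> comod_arrs R (unit_comod R) (Q M N)"
    by (simp_all add: sel)
  note I = is_comod_unit[OF cring] and U = module_unit[OF cring]
  note us = arr_simps[OF I Q_comod[OF L M] u, unfolded unit_comod_sel unit_coalgebra_simps]
    and vs = arr_simps[OF I Q_comod[OF M N] v, unfolded unit_comod_sel unit_coalgebra_simps]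
  note m = is_comodD(1,2)[OF Q_comod[OF L M]] is_comodD(1,2)[OF Q_comod[OF M N]]
  \<comment> \<open>It suffices to follow the scalar 1: the inverse unit constraint sends it to
    \<open>1 \<otimes> 1\<close>, and the tensor product of the two arrows sends that to
    \<open>v(1) \<otimes> u(1)\<close>.\<close>
  have cmp: "fst (Cmp (underlying_cat (Comod R) K) L M N v u) (Scalar \<one>\<^bsub>R\<^esub>)
      = fst (comp L M N) (pure R (cospace (Q M N)) (cospace (Q L M)) (fst v (Scalar \<one>\<^bsub>R\<^esub>))
          (fst u (Scalar \<one>\<^bsub>R\<^esub>)))"
    "snd (Cmp (underlying_cat (Comod R) K) L M N v u) (Scalar \<one>\<^bsub>R\<^esub>)
      = snd (comp L M N) (pure R (coalg (Q M N)) (coalg (Q L M)) (snd v (Scalar \<one>\<^bsub>R\<^esub>))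
          (snd u (Scalar \<one>\<^bsub>R\<^esub>)))"
    by (simp_all add: underlying_cat_def K_sel Comod_sel(5,6) inv_arr_unit)
      (simp_all add: Comod_sel comod_cmp_def compose_def comod_tensor_sel tensor_coalgebra_simps
          unit_comod_sel unit_coalgebra_simps
        lin_lunit_inv_def Scalar_closed 1 pure_closed tmap_pure U m us vs)
  \<comment> \<open>Evaluating the composite at \<open>l\<close> gives \<open>ev M N\<close> of
    \<open>ev L M l (u(1))\<close> at \<open>v(1)\<close>, which is the map belonging to
    \<open>v\<close> applied to the value of the map belonging to \<open>u\<close>.\<close>
  show "underlying_fun L N (Cmp (underlying_cat (Comod R) K) L M N v u)
      = Cmp (Mod R) L M N (underlying_fun M N v) (underlying_fun L M u)"
    using ev_pairing[OF L M, THEN pairingD(5)]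
    by (auto simp: selM underlying_fun_def unit_value_def mod_cmp_def compose_def cmp
        comp_spec[OF L M N] us vs Scalar_closed 1 intro!: restrict_ext)
qed

end

theorem proposition7p2:
  fixes R :: "'r ring"
    and Q :: "('r, 'a, 'm) amod \<Rightarrow> ('r, 'a, 'm) amod \<Rightarrow> ('r, 'x) comod"
  assumes "cring R"
    and "\<And>M N. M \<in> Obj (Mod R) \<Longrightarrow> N \<in> Obj (Mod R) \<Longrightarrow> universal_measuring_comodule R M N (Q M N)"
  shows "\<exists>K :: (('r, 'a, 'm) amod, ('r, 'x) comod, ('r, 'x) comod_arr) ecat.
    enriched_category (Comod R) K \<and>
    EObj K = Obj (Mod R) \<and>
    (\<forall>M\<in>Obj (Mod R). \<forall>N\<in>Obj (Mod R). EHom K M N = Q M N) \<and>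
    (\<exists>F. iso_over_objects (underlying_cat (Comod R) K) (Mod R) F)"
proof -
  \<comment> \<open>The assumption provides bijections only; for each pair of modules a universal
    pairing is chosen among those given by \<open>universal_pairing_exists\<close>.\<close>
  let ?ev = "\<lambda>M N. SOME e. universal_pairing R M N (Q M N) e"
  interpret measuring_family R Q ?ev
  proof (rule measuring_family.intro)
    fix M N :: "('r, 'a, 'm) amod" assume "is_amod R M" "is_amod R N"
    then show "universal_pairing R M N (Q M N) (?ev M N)"
      using assms(2) by (intro someI_ex[OF universal_pairing_exists]) (simp_all add: Mod_def)
  qed (rule assms(1))
  show ?thesis
    using enriched_category_K underlying_cat_iso by (intro exI[of _ K]) (auto simp: K_def)
qed

end
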